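(* Let $M=\mathrm{Inv}\langle X|R\rangle$ be a finitely presented Adian inverse semigroup whose presentation satisfies condition $(\star)$ and whose bi-sided graph $BS(X,R)$ contains no closed path. Then the Schützenberger complex $SC(w)$ is finite for all $w\in (X\cup X^{-1})^*$.
   Context: A positive presentation $\langle X|R\rangle$ consists of a set $X$ and a set $R$ of pairs $(u,v)$ with $u,v\in X^+$, read as relations $u=v$. An $R$-word is a word that is one of the two sides of a relation in $R$. The left graph is the undirected (multi)graph with vertex set $X$ and, for each $(u,v)\in R$, one edge joining the first letter of $u$ to the first letter of $v$; the right graph is defined in the same way using last letters. The presentation is Adian if neither graph contains a cycle (loops and pairs of parallel edges count as cycles). $\mathrm{Inv}\langle X|R\rangle$ is the inverse semigroup generated by $X$ subject to $R$ (an identity is adjoined where needed to interpret the empty word); it is an Adian inverse semigroup if the presentation is Adian. It is finitely presented if $X$ and $R$ are finite. Condition $(\star)$: (1) no proper (nonempty) prefix of an $R$-word is a suffix of itself or of any other $R$-word; (2) no proper (nonempty) suffix of an $R$-word is a prefix of itself or of any other $R$-word. The bi-sided graph $BS(X,R)$ is the directed edge-labeled graph whose vertices are the $R$-words, with an edge from $u$ to $v$ (where $u,v$ are $R$-words, possibly equal) in each of the following cases: (1) $u=xvy$ is a relation of $R$ (read in either order), i.e. $(u,xvy)\in R$ or $(xvy,u)\in R$, for some $x,y\in X^+$; the edge is labeled $(x,y)$. (2) $u\equiv xvy$ as words for some $x,y\in X^+$, with $u,v$ distinct $R$-words; the edge is labeled $(x,y)$. (3) $u=v$ is a relation of $R$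 and neither $u$ nor $v$ contains an $R$-word as a proper subword; then there is a single edge between $u$ and $v$ pointing in both directions, labeled $(\varepsilon,\varepsilon)$ with $\varepsilon$ the empty word. Edges with different labels are different edges. "No closed path" means that $BS(X,R)$ has no closed paths, directed or undirected, i.e. it is a forest (a single bidirectional edge of type (3) is not a closed path). For $M=\mathrm{Inv}\langle X|R\rangle$ and $w\in (X\cup X^{-1})^*$, the Schützenberger graph $S\Gamma(w)$ has vertex set $\{m\in M: mm^{-1}=ww^{-1}\}$ and an edge labeled $x\in X\cup X^{-1}$ from $m$ to $mx$ whenever both lie in this set. The Schützenberger complex $SC(w)$ is the 2-complex with 1-skeleton $S\Gamma(w)$ and, for each $(r,s)\in R$ and each vertex $v$ at which both $r$ and $s$ can be read, a 2-cell whose boundary is the pair of paths labeled $r$ and $s$ starting at $v$. *)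

theory Defs
  imports
    "HOL-Algebra.Group"
    "HOL-Library.Sublist"
    "Graph_Theory.Arc_Walk"
begin

section \<open>Undirected multigraphs\<close>

text \<open>Every edge is incident with a set of one vertex (a loop) or two vertices; distinct edges may
  have the same ends.\<close>

record ('v, 'e) multigraph =
  mverts :: "'v set"
  medges :: "'e set"
  mends  :: "'e \<Rightarrow> 'v set"

text \<open>A cycle \<open>v\<^sub>0, e\<^sub>0, v\<^sub>1, e\<^sub>1, \<dots>, e\<^sub>n\<^sub>-\<^sub>1, v\<^sub>0\<close> repeats neither vertices nor edges. A loop is a
  cycle of length 1, a pair of parallel edges is a cycle of length 2.\<close>

definition is_cycle :: "('v, 'e) multigraph \<Rightarrow> 'v list \<Rightarrow> 'e list \<Rightarrow> bool" where
  "is_cycle G vs es \<longleftrightarrow>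
     es \<noteq> [] \<and> length vs = length es \<and> distinct vs \<and> distinct es \<and>
     set vs \<subseteq> mverts G \<and> set es \<subseteq> medges G \<and>
     (\<forall>i < length es. mends G (es ! i) = {vs ! i, vs ! (Suc i mod length es)})"

definition is_forest :: "('v, 'e) multigraph \<Rightarrow> bool" where
  "is_forest G \<longleftrightarrow> (\<nexists>vs es. is_cycle G vs es)"


section \<open>Positive presentations\<close>

type_synonym 'a relations = "('a list \<times> 'a list) set"

definition positive_presentation :: "'a set \<Rightarrow> 'a relations \<Rightarrow> bool" where
  "positive_presentation X R \<longleftrightarrow>
     (\<forall>(u, v) \<in> R. u \<in> lists X \<and> u \<noteq> [] \<and> v \<in> lists X \<and> v \<noteq> [])"

definition R_words :: "'a relations \<Rightarrow> 'a list set" where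
  "R_words R = fst ` R \<union> snd ` R"

definition left_graph :: "'a set \<Rightarrow> 'a relations \<Rightarrow> ('a, 'a list \<times> 'a list) multigraph" where
  "left_graph X R = \<lparr>mverts = X, medges = R, mends = (\<lambda>(u, v). {hd u, hd v})\<rparr>"

definition right_graph :: "'a set \<Rightarrow> 'a relations \<Rightarrow> ('a, 'a list \<times> 'a list) multigraph" where
  "right_graph X R = \<lparr>mverts = X, medges = R, mends = (\<lambda>(u, v). {last u, last v})\<rparr>"

definition adian :: "'a set \<Rightarrow> 'a relations \<Rightarrow> bool" where
  "adian X R \<longleftrightarrow> is_forest (left_graph X R) \<and> is_forest (right_graph X R)"

text \<open>Only the factor taken from \<open>r\<close> has to be proper; it may be all of the other R-word \<open>s\<close>.\<close>

definition condition_star :: "'a relations \<Rightarrow> bool" where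
  "condition_star R \<longleftrightarrow>
     (\<forall>r \<in> R_words R. \<forall>s \<in> R_words R. \<forall>p. p \<noteq> [] \<and> strict_prefix p r \<longrightarrow> \<not> suffix p s) \<and>
     (\<forall>r \<in> R_words R. \<forall>s \<in> R_words R. \<forall>p. p \<noteq> [] \<and> strict_suffix p r \<longrightarrow> \<not> prefix p s)"


section \<open>The bi-sided graph\<close>

text \<open>An arc is a triple of source, label and target. The bidirectional edges are those labelled
  \<open>([], [])\<close>; such an edge is present as two mutually inverse arcs.\<close>

type_synonym 'a bs_arc = "'a list \<times> ('a list \<times> 'a list) \<times> 'a list"

inductive_set bs_arcs :: "'a relations \<Rightarrow> 'a bs_arc set" for R :: "'a relations" where
  relation:
    "u \<in> R_words R \<Longrightarrow> v \<in> R_words R \<Longrightarrow> x \<noteq> [] \<Longrightarrow> y \<noteq> [] \<Longrightarrow>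
     (u, x @ v @ y) \<in> R \<or> (x @ v @ y, u) \<in> R \<Longrightarrow> (u, (x, y), v) \<in> bs_arcs R"
| subword:
    "u \<in> R_words R \<Longrightarrow> v \<in> R_words R \<Longrightarrow> x \<noteq> [] \<Longrightarrow> y \<noteq> [] \<Longrightarrow>
     u \<noteq> v \<Longrightarrow> u = x @ v @ y \<Longrightarrow> (u, (x, y), v) \<in> bs_arcs R"
| bidirectional:
    "(u, v) \<in> R \<or> (v, u) \<in> R \<Longrightarrow>
     (\<And>z. z \<in> R_words R \<Longrightarrow> \<not> strict_sublist z u \<and> \<not> strict_sublist z v) \<Longrightarrow>
     (u, ([], []), v) \<in> bs_arcs R"

definition bs_graph :: "'a relations \<Rightarrow> ('a list, 'a bs_arc) pre_digraph" where
  "bs_graph R = \<lparr>verts = R_words R, arcs = bs_arcs R,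
                 tail = (\<lambda>(u, l, v). u), head = (\<lambda>(u, l, v). v)\<rparr>"

text \<open>The underlying undirected multigraph, in which the two arcs of a bidirectional edge form a
  single edge: an edge is the set of its arcs.\<close>

fun bs_edge :: "'a bs_arc \<Rightarrow> 'a bs_arc set" where
  "bs_edge (u, l, v) = (if l = ([], []) then {(u, l, v), (v, l, u)} else {(u, l, v)})"

definition bs_multigraph :: "'a relations \<Rightarrow> ('a list, 'a bs_arc set) multigraph" where
  "bs_multigraph R =
     \<lparr>mverts = verts (bs_graph R),
      medges = bs_edge ` arcs (bs_graph R),
      mends = (\<lambda>e. tail (bs_graph R) ` e \<union> head (bs_graph R) ` e)\<rparr>"

definition bs_no_closed_path :: "'a relations \<Rightarrow> bool" where
  "bs_no_closed_path R \<longleftrightarrow> is_forest (bs_multigraph R)"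


section \<open>The inverse semigroup of a presentation\<close>

datatype 'a letter = Pos 'a | Neg 'a

fun inv_letter :: "'a letter \<Rightarrow> 'a letter" where
  "inv_letter (Pos a) = Neg a"
| "inv_letter (Neg a) = Pos a"

definition inv_word :: "'a letter list \<Rightarrow> 'a letter list" where
  "inv_word w = rev (map inv_letter w)"

definition letters :: "'a set \<Rightarrow> 'a letter set" where
  "letters X = Pos ` X \<union> Neg ` X"

abbreviation words :: "'a set \<Rightarrow> 'a letter list set" where
  "words X \<equiv> lists (letters X)"

text \<open>The congruence on \<open>(X \<union> X\<inverse>)\<^sup>*\<close> generated by the Vagner relations and \<open>R\<close>.\<close>

inductive_set inv_cong :: "'a set \<Rightarrow> 'a relations \<Rightarrow> ('a letter list \<times> 'a letter list) set"
  for X :: "'a set" and R :: "'a relations" where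
  refl: "w \<in> words X \<Longrightarrow> (w, w) \<in> inv_cong X R"
| sym: "(u, v) \<in> inv_cong X R \<Longrightarrow> (v, u) \<in> inv_cong X R"
| trans: "(u, v) \<in> inv_cong X R \<Longrightarrow> (v, w) \<in> inv_cong X R \<Longrightarrow> (u, w) \<in> inv_cong X R"
| compat: "(u, v) \<in> inv_cong X R \<Longrightarrow> p \<in> words X \<Longrightarrow> q \<in> words X \<Longrightarrow>
     (p @ u @ q, p @ v @ q) \<in> inv_cong X R"
| regular: "w \<in> words X \<Longrightarrow> (w @ inv_word w @ w, w) \<in> inv_cong X R"
| commute: "u \<in> words X \<Longrightarrow> v \<in> words X \<Longrightarrow>
     (u @ inv_word u @ v @ inv_word v, v @ inv_word v @ u @ inv_word u) \<in> inv_cong X R"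
| relation: "(r, s) \<in> R \<Longrightarrow> (map Pos r, map Pos s) \<in> inv_cong X R"

definition word_class :: "'a set \<Rightarrow> 'a relations \<Rightarrow> 'a letter list \<Rightarrow> 'a letter list set" where
  "word_class X R w = inv_cong X R `` {w}"

text \<open>\<open>Inv\<langle>X|R\<rangle>\<close> with an identity adjoined: for a positive presentation the class of the empty
  word is the singleton \<open>{[]}\<close>.\<close>

definition Inv_pres :: "'a set \<Rightarrow> 'a relations \<Rightarrow> 'a letter list set monoid" where
  "Inv_pres X R =
     \<lparr>carrier = words X // inv_cong X R,
      mult = (\<lambda>A B. \<Union>a \<in> A. \<Union>b \<in> B. word_class X R (a @ b)),
      one = word_class X R []\<rparr>"

text \<open>The inverse in the sense of inverse semigroups (\<open>m_inv\<close> is the inverse of a unit).\<close>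

definition sg_inv :: "('m, 'b) monoid_scheme \<Rightarrow> 'm \<Rightarrow> 'm" where
  "sg_inv M m = (THE n. n \<in> carrier M \<and>
     m \<otimes>\<^bsub>M\<^esub> n \<otimes>\<^bsub>M\<^esub> m = m \<and> n \<otimes>\<^bsub>M\<^esub> m \<otimes>\<^bsub>M\<^esub> n = n)"


section \<open>Schuetzenberger graphs and complexes\<close>

text \<open>An arc is a triple of source, label and target.\<close>

type_synonym 'a schutz_arc = "'a letter list set \<times> 'a letter \<times> 'a letter list set"

definition schutz_verts ::
    "'a set \<Rightarrow> 'a relations \<Rightarrow> 'a letter list \<Rightarrow> 'a letter list set set" where
  "schutz_verts X R w =
     (let M = Inv_pres X R; c = word_class X R w
      in {m \<in> carrier M. m \<otimes>\<^bsub>M\<^esub> sg_inv M m = c \<otimes>\<^bsub>M\<^esub> sg_inv M c})"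

definition schutz_graph ::
    "'a set \<Rightarrow> 'a relations \<Rightarrow> 'a letter list \<Rightarrow>
     ('a letter list set, 'a schutz_arc) pre_digraph" where
  "schutz_graph X R w =
     \<lparr>verts = schutz_verts X R w,
      arcs = {(m, x, n). m \<in> schutz_verts X R w \<and> n \<in> schutz_verts X R w \<and> x \<in> letters X \<and>
                         n = m \<otimes>\<^bsub>Inv_pres X R\<^esub> word_class X R [x]},
      tail = (\<lambda>(m, x, n). m), head = (\<lambda>(m, x, n). n)\<rparr>"

definition reads ::
    "('v, 'v \<times> 'l \<times> 'v) pre_digraph \<Rightarrow> 'v \<Rightarrow> 'l list \<Rightarrow> ('v \<times> 'l \<times> 'v) list \<Rightarrow> bool" where
  "reads G v r p \<longleftrightarrow> (\<exists>v'. pre_digraph.awalk G v p v') \<and> map (\<lambda>(m, x, n). x) p = r"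

text \<open>The boundary of a 2-cell is a pair of edge paths with a common start vertex.\<close>

record ('v, 'e, 'f) two_complex =
  skeleton :: "('v, 'e) pre_digraph"
  faces    :: "'f set"
  boundary :: "'f \<Rightarrow> 'e list \<times> 'e list"

definition finite_complex :: "('v, 'e, 'f) two_complex \<Rightarrow> bool" where
  "finite_complex K \<longleftrightarrow>
     finite (verts (skeleton K)) \<and> finite (arcs (skeleton K)) \<and> finite (faces K)"

text \<open>A word labels at most one path from a given vertex of a Schuetzenberger graph, so the paths
  selected by \<open>THE\<close> are well defined.\<close>

definition schutz_complex ::
    "'a set \<Rightarrow> 'a relations \<Rightarrow> 'a letter list \<Rightarrow>
     ('a letter list set, 'a schutz_arc, 'a letter list set \<times> 'a list \<times> 'a list) two_complex" where
  "schutz_complex X R w =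
     (let G = schutz_graph X R w in
      \<lparr>skeleton = G,
       faces = {(v, r, s). v \<in> verts G \<and> (r, s) \<in> R \<and>
                  (\<exists>p. reads G v (map Pos r) p) \<and> (\<exists>q. reads G v (map Pos s) q)},
       boundary = (\<lambda>(v, r, s). (THE p. reads G v (map Pos r) p, THE q. reads G v (map Pos s) q))\<rparr>)"


section \<open>The construction yields an inverse monoid\<close>

lemma inv_word_words: "w \<in> words X \<Longrightarrow> inv_word w \<in> words X"
proof -
  have "inv_letter l \<in> letters X" if "l \<in> letters X" for l
    using that by (auto simp: letters_def)
  then show "w \<in> words X \<Longrightarrow> inv_word w \<in> words X"
    by (auto simp: inv_word_def in_lists_conv_set)
qed

lemma inv_cong_words:
  assumes "positive_presentation X R" "(u, v) \<in> inv_cong X R"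
  shows "u \<in> words X \<and> v \<in> words X"
  using assms(2)
proof induction
  case (relation r s)
  then have "r \<in> lists X" "s \<in> lists X"
    using assms(1) by (auto simp: positive_presentation_def)
  then show ?case by (auto simp: in_lists_conv_set letters_def)
qed (simp_all add: inv_word_words)

lemma inv_cong_Nil_iff:
  assumes "positive_presentation X R" "(u, v) \<in> inv_cong X R"
  shows "u = [] \<longleftrightarrow> v = []"
  using assms(2)
proof induction
  case (relation r s)
  then show ?case using assms(1) by (auto simp: positive_presentation_def)
qed (auto simp: inv_word_def)

lemma word_class_Nil:
  assumes "positive_presentation X R"
  shows "word_class X R [] = {[]}"
proof -
  have "([], v) \<in> inv_cong X R \<longleftrightarrow> v = []" for v
    using inv_cong_Nil_iff[OF assms, of "[]" v] inv_cong.refl[of "[]" X R] by auto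
  then show ?thesis by (simp add: word_class_def Image_singleton)
qed

lemma equiv_inv_cong:
  assumes "positive_presentation X R"
  shows "equiv (words X) (inv_cong X R)"
proof (rule equivI)
  show "inv_cong X R \<subseteq> words X \<times> words X"
    using inv_cong_words[OF assms] by fast
  show "refl_on (words X) (inv_cong X R)" by (intro refl_onI inv_cong.refl)
  show "sym (inv_cong X R)" by (intro symI) (rule inv_cong.sym)
  show "trans (inv_cong X R)" by (intro transI) (rule inv_cong.trans)
qed

lemma word_class_eq_iff:
  assumes "positive_presentation X R" "u \<in> words X" "v \<in> words X"
  shows "word_class X R u = word_class X R v \<longleftrightarrow> (u, v) \<in> inv_cong X R"
  unfolding word_class_def using eq_equiv_class_iff[OF equiv_inv_cong] assms by metis

lemma inv_cong_append:
  assumes "positive_presentation X R" "(a, a') \<in> inv_cong X R" "(b, b') \<in> inv_cong X R"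
  shows "(a @ b, a' @ b') \<in> inv_cong X R"
proof -
  have "(a @ b, a' @ b) \<in> inv_cong X R"
    using inv_cong.compat[OF assms(2), of "[]" b] inv_cong_words[OF assms(1,3)] by simp
  moreover have "(a' @ b, a' @ b') \<in> inv_cong X R"
    using inv_cong.compat[OF assms(3), of a' "[]"] inv_cong_words[OF assms(1,2)] by simp
  ultimately show ?thesis by (rule inv_cong.trans)
qed

lemma mult_word_class:
  assumes "positive_presentation X R" "u \<in> words X" "v \<in> words X"
  shows "word_class X R u \<otimes>\<^bsub>Inv_pres X R\<^esub> word_class X R v = word_class X R (u @ v)"
proof -
  have "word_class X R (a @ b) = word_class X R (u @ v)"
    if "a \<in> word_class X R u" "b \<in> word_class X R v" for a b
  proof -
    have "(u @ v, a @ b) \<in> inv_cong X R"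
      using that inv_cong_append[OF assms(1)] by (simp add: word_class_def)
    then show ?thesis
      unfolding word_class_def using equiv_class_eq[OF equiv_inv_cong[OF assms(1)]] by metis
  qed
  moreover have "u \<in> word_class X R u" "v \<in> word_class X R v"
    using assms(2,3) by (simp_all add: word_class_def inv_cong.refl)
  ultimately have "(\<Union>a \<in> word_class X R u. \<Union>b \<in> word_class X R v. word_class X R (a @ b)) =
      word_class X R (u @ v)"
    by blast
  then show ?thesis by (simp add: Inv_pres_def)
qed

lemma carrier_Inv_pres: "carrier (Inv_pres X R) = word_class X R ` words X"
  by (auto simp: Inv_pres_def quotient_def word_class_def)

lemma monoid_Inv_pres:
  assumes "positive_presentation X R"
  shows "monoid (Inv_pres X R)"
proof -
  have one: "\<one>\<^bsub>Inv_pres X R\<^esub> = word_class X R []" by (simp add: Inv_pres_def)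
  show ?thesis
    by (rule monoidI; unfold carrier_Inv_pres one; (elim imageE)?;
        simp add: mult_word_class[OF assms])
qed

lemma inv_word_inv_word [simp]: "inv_word (inv_word w) = w"
proof -
  have "inv_letter (inv_letter l) = l" for l :: "'a letter" by (cases l) auto
  then show ?thesis by (simp add: inv_word_def rev_map o_def)
qed

text \<open>Inverses are unique, hence \<open>sg_inv\<close> is the operation induced by formal inversion.\<close>

lemma sg_inv_word_class:
  assumes pp: "positive_presentation X R" and w: "w \<in> words X"
  shows "sg_inv (Inv_pres X R) (word_class X R w) = word_class X R (inv_word w)"
proof -
  let ?M = "Inv_pres X R"
  interpret M: monoid ?M by (rule monoid_Inv_pres[OF pp])
  note mwc = mult_word_class[OF pp]
  have reg: "word_class X R u \<otimes>\<^bsub>?M\<^esub> word_class X R (inv_word u) \<otimes>\<^bsub>?M\<^esub> word_class X R u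
      = word_class X R u" if "u \<in> words X" for u
    using that inv_word_words[OF that] inv_cong.regular[OF that]
    by (simp add: mwc word_class_eq_iff[OF pp])
  have reg': "word_class X R (inv_word u) \<otimes>\<^bsub>?M\<^esub> word_class X R u \<otimes>\<^bsub>?M\<^esub> word_class X R (inv_word u)
      = word_class X R (inv_word u)" if "u \<in> words X" for u
    using reg[OF inv_word_words[OF that]] by simp
  have com: "(word_class X R u \<otimes>\<^bsub>?M\<^esub> word_class X R (inv_word u)) \<otimes>\<^bsub>?M\<^esub>
       (word_class X R v \<otimes>\<^bsub>?M\<^esub> word_class X R (inv_word v))
     = (word_class X R v \<otimes>\<^bsub>?M\<^esub> word_class X R (inv_word v)) \<otimes>\<^bsub>?M\<^esub>
       (word_class X R u \<otimes>\<^bsub>?M\<^esub> word_class X R (inv_word u))"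
    if "u \<in> words X" "v \<in> words X" for u v
    using that inv_word_words[OF that(1)] inv_word_words[OF that(2)] inv_cong.commute[OF that]
    by (simp add: mwc word_class_eq_iff[OF pp])
  have wc: "word_class X R u \<in> carrier ?M" if "u \<in> words X" for u
    using that by (auto simp: carrier_Inv_pres)
  \<comment> \<open>every idempotent has the form \<open>u u\<inverse>\<close>\<close>
  have idem: "\<exists>u \<in> words X. e = word_class X R u \<otimes>\<^bsub>?M\<^esub> word_class X R (inv_word u)"
    if e: "e \<in> carrier ?M" and ee: "e \<otimes>\<^bsub>?M\<^esub> e = e" for e
  proof -
    obtain u where u: "u \<in> words X" "e = word_class X R u"
      using e by (auto simp: carrier_Inv_pres)
    define f where "f = word_class X R (inv_word u)"
    have f: "f \<in> carrier ?M" unfolding f_def by (intro wc inv_word_words u)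
    have efe: "e \<otimes>\<^bsub>?M\<^esub> f \<otimes>\<^bsub>?M\<^esub> e = e" and fef: "f \<otimes>\<^bsub>?M\<^esub> e \<otimes>\<^bsub>?M\<^esub> f = f"
      using reg[OF u(1)] reg'[OF u(1)] by (simp_all add: u(2) f_def)
    have c: "(f \<otimes>\<^bsub>?M\<^esub> e) \<otimes>\<^bsub>?M\<^esub> (e \<otimes>\<^bsub>?M\<^esub> f) = (e \<otimes>\<^bsub>?M\<^esub> f) \<otimes>\<^bsub>?M\<^esub> (f \<otimes>\<^bsub>?M\<^esub> e)"
      using com[OF inv_word_words[OF u(1)] u(1)] by (simp add: u(2) f_def)
    have "f = f \<otimes>\<^bsub>?M\<^esub> (e \<otimes>\<^bsub>?M\<^esub> e) \<otimes>\<^bsub>?M\<^esub> f" by (simp add: ee fef)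
    also have "\<dots> = (e \<otimes>\<^bsub>?M\<^esub> f) \<otimes>\<^bsub>?M\<^esub> (f \<otimes>\<^bsub>?M\<^esub> e)" using e f c by (simp add: M.m_assoc)
    finally have 1: "f = e \<otimes>\<^bsub>?M\<^esub> (f \<otimes>\<^bsub>?M\<^esub> (f \<otimes>\<^bsub>?M\<^esub> e))" using e f by (simp add: M.m_assoc)
    have "e \<otimes>\<^bsub>?M\<^esub> f = f"
      using arg_cong[OF 1, of "\<lambda>z. e \<otimes>\<^bsub>?M\<^esub> z"] 1 e f ee by (metis M.m_assoc M.m_closed)
    moreover have "f \<otimes>\<^bsub>?M\<^esub> e = f"
      using 1 e f ee by (metis M.m_assoc M.m_closed)
    ultimately have "e = f" using efe e f by (metis M.m_assoc)
    then have "e = e \<otimes>\<^bsub>?M\<^esub> f" using ee by simp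
    then show ?thesis using u f_def by auto
  qed
  define m where "m = word_class X R w"
  define n where "n = word_class X R (inv_word w)"
  have mn: "m \<in> carrier ?M" "n \<in> carrier ?M" "m \<otimes>\<^bsub>?M\<^esub> n \<otimes>\<^bsub>?M\<^esub> m = m" "n \<otimes>\<^bsub>?M\<^esub> m \<otimes>\<^bsub>?M\<^esub> n = n"
    unfolding m_def n_def using w wc inv_word_words reg reg' by blast+
  have "k = n" if k: "k \<in> carrier ?M" "m \<otimes>\<^bsub>?M\<^esub> k \<otimes>\<^bsub>?M\<^esub> m = m" "k \<otimes>\<^bsub>?M\<^esub> m \<otimes>\<^bsub>?M\<^esub> k = k" for k
  proof -
    have icomm: "e \<otimes>\<^bsub>?M\<^esub> f = f \<otimes>\<^bsub>?M\<^esub> e"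
      if "e \<in> carrier ?M" "f \<in> carrier ?M" "e \<otimes>\<^bsub>?M\<^esub> e = e" "f \<otimes>\<^bsub>?M\<^esub> f = f" for e f
      using idem[OF that(1,3)] idem[OF that(2,4)] com by auto
    have id: "(m \<otimes>\<^bsub>?M\<^esub> k) \<otimes>\<^bsub>?M\<^esub> (m \<otimes>\<^bsub>?M\<^esub> k) = m \<otimes>\<^bsub>?M\<^esub> k" "(m \<otimes>\<^bsub>?M\<^esub> n) \<otimes>\<^bsub>?M\<^esub> (m \<otimes>\<^bsub>?M\<^esub> n) = m \<otimes>\<^bsub>?M\<^esub> n"
      "(k \<otimes>\<^bsub>?M\<^esub> m) \<otimes>\<^bsub>?M\<^esub> (k \<otimes>\<^bsub>?M\<^esub> m) = k \<otimes>\<^bsub>?M\<^esub> m" "(n \<otimes>\<^bsub>?M\<^esub> m) \<otimes>\<^bsub>?M\<^esub> (n \<otimes>\<^bsub>?M\<^esub> m) = n \<otimes>\<^bsub>?M\<^esub> m"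
      using mn k by (metis M.m_assoc M.m_closed)+
    have 1: "(m \<otimes>\<^bsub>?M\<^esub> k) \<otimes>\<^bsub>?M\<^esub> (m \<otimes>\<^bsub>?M\<^esub> n) = (m \<otimes>\<^bsub>?M\<^esub> n) \<otimes>\<^bsub>?M\<^esub> (m \<otimes>\<^bsub>?M\<^esub> k)"
      using id mn k by (intro icomm) auto
    have 2: "(k \<otimes>\<^bsub>?M\<^esub> m) \<otimes>\<^bsub>?M\<^esub> (n \<otimes>\<^bsub>?M\<^esub> m) = (n \<otimes>\<^bsub>?M\<^esub> m) \<otimes>\<^bsub>?M\<^esub> (k \<otimes>\<^bsub>?M\<^esub> m)"
      using id mn k by (intro icomm) auto
    have 3: "m \<otimes>\<^bsub>?M\<^esub> k = m \<otimes>\<^bsub>?M\<^esub> n" using 1 mn k by (metis M.m_assoc M.m_closed)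
    have 4: "k \<otimes>\<^bsub>?M\<^esub> m = n \<otimes>\<^bsub>?M\<^esub> m" using 2 mn k by (metis M.m_assoc M.m_closed)
    show "k = n" using 3 4 mn k by (metis M.m_assoc)
  qed
  then have "sg_inv ?M m = n"
    unfolding sg_inv_def using mn by (intro the_equality) blast+
  then show ?thesis by (simp add: m_def n_def)
qed

end

theory Submission
  imports Defs
begin

text \<open>Let \<open>S\<close> be the semigroup with the given presentation. Condition \<open>(\<star>)\<close> and the absence of
  closed paths make the occurrences of R-words in a word pairwise disjoint or nested to depth one, and
  a rewriting step moves one innermost occurrence along an edge of the forest \<open>BS(X, R)\<close>. A potential
  on this forest therefore bounds the length of the words equal to a given word in \<open>S\<close>, so that the
  classes of positive words are finite.

  As the left and right graphs are forests, \<open>S\<close> is cancellative, elements with a common multiple have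
  a least one, and elements with pairwise common multiples have a common multiple (a median of the
  three first letters in the left graph divides everything). Dehornoy's reduction of multifractions is
  then convergent, and \<open>S\<close> embeds into the group with the same presentation.

  Finally, every edge of the Schuetzenberger graph of \<open>w\<close> lies on a positive path between two of the
  finitely many vertices of the path labelled \<open>w\<close>. Two positive paths with the same ends have labels
  that are equal in the group, hence in \<open>S\<close>, and so there are only finitely many of them.\<close>

section \<open>Walks\<close>

text \<open>Elements of \<open>S\<close> need not have common multiples, so \<open>S\<close> need
  not have a group of simple fractions. Hence multifractions: a reduction uses a common multiple
  only where one is at hand, and the condition on three elements is what makes reduction confluent.
  The obstacle that calls for the embedding is that two labels of positive paths between the same
  vertices are known to agree only behind a prefix with inverse letters; such a prefix can be
  removed where the letters act by bijections, as they do on classes of multifractions. A second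
  action serves the Schuetzenberger graph itself. Its vertices are not built by expansions and
  foldings; instead the edges on positive paths define partial injections that respect the
  relations, so every word congruent to \<open>w @ inv_word w\<close> can be traversed along these
  edges. The left-sided arguments use only the left graph and the finiteness of classes, so the
  right-sided ones follow by reversing all words.\<close>

fun walk :: "('w \<times> 'w) set \<Rightarrow> ('w \<Rightarrow> 'v) \<Rightarrow> 'v \<Rightarrow> ('w \<times> 'w) list \<Rightarrow> 'v \<Rightarrow> bool" where
  "walk D f x [] y \<longleftrightarrow> x = y"
| "walk D f x (d # ds) y \<longleftrightarrow> d \<in> D \<and> f (fst d) = x \<and> walk D f (f (snd d)) ds y"

definition reduced :: "('w \<times> 'w) list \<Rightarrow> bool" where
  "reduced = successively (\<lambda>d d'. d' \<noteq> prod.swap d)"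

text \<open>A step is an oriented relation and \<open>f\<close> reads off its ends, so
  \<open>hd\<close>, \<open>last\<close> and \<open>core\<close> turn the same set \<open>D\<close>
  into the left graph, the right graph and a subgraph of the bi-sided graph. Reduced closed walks
  fit derivations better than simple cycles do.\<close>

definition walk_forest :: "('w \<times> 'w) set \<Rightarrow> ('w \<Rightarrow> 'v) \<Rightarrow> bool" where
  "walk_forest D f \<longleftrightarrow> (\<forall>x ds. walk D f x ds x \<longrightarrow> reduced ds \<longrightarrow> ds = [])"

lemma walk_append:
  "walk D f x (ds @ es) y \<longleftrightarrow> (\<exists>z. walk D f x ds z \<and> walk D f z es y)"
  by (induction ds arbitrary: x) auto

lemma walk_end_unique: "walk D f x ds y \<Longrightarrow> walk D f x ds z \<Longrightarrow> y = z"
  by (induction ds arbitrary: x) auto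

lemma walk_rev:
  assumes "sym D"
  shows "walk D f x ds y \<Longrightarrow> walk D f y (rev (map prod.swap ds)) x"
  using assms by (induction ds arbitrary: x) (auto simp: walk_append sym_def)

lemma walk_nth_snd:
  "walk D f x ds y \<Longrightarrow> i < length ds \<Longrightarrow>
    f (snd (ds ! i)) = (if Suc i < length ds then f (fst (ds ! Suc i)) else y)"
proof (induction ds arbitrary: x i)
  case (Cons d ds)
  show ?case
  proof (cases i)
    case 0
    then show ?thesis using Cons.prems by (cases ds) auto
  next
    case (Suc j)
    then show ?thesis using Cons by auto
  qed
qed simp

lemma reduced_append: "reduced (ds @ es) \<longleftrightarrow> reduced ds \<and> reduced es \<and>
    (ds \<noteq> [] \<longrightarrow> es \<noteq> [] \<longrightarrow> hd es \<noteq> prod.swap (last ds))"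
  by (auto simp: reduced_def successively_append_iff)

lemma reduced_Nil [simp]: "reduced []" by (simp add: reduced_def)

lemma reduced_Cons: "reduced (d # ds) \<longleftrightarrow> reduced ds \<and> (ds \<noteq> [] \<longrightarrow> hd ds \<noteq> prod.swap d)"
  by (auto simp: reduced_def successively_Cons)

lemma reduced_rev: "reduced ds \<Longrightarrow> reduced (rev (map prod.swap ds))"
  by (auto simp: reduced_def successively_map elim!: successively_mono)

lemma not_reduced_decomp:
  "\<not> reduced ds \<Longrightarrow> \<exists>as d bs. ds = as @ d # prod.swap d # bs"
proof (induction ds)
  case (Cons d ds)
  show ?case
  proof (cases "reduced ds")
    case True
    then obtain bs where "ds = prod.swap d # bs"
      using Cons.prems by (cases ds) (auto simp: reduced_Cons)
    then show ?thesis by (metis append_Nil)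
  next
    case False
    then show ?thesis using Cons.IH by (metis append_Cons)
  qed
qed simp

text \<open>A shortest nonempty reduced closed walk is a simple cycle: a repeated vertex cuts out a
  shorter one, and a repeated edge means a repeated vertex or, if traversed backwards, two
  consecutive inverse steps.\<close>

lemma walk_forestI:
  assumes forest: "is_forest G"
    and edge: "\<And>d. d \<in> D \<Longrightarrow> \<epsilon> d \<in> medges G \<and> mends G (\<epsilon> d) = {f (fst d), f (snd d)} \<and>
                 f (fst d) \<in> mverts G"
    and inj: "\<And>d d'. d \<in> D \<Longrightarrow> d' \<in> D \<Longrightarrow> \<epsilon> d = \<epsilon> d' \<Longrightarrow> d' = d \<or> d' = prod.swap d"
  shows "walk_forest D f"
proof (rule ccontr)
  let ?P = "\<lambda>ds. ds \<noteq> [] \<and> reduced ds \<and> (\<exists>x. walk D f x ds x)"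
  assume "\<not> walk_forest D f"
  then have "\<exists>ds. ?P ds" by (auto simp: walk_forest_def)
  then obtain ds where ds: "?P ds" and min: "\<And>es. ?P es \<Longrightarrow> length ds \<le> length es"
    using ex_has_least_nat[of ?P _ length] by metis
  from ds obtain x where w: "walk D f x ds x" and ne: "ds \<noteq> []" and red: "reduced ds" by auto
  have inD: "d \<in> D" if "d \<in> set ds" for d
  proof -
    have "walk D f x es y \<Longrightarrow> d \<in> set es \<Longrightarrow> d \<in> D" for es x y
      by (induction es arbitrary: x) auto
    from this[OF w that] show ?thesis .
  qed
  let ?n = "length ds"
  let ?vs = "map (f \<circ> fst) ds"
  have dist: "distinct ?vs"
  proof (rule ccontr)
    assume "\<not> distinct ?vs"
    then obtain as bs cs v where "?vs = as @ [v] @ bs @ [v] @ cs"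
      using not_distinct_decomp by blast
    then obtain A d B d' C where d: "ds = A @ d # B @ d' # C" "f (fst d) = v" "f (fst d') = v"
      by (auto simp: map_eq_append_conv map_eq_Cons_conv append_eq_map_conv Cons_eq_map_conv)
    have "walk D f v (d # B) v" using w d by (auto simp: walk_append)
    moreover have "reduced (d # B)"
      using red d(1) reduced_append[of A "(d # B) @ d' # C"] reduced_append[of "d # B" "d' # C"]
      by simp
    ultimately have "length ds \<le> length (d # B)" by (intro min) auto
    then show False using d by simp
  qed
  have src: "f (fst (ds ! i)) = ?vs ! i" if "i < ?n" for i using that by simp
  have snd: "f (snd (ds ! i)) = ?vs ! (Suc i mod ?n)" if "i < ?n" for i
  proof -
    have "x = f (fst (ds ! 0))" using w ne by (cases ds) auto
    then show ?thesis
      using walk_nth_snd[OF w that] that ne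
      by (cases "Suc i = ?n") auto
  qed
  have disteps: "\<epsilon> (ds ! i) \<noteq> \<epsilon> (ds ! j)" if ij: "i < j" "j < ?n" for i j
  proof
    assume "\<epsilon> (ds ! i) = \<epsilon> (ds ! j)"
    then have "ds ! j = ds ! i \<or> ds ! j = prod.swap (ds ! i)" using inj inD ij by simp
    then show False
    proof
      assume "ds ! j = ds ! i"
      then have "?vs ! i = ?vs ! j" using ij by simp
      then show False using nth_eq_iff_index_eq[OF dist, of i j] ij by simp
    next
      assume sw: "ds ! j = prod.swap (ds ! i)"
      then have "?vs ! j = ?vs ! (Suc i mod ?n)" using src[of j] snd[of i] ij by simp
      \<comment> \<open>The reversed edge leaves the vertex that step \<open>i\<close> enters; as
        vertices do not repeat, it is the very next step.\<close>
      then have "j = Suc i mod ?n"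
        using nth_eq_iff_index_eq[OF dist, of j "Suc i mod ?n"] ij by simp
      then have "j = Suc i" using ij by simp
      moreover have "ds ! Suc i \<noteq> prod.swap (ds ! i)"
        using red reduced_append[of "take (Suc i) ds" "drop (Suc i) ds"] ij \<open>j = Suc i\<close> ne
        by (simp add: hd_drop_conv_nth last_conv_nth min_def)
      ultimately show False using sw by simp
    qed
  qed
  have ed: "\<epsilon> d \<in> medges G" "f (fst d) \<in> mverts G" if "d \<in> set ds" for d
    using edge[OF inD[OF that]] by simp_all
  have "is_cycle G ?vs (map \<epsilon> ds)"
    unfolding is_cycle_def
  proof (intro conjI allI impI)
    show "distinct (map \<epsilon> ds)"
      unfolding distinct_conv_nth
    proof (intro allI impI)
      fix i j assume "i < length (map \<epsilon> ds)" "j < length (map \<epsilon> ds)" "i \<noteq> j"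
      then show "map \<epsilon> ds ! i \<noteq> map \<epsilon> ds ! j"
        using disteps[of i j] disteps[of j i] by (cases "i < j") auto
    qed
    show "set ?vs \<subseteq> mverts G" "set (map \<epsilon> ds) \<subseteq> medges G" using ed by auto
    fix i assume "i < length (map \<epsilon> ds)"
    then have i: "i < ?n" by simp
    then have "mends G (map \<epsilon> ds ! i) = {f (fst (ds ! i)), f (snd (ds ! i))}"
      using edge[OF inD[of "ds ! i"]] by simp
    then show "mends G (map \<epsilon> ds ! i) = {?vs ! i, ?vs ! (Suc i mod length (map \<epsilon> ds))}"
      unfolding src[OF i] snd[OF i] length_map .
  qed (use ne dist in auto)
  then show False using forest by (auto simp: is_forest_def)
qed

text \<open>Where two reduced walks with the same ends first differ, going back along one remainder
  and forth along the other is a nonempty reduced closed walk.\<close>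

lemma reduced_walk_unique:
  assumes "walk_forest D f" "sym D"
  shows "walk D f x ds y \<Longrightarrow> reduced ds \<Longrightarrow> walk D f x es y \<Longrightarrow> reduced es \<Longrightarrow> ds = es"
proof (induction ds arbitrary: x es)
  case Nil
  then show ?case using assms by (auto simp: walk_forest_def)
next
  case (Cons d ds)
  show ?case
  proof (cases es)
    case Nil
    then show ?thesis using Cons.prems assms by (metis walk.simps(1) walk_forest_def)
  next
    case (Cons e es')
    have "e = d"
    proof (rule ccontr)
      assume "e \<noteq> d"
      let ?w = "rev (map prod.swap (d # ds)) @ es"
      have "walk D f y ?w y"
        using walk_rev[OF assms(2) Cons.prems(1)] Cons.prems(3) by (auto simp: walk_append)
      moreover have "reduced ?w"
        using reduced_rev[OF Cons.prems(2)] Cons.prems(4) \<open>e \<noteq> d\<close> Cons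
        by (subst reduced_append) (auto simp: last_rev hd_map)
      ultimately show False using assms by (auto simp: walk_forest_def)
    qed
    then show ?thesis using Cons Cons.prems Cons.IH by (auto simp: reduced_Cons)
  qed
qed

text \<open>The branching point \<open>m\<close> of the two walks is the median of \<open>x\<close>,
  \<open>y\<close>, \<open>z\<close>: without the common part \<open>ks\<close> the remainders join
  without backtracking, so \<open>m\<close> also lies on the reduced walk from \<open>y\<close> to
  \<open>z\<close>.\<close>

lemma reduced_walks_median:
  assumes "sym D" "walk D f x ds y" "reduced ds" "walk D f x es z" "reduced es"
  obtains ks ds' es' m where "ds = ks @ ds'" "es = ks @ es'" "walk D f x ks m"
    "walk D f y (rev (map prod.swap ds')) m" "walk D f m es' z"
    "reduced (rev (map prod.swap ds') @ es')"
proof -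
  obtain ks ds' es' where k: "ds = ks @ ds'" "es = ks @ es'" "ds' = [] \<or> es' = [] \<or> hd ds' \<noteq> hd es'"
    using longest_common_prefix[of ds es] by (metis hd_Cons_tl list.sel(1))
  obtain m where m: "walk D f x ks m" "walk D f m ds' y" using assms(2) k by (auto simp: walk_append)
  have m': "walk D f m es' z" using assms(4) k m(1) walk_end_unique by (metis walk_append)
  have "reduced (rev (map prod.swap ds'))" "reduced es'"
    using assms(3,5) k by (auto simp: reduced_append intro: reduced_rev)
  then have "reduced (rev (map prod.swap ds') @ es')"
    using k(3) by (subst reduced_append) (auto simp: last_rev hd_map)
  then show thesis using that k m m' walk_rev[OF assms(1) m(2)] by blast
qed

text \<open>Along a closed walk of a forest the increments cancel, so they integrate to a potential.\<close>

lemma walk_forest_potential: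
  fixes g :: "'w \<Rightarrow> int"
  assumes forest: "walk_forest D f" and "sym D"
  obtains h where "\<And>r s. (r, s) \<in> D \<Longrightarrow> g r + h (f r) = g s + h (f s)"
proof -
  define wt where "wt ds = sum_list (map (\<lambda>d. g (fst d) - g (snd d)) ds)" for ds :: "('w \<times> 'w) list"
  have wt_rev: "wt (rev (map prod.swap ds)) = - wt ds" for ds
    by (induction ds) (auto simp: wt_def)
  have closed: "wt ds = 0" if "walk D f x ds x" for ds x
    using that
  proof (induction ds rule: length_induct)
    case (1 ds)
    show ?case
    proof (cases "ds = []")
      case False
      then have "\<not> reduced ds" using forest 1 by (auto simp: walk_forest_def)
      then obtain as d bs where ds: "ds = as @ d # prod.swap d # bs"
        using not_reduced_decomp by blast
      then have "walk D f x (as @ bs) x" using 1 by (auto simp: walk_append)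
      then have "wt (as @ bs) = 0" using 1 ds by simp
      then show ?thesis by (simp add: wt_def ds)
    qed (simp add: wt_def)
  qed
  \<comment> \<open>One vertex is fixed in each component; minus the weight of a walk to it is the
    potential, independent of the walk because closed walks have weight zero.\<close>
  define C where "C v = {u. \<exists>ds. walk D f v ds u}" for v
  define root where "root v = (SOME u. u \<in> C v)" for v
  have root: "\<exists>ds. walk D f v ds (root v)" for v
  proof -
    have "walk D f v [] v" by simp
    then have "v \<in> C v" unfolding C_def by blast
    then have "root v \<in> C v" unfolding root_def by (rule someI)
    then show ?thesis by (simp add: C_def)
  qed
  define pth where "pth v = (SOME ds. walk D f v ds (root v))" for v
  have pth: "walk D f v (pth v) (root v)" for v
    unfolding pth_def using root by (rule someI_ex)
  have "g r + - wt (pth (f r)) = g s + - wt (pth (f s))" if d: "(r, s) \<in> D" for r s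
  proof -
    have e: "walk D f (f r) [(r, s)] (f s)" "walk D f (f s) [(s, r)] (f r)"
      using d assms(2) by (auto simp: sym_def)
    have "C (f r) = C (f s)" unfolding C_def using e walk_append by (metis (no_types, lifting))
    then have eq: "root (f r) = root (f s)" by (simp add: root_def)
    have "walk D f (f r) ([(r, s)] @ pth (f s) @ rev (map prod.swap (pth (f r)))) (f r)"
      using e(1) pth[of "f s"] walk_rev[OF assms(2) pth[of "f r"]] eq by (auto simp: walk_append)
    from closed[OF this] show ?thesis using wt_rev[of "pth (f r)"] by (simp add: wt_def)
  qed
  then show thesis using that[of "\<lambda>v. - wt (pth v)"] by blast
qed

section \<open>The congruence of a semigroup presentation\<close>

definition rstep :: "'a relations \<Rightarrow> 'a relations" where
  "rstep D = {(p @ r @ q, p @ s @ q) | p q r s. (r, s) \<in> D}"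

text \<open>No symmetric closure is taken: \<open>D\<close> will contain every relation in both
  orientations, so that a rewriting step is also an oriented step of a walk.\<close>

definition scong :: "'a relations \<Rightarrow> 'a relations" where
  "scong D = (rstep D)\<^sup>*"

lemma scong_refl [simp]: "(u, u) \<in> scong D"
  by (simp add: scong_def)

lemma scong_trans [trans]: "(u, v) \<in> scong D \<Longrightarrow> (v, w) \<in> scong D \<Longrightarrow> (u, w) \<in> scong D"
  unfolding scong_def by (rule rtrancl_trans)

lemma scong_sym: "sym D \<Longrightarrow> (u, v) \<in> scong D \<Longrightarrow> (v, u) \<in> scong D"
proof -
  assume "sym D"
  then have "sym (rstep D)" by (fastforce simp: sym_def rstep_def)
  then show "(u, v) \<in> scong D \<Longrightarrow> (v, u) \<in> scong D"
    unfolding scong_def by (meson sym_rtrancl symD)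
qed

lemma scong_context: "(u, v) \<in> scong D \<Longrightarrow> (p @ u @ q, p @ v @ q) \<in> scong D"
  unfolding scong_def
proof (induction rule: rtrancl_induct)
  case (step v w)
  then obtain a b r s where "v = a @ r @ b" "w = a @ s @ b" "(r, s) \<in> D"
    by (auto simp: rstep_def)
  then have "((p @ a) @ r @ (b @ q), (p @ a) @ s @ (b @ q)) \<in> rstep D"
    unfolding rstep_def by blast
  then have "(p @ v @ q, p @ w @ q) \<in> rstep D"
    using \<open>v = _\<close> \<open>w = _\<close> by simp
  with step.IH show ?case by (rule rtrancl_into_rtrancl)
qed simp

lemma scong_append:
  "(u, u') \<in> scong D \<Longrightarrow> (v, v') \<in> scong D \<Longrightarrow> (u @ v, u' @ v') \<in> scong D"
  using scong_context[of u u' D "[]" v] scong_context[of v v' D u' "[]"] scong_trans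
  by fastforce

lemma scong_rel: "(r, s) \<in> D \<Longrightarrow> (r, s) \<in> scong D"
proof -
  assume "(r, s) \<in> D"
  then have "([] @ r @ [], [] @ s @ []) \<in> rstep D" unfolding rstep_def by blast
  then show ?thesis by (auto simp: scong_def)
qed

section \<open>Finiteness of the classes of positive words\<close>

locale bs_presentation =
  fixes X :: "'a set" and R D :: "'a relations"
  assumes pp: "positive_presentation X R"
    and finX: "finite X" and finR: "finite R"
    and adian: "adian X R"
    and star: "condition_star R"
    and forest: "bs_no_closed_path R"
    and D_def: "D = R \<union> R\<inverse>"
begin

lemma sym_D: "sym D"
  by (auto simp: D_def sym_def)

lemma D_words:
  assumes "(r, s) \<in> D"
  shows "r \<noteq> []" "s \<noteq> []" "r \<in> lists X" "s \<in> lists X" "r \<in> R_words R" "s \<in> R_words R"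
  using assms pp by (force simp: D_def positive_presentation_def R_words_def)+

lemma R_words_nonempty: "r \<in> R_words R \<Longrightarrow> r \<noteq> []"
  using pp by (auto simp: R_words_def positive_presentation_def)

lemma D_edge:
  assumes "d \<in> D"
  shows "(if d \<in> R then d else prod.swap d) \<in> R"
  using assms by (auto simp: D_def)

lemma walk_forest_hd: "walk_forest D hd"
proof (rule walk_forestI)
  show "is_forest (left_graph X R)" using adian by (simp add: adian_def)
  fix d assume d: "d \<in> D"
  have "fst d \<noteq> []" "fst d \<in> lists X" using D_words[of "fst d" "snd d"] d by auto
  then have "hd (fst d) \<in> X" by (simp add: in_lists_conv_set)
  then show "(if d \<in> R then d else prod.swap d) \<in> medges (left_graph X R) \<and>
     mends (left_graph X R) (if d \<in> R then d else prod.swap d) = {hd (fst d), hd (snd d)} \<and>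
     hd (fst d) \<in> mverts (left_graph X R)"
    using D_edge[OF d] by (auto simp: left_graph_def split: prod.splits)
next
  fix d d' :: "'a list \<times> 'a list"
  assume "(if d \<in> R then d else prod.swap d) = (if d' \<in> R then d' else prod.swap d')"
  then show "d' = d \<or> d' = prod.swap d" by (cases d; cases d') (auto split: if_splits)
qed

lemma walk_forest_last: "walk_forest D last"
proof (rule walk_forestI)
  show "is_forest (right_graph X R)" using adian by (simp add: adian_def)
  fix d assume d: "d \<in> D"
  have "fst d \<noteq> []" "fst d \<in> lists X" using D_words[of "fst d" "snd d"] d by auto
  then have "last (fst d) \<in> X" by (simp add: in_lists_conv_set)
  then show "(if d \<in> R then d else prod.swap d) \<in> medges (right_graph X R) \<and>
     mends (right_graph X R) (if d \<in> R then d else prod.swap d) = {last (fst d), last (snd d)} \<and>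
     last (fst d) \<in> mverts (right_graph X R)"
    using D_edge[OF d] by (auto simp: right_graph_def split: prod.splits)
next
  fix d d' :: "'a list \<times> 'a list"
  assume "(if d \<in> R then d else prod.swap d) = (if d' \<in> R then d' else prod.swap d')"
  then show "d' = d \<or> d' = prod.swap d" by (cases d; cases d') (auto split: if_splits)
qed

lemma D_hd_neq: "(r, s) \<in> D \<Longrightarrow> hd r \<noteq> hd s"
proof
  assume "(r, s) \<in> D" "hd r = hd s"
  then have "walk D hd (hd r) [(r, s)] (hd r)" by simp
  moreover have "reduced [(r, s)]" by (simp add: reduced_def)
  ultimately show False using walk_forest_hd unfolding walk_forest_def by blast
qed

section \<open>Containment and overlap of R-words\<close>

definition nest :: "'a list \<Rightarrow> 'a list \<Rightarrow> 'a list \<Rightarrow> 'a list \<Rightarrow> bool" where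
  "nest u x v y \<longleftrightarrow> u \<in> R_words R \<and> v \<in> R_words R \<and> u = x @ v @ y \<and> x \<noteq> [] \<and> y \<noteq> []"

lemma star_suffix_prefix:
  assumes "x @ c \<in> R_words R" "c @ y \<in> R_words R" "x \<noteq> []" "c \<noteq> []"
  shows False
proof -
  have "strict_suffix c (x @ c)" "prefix c (c @ y)"
    using assms by (auto simp: strict_suffix_def suffix_def)
  then show False using star assms unfolding condition_star_def by blast
qed

lemma star_prefix_suffix:
  assumes "x @ c \<in> R_words R" "c @ y \<in> R_words R" "y \<noteq> []" "c \<noteq> []"
  shows False
proof -
  have "strict_prefix c (c @ y)" "suffix c (x @ c)"
    using assms by (auto simp: strict_prefix_def suffix_def)
  then show False using star assms unfolding condition_star_def by blast
qed

text \<open>If only \<open>x\<close> were empty, \<open>v\<close> would be a proper prefix of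
  \<open>u\<close> and a suffix of the R-word \<open>v\<close>, against condition star; the case of
  \<open>y\<close> is dual. So proper containment is strict at both ends.\<close>

lemma nestI:
  assumes "u \<in> R_words R" "v \<in> R_words R" "u = x @ v @ y" "x \<noteq> [] \<or> y \<noteq> []"
  shows "nest u x v y"
proof -
  have "x \<noteq> []"
    using star_prefix_suffix[of "[]" v y] assms R_words_nonempty by auto
  moreover have "y \<noteq> []"
    using star_suffix_prefix[of x v "[]"] assms R_words_nonempty by auto
  ultimately show ?thesis using assms by (simp add: nest_def)
qed

text \<open>The word \<open>t2\<close> starts inside \<open>t1\<close>. By condition star no proper
  suffix of \<open>t1\<close> is a prefix of \<open>t2\<close>, so one of them contains the other,
  and \<open>t2\<close> can contain \<open>t1\<close> only if both start together.\<close>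

lemma overlap:
  assumes "t1 @ q1 = z @ t2 @ q2" "length z < length t1" "t1 \<in> R_words R" "t2 \<in> R_words R"
  shows "(\<exists>c. t1 = z @ t2 @ c) \<or> z = [] \<and> (\<exists>c. t2 = t1 @ c)"
proof -
  obtain a where a: "t1 = z @ a" "a @ q1 = t2 @ q2"
    using assms(1,2) by (auto simp: append_eq_append_conv2)
  with assms(2) have "a \<noteq> []" by auto
  from a(2) consider c where "a = t2 @ c" | c where "t2 = a @ c"
    by (auto simp: append_eq_append_conv2)
  then show ?thesis
  proof cases
    case 2
    then show ?thesis using a(1) assms star_suffix_prefix[of z a c] \<open>a \<noteq> []\<close> by auto
  qed (use a in auto)
qed

section \<open>Short closed paths in the bi-sided graph\<close>

lemma bs_medge: "(u, l, v) \<in> bs_arcs R \<Longrightarrow> l \<noteq> ([], []) \<Longrightarrow> {(u, l, v)} \<in> medges (bs_multigraph R)"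
  using image_eqI[of "{(u, l, v)}" bs_edge "(u, l, v)" "bs_arcs R"]
  by (simp add: bs_multigraph_def bs_graph_def)

lemma bs_mends: "mends (bs_multigraph R) {(u, l, v)} = {u, v}"
  by (simp add: bs_multigraph_def bs_graph_def insert_commute)

lemma bs_mverts: "mverts (bs_multigraph R) = R_words R"
  by (simp add: bs_multigraph_def bs_graph_def)

lemma bs_square:
  assumes "(u, l, v) \<in> bs_arcs R" "(w, l, v) \<in> bs_arcs R" "(w, l', v') \<in> bs_arcs R" "(u, l', v') \<in> bs_arcs R"
    "l \<noteq> ([], [])" "l' \<noteq> ([], [])" "u \<noteq> w" "v \<noteq> v'" "u \<notin> {v, v'}" "w \<notin> {v, v'}"
    "{u, v, w, v'} \<subseteq> R_words R"
  shows False
proof -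
  have "is_cycle (bs_multigraph R) [u, v, w, v'] [{(u, l, v)}, {(w, l, v)}, {(w, l', v')}, {(u, l', v')}]"
    unfolding is_cycle_def
  proof (intro conjI allI impI)
    show "set [{(u, l, v)}, {(w, l, v)}, {(w, l', v')}, {(u, l', v')}] \<subseteq> medges (bs_multigraph R)"
      using assms by (simp add: bs_medge)
  next
    fix i assume "i < length [{(u, l, v)}, {(w, l, v)}, {(w, l', v')}, {(u, l', v')}]"
    then consider "i = 0" | "i = 1" | "i = 2" | "i = 3" by fastforce
    then show "mends (bs_multigraph R) ([{(u, l, v)}, {(w, l, v)}, {(w, l', v')}, {(u, l', v')}] ! i) =
      {[u, v, w, v'] ! i, [u, v, w, v'] ! (Suc i mod length [{(u, l, v)}, {(w, l, v)}, {(w, l', v')}, {(u, l', v')}])}"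
      by cases (simp_all add: bs_mends insert_commute)
  qed (use assms in \<open>auto simp: bs_mverts bs_mends\<close>)
  then show False using forest by (auto simp: bs_no_closed_path_def is_forest_def)
qed

lemma bs_parallel:
  assumes "(u, l, v) \<in> bs_arcs R" "(u, l', v) \<in> bs_arcs R" "l \<noteq> ([], [])" "l' \<noteq> ([], [])"
    "l \<noteq> l'" "u \<noteq> v" "{u, v} \<subseteq> R_words R"
  shows False
proof -
  have "is_cycle (bs_multigraph R) [u, v] [{(u, l, v)}, {(u, l', v)}]"
    unfolding is_cycle_def
  proof (intro conjI allI impI)
    show "set [{(u, l, v)}, {(u, l', v)}] \<subseteq> medges (bs_multigraph R)"
      using assms by (simp add: bs_medge)
  next
    fix i assume "i < length [{(u, l, v)}, {(u, l', v)}]"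
    then consider "i = 0" | "i = 1" by fastforce
    then show "mends (bs_multigraph R) ([{(u, l, v)}, {(u, l', v)}] ! i) =
      {[u, v] ! i, [u, v] ! (Suc i mod length [{(u, l, v)}, {(u, l', v)}])}"
      by cases (simp_all add: bs_mends insert_commute)
  qed (use assms in \<open>auto simp: bs_mverts bs_mends\<close>)
  then show False using forest by (auto simp: bs_no_closed_path_def is_forest_def)
qed

lemma bs_loop:
  assumes "(u, l, u) \<in> bs_arcs R" "l \<noteq> ([], [])" "u \<in> R_words R"
  shows False
proof -
  have "is_cycle (bs_multigraph R) [u] [{(u, l, u)}]"
    unfolding is_cycle_def
  proof (intro conjI allI impI)
    show "set [{(u, l, u)}] \<subseteq> medges (bs_multigraph R)"
      using assms by (simp add: bs_medge)
  qed (use assms in \<open>auto simp: bs_mverts bs_mends\<close>)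
  then show False using forest by (auto simp: bs_no_closed_path_def is_forest_def)
qed

lemma nest_shorter: "nest u x v y \<Longrightarrow> length v < length u"
  by (auto simp: nest_def)

lemma nest_arc:
  assumes "nest u x v y"
  shows "(u, (x, y), v) \<in> bs_arcs R"
proof (rule bs_arcs.subword)
  show "u \<noteq> v" using nest_shorter[OF assms] by blast
qed (use assms in \<open>auto simp: nest_def\<close>)

text \<open>Each containment in \<open>u\<close> shows up twice in the bi-sided graph: as an arc
  from \<open>u\<close> itself and, with the same label, as an arc from the other side
  \<open>w\<close> of a relation. This doubling creates the closed paths used below.\<close>

lemma nest_arc': "(u, w) \<in> D \<Longrightarrow> nest u x v y \<Longrightarrow> (w, (x, y), v) \<in> bs_arcs R"
  by (rule bs_arcs.relation) (auto simp: nest_def D_def R_words_def image_iff intro: rev_bexI)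

lemma nest_neq:
  assumes "(u, w) \<in> D" "nest u x v y"
  shows "u \<noteq> v \<and> w \<noteq> v"
proof -
  have "(w, (x, y), v) \<in> bs_arcs R" "w \<in> R_words R" "x \<noteq> []"
    using nest_arc'[OF assms] D_words[OF assms(1)] assms(2) by (simp_all add: nest_def)
  then have "w \<noteq> v" using bs_loop[of w "(x, y)"] by auto
  then show ?thesis using nest_shorter[OF assms(2)] by auto
qed

lemma R_word_partner:
  assumes "u \<in> R_words R"
  obtains w where "(u, w) \<in> D"
proof -
  have "\<exists>w. (u, w) \<in> D" using assms by (auto simp: R_words_def D_def)
  then show thesis using that by blast
qed

text \<open>Two different inner words would close the square \<open>u\<close>, \<open>v\<close>,
  \<open>w\<close>, \<open>v'\<close> with a partner \<open>w\<close> of \<open>u\<close>; two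
  positions of the same inner word would be parallel arcs from \<open>u\<close>.\<close>

lemma nest_unique:
  assumes "nest u x v y" "nest u x' v' y'"
  shows "x = x' \<and> v = v' \<and> y = y'"
proof -
  obtain w where w: "(u, w) \<in> D" using R_word_partner assms(1) by (auto simp: nest_def)
  note ne = nest_neq[OF w assms(1)] nest_neq[OF w assms(2)]
  have uw: "u \<noteq> w" using D_hd_neq[OF w] by auto
  have RW: "u \<in> R_words R" "w \<in> R_words R" "v \<in> R_words R" "v' \<in> R_words R"
    using assms D_words[OF w] by (auto simp: nest_def)
  have xy: "(x, y) \<noteq> ([], [])" "(x', y') \<noteq> ([], [])" using assms by (auto simp: nest_def)
  have "v = v'"
    using bs_square[OF nest_arc[OF assms(1)] nest_arc'[OF w assms(1)] nest_arc'[OF w assms(2)]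
        nest_arc[OF assms(2)] xy uw] ne RW by auto
  moreover have "(x, y) = (x', y')"
    using bs_parallel[OF nest_arc[OF assms(1)] _ xy] nest_arc[OF assms(2)] \<open>v = v'\<close> ne RW by auto
  ultimately show ?thesis by simp
qed

text \<open>Each inner word would be joined to both sides of the relation, which is again a square.
  If the inner words coincide, the two arcs from \<open>u\<close> are parallel, with different
  labels because \<open>u\<close> and \<open>w\<close> differ.\<close>

lemma nest_not_both:
  assumes D: "(u, w) \<in> D" and "nest u x v y" "nest w x' v' y'"
  shows False
proof -
  have D': "(w, u) \<in> D" using D sym_D by (auto simp: sym_def)
  note ne = nest_neq[OF D assms(2)] nest_neq[OF D' assms(3)]
  have uw: "hd u \<noteq> hd w" using D_hd_neq[OF D] .
  have RW: "u \<in> R_words R" "w \<in> R_words R" "v \<in> R_words R" "v' \<in> R_words R"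
    using assms D_words[OF D] by (auto simp: nest_def)
  have xy: "(x, y) \<noteq> ([], [])" "(x', y') \<noteq> ([], [])" using assms by (auto simp: nest_def)
  have "v = v'"
    using bs_square[OF nest_arc[OF assms(2)] nest_arc'[OF D assms(2)] nest_arc[OF assms(3)]
        nest_arc'[OF D' assms(3)] xy] ne RW uw by auto
  moreover have "(x, y) \<noteq> (x', y')" using assms(2,3) uw by (auto simp: nest_def)
  ultimately show False
    using bs_parallel[OF nest_arc[OF assms(2)] _ xy] nest_arc'[OF D' assms(3)] ne RW by auto
qed

section \<open>Cores of R-words\<close>

definition nested :: "'a list \<Rightarrow> bool" where
  "nested u \<longleftrightarrow> (\<exists>x v y. nest u x v y)"

definition pre :: "'a list \<Rightarrow> 'a list" where
  "pre u = (if nested u then SOME x. \<exists>v y. nest u x v y else [])"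

definition core :: "'a list \<Rightarrow> 'a list" where
  "core u = (if nested u then SOME v. \<exists>x y. nest u x v y else u)"

definition post :: "'a list \<Rightarrow> 'a list" where
  "post u = (if nested u then SOME y. \<exists>x v. nest u x v y else [])"

lemma nest_parts:
  assumes "nest u x v y"
  shows "pre u = x" "core u = v" "post u = y"
proof -
  have n: "nested u" using assms by (auto simp: nested_def)
  show "pre u = x" unfolding pre_def using n assms nest_unique by (auto intro!: some_equality)
  show "core u = v" unfolding core_def using n assms nest_unique by (auto intro!: some_equality)
  show "post u = y" unfolding post_def using n assms nest_unique by (auto intro!: some_equality)
qed

lemma nested_nest: "nested u \<Longrightarrow> nest u (pre u) (core u) (post u)"
  using nest_parts by (fastforce simp: nested_def)

lemma parts: "u = pre u @ core u @ post u"
  using nested_nest[of u] by (cases "nested u") (auto simp: nest_def pre_def core_def post_def)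

definition minimal_words :: "'a list set" where
  "minimal_words = {m \<in> R_words R. \<not> nested m}"

text \<open>Nesting has depth one: an R-word properly inside \<open>core u\<close> would be another
  one inside \<open>u\<close>, against uniqueness.\<close>

lemma core_minimal:
  assumes "u \<in> R_words R"
  shows "core u \<in> minimal_words"
proof (cases "nested u")
  case True
  have n: "nest u (pre u) (core u) (post u)" using nested_nest[OF True] .
  have "\<not> nested (core u)"
  proof
    assume "nested (core u)"
    then have c: "nest (core u) (pre (core u)) (core (core u)) (post (core u))"
      by (rule nested_nest)
    then have "nest u (pre u @ pre (core u)) (core (core u)) (post (core u) @ post u)"
      using n unfolding nest_def by (metis append.assoc append_is_Nil_conv)
    then have "core (core u) = core u" using nest_unique[OF n] by metis
    then show False using nest_shorter[OF c] by simp
  qed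
  then show ?thesis using n by (auto simp: minimal_words_def nest_def)
qed (use assms in \<open>auto simp: minimal_words_def core_def\<close>)

text \<open>A relation becomes an edge between the cores of its sides. At most one side is nested;
  its inner word is then the target of an arc from the other side, which is its own core. If no side
  is nested, the edge is bidirectional. Label and target spell out the nested side, so the edge
  determines the relation up to orientation.\<close>

lemma walk_forest_core: "walk_forest D core"
proof -
  define \<epsilon> where "\<epsilon> = (\<lambda>(r, s). if nested s then {(r, (pre s, post s), core s)}
     else if nested r then {(s, (pre r, post r), core r)} else bs_edge (r, ([], []), s))"
  have lab: "(pre s, post s) \<noteq> ([], [])" if "nested s" for s
    using nested_nest[OF that] by (auto simp: nest_def)
  show ?thesis
  proof (rule walk_forestI[where \<epsilon> = \<epsilon>])
    show "is_forest (bs_multigraph R)" using forest by (simp add: bs_no_closed_path_def)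
  next
    fix d assume d: "d \<in> D"
    obtain r s where rs: "d = (r, s)" by (cases d)
    have D: "(r, s) \<in> D" "(s, r) \<in> D" using d rs sym_D by (auto simp: sym_def)
    have core: "core (fst d) \<in> R_words R"
      using core_minimal[of r] D_words(5)[OF D(1)] rs by (auto simp: minimal_words_def)
    consider (s) "nested s" "\<not> nested r" | (r) "nested r" "\<not> nested s" | (n) "\<not> nested r" "\<not> nested s"
      using nest_not_both[OF D(1)] unfolding nested_def by metis
    then show "\<epsilon> d \<in> medges (bs_multigraph R) \<and>
         mends (bs_multigraph R) (\<epsilon> d) = {core (fst d), core (snd d)} \<and>
         core (fst d) \<in> mverts (bs_multigraph R)"
    proof cases
      case s
      have "(r, (pre s, post s), core s) \<in> bs_arcs R"
        by (rule nest_arc'[OF D(2) nested_nest[OF s(1)]])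
      then show ?thesis using s bs_medge[OF _ lab[OF s(1)]] core rs
        by (simp add: \<epsilon>_def bs_mends bs_mverts core_def[of r])
    next
      case r
      have "(s, (pre r, post r), core r) \<in> bs_arcs R"
        by (rule nest_arc'[OF D(1) nested_nest[OF r(1)]])
      then show ?thesis using r bs_medge[OF _ lab[OF r(1)]] core rs
        by (auto simp: \<epsilon>_def bs_mends bs_mverts core_def[of s])
    next
      case n
      have no: "\<not> strict_sublist z u" if "u \<in> {r, s}" "z \<in> R_words R" for u z
      proof
        assume "strict_sublist z u"
        then obtain x y where xy: "u = x @ z @ y" "z \<noteq> u"
          by (auto simp: sublist_def sublist_order.less_le)
        have "u \<in> R_words R" using that D_words[OF D(1)] by auto
        then have "nest u x z y" using xy that by (intro nestI) auto
        then show False using n that by (auto simp: nested_def)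
      qed
      have "(r, ([], []), s) \<in> bs_arcs R"
        using no D by (intro bs_arcs.bidirectional) (auto simp: D_def)
      then have "bs_edge (r, ([], []), s) \<in> bs_edge ` bs_arcs R" by blast
      then show ?thesis using n core rs
        by (auto simp: \<epsilon>_def bs_multigraph_def bs_graph_def core_def)
    qed
  next
    fix d d' assume d: "d \<in> D" "d' \<in> D" and eq: "\<epsilon> d = \<epsilon> d'"
    obtain r s r' s' where rs: "d = (r, s)" "d' = (r', s')" by (cases d; cases d')
    have eqI: "u = v" if "pre u = pre v" "core u = core v" "post u = post v" for u v
      using parts[of u] parts[of v] that by simp
    show "d' = d \<or> d' = prod.swap d"
      using eq lab[of s] lab[of r] lab[of s'] lab[of r'] unfolding rs \<epsilon>_def
      by (auto simp: doubleton_eq_iff split: if_splits dest: eqI)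
  qed
qed

section \<open>Occurrences of minimal words and the bound on lengths\<close>

definition occ :: "'a list \<Rightarrow> ('a list \<times> 'a list \<times> 'a list) set" where
  "occ w = {(p, m, q). m \<in> minimal_words \<and> w = p @ m @ q}"

lemma finite_occ: "finite (occ w)"
proof -
  have "occ w \<subseteq> (\<lambda>(i, j). (take i w, take j (drop i w), drop (i + j) w)) ` ({..length w} \<times> {..length w})"
  proof
    fix t assume "t \<in> occ w"
    then obtain p m q where "t = (p, m, q)" "w = p @ m @ q" by (auto simp: occ_def)
    then show "t \<in> (\<lambda>(i, j). (take i w, take j (drop i w), drop (i + j) w)) ` ({..length w} \<times> {..length w})"
      by (intro image_eqI[of _ _ "(length p, length m)"]) auto
  qed
  then show ?thesis by (rule finite_subset) auto
qed

text \<open>A minimal occurrence cannot straddle an end of \<open>r\<close> by condition star,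
  cannot properly contain \<open>r\<close> by minimality, and inside \<open>r\<close> can only be
  the core. So \<open>r\<close> contributes exactly one occurrence and shields \<open>p\<close> from
  \<open>q\<close>.\<close>

lemma occ_decomp:
  assumes r: "r \<in> R_words R"
  shows "occ (p @ r @ q) = (\<lambda>(a, m, b). (a, m, b @ r @ q)) ` occ p \<union>
    (\<lambda>(a, m, b). (p @ r @ a, m, b)) ` occ q \<union> {(p @ pre r, core r, post r @ q)}"
    (is "_ = ?A \<union> ?B \<union> {?c}")
proof (intro equalityI subsetI)
  fix t assume "t \<in> occ (p @ r @ q)"
  then obtain a m b where t: "t = (a, m, b)" and m: "m \<in> minimal_words" and eq: "a @ m @ b = p @ r @ q"
    by (auto simp: occ_def)
  have mR: "m \<in> R_words R" and mm: "\<And>x v y. \<not> nest m x v y"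
    using m by (auto simp: minimal_words_def nested_def)
  have core: "r = z @ m @ c \<Longrightarrow> z = pre r \<and> m = core r \<and> c = post r" for z c
  proof -
    assume rr: "r = z @ m @ c"
    show ?thesis
    proof (cases "z = [] \<and> c = []")
      case True
      then have "r = m" using rr by simp
      then show ?thesis using True mm by (simp add: pre_def core_def post_def nested_def)
    next
      case False
      then have "nest r z m c" using nestI[OF r mR rr] by auto
      then show ?thesis using nest_parts by auto
    qed
  qed
  consider (l) "length a + length m \<le> length p" | (r) "length p + length r \<le> length a"
    | (i) "length p \<le> length a" "length a < length p + length r"
    | (o) "length a < length p" "length p < length a + length m" by linarith
  then show "t \<in> ?A \<union> ?B \<union> {?c}"
  proof cases
    case l
    have "(a @ m) @ b = p @ r @ q" using eq by simp
    then have "take (length (a @ m)) p = a @ m" using l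
      by (metis append_eq_conv_conj append_eq_append_conv_if length_append)
    then obtain c where c: "p = (a @ m) @ c" by (metis append_take_drop_id)
    then have "b = c @ r @ q" using eq by simp
    note this c
    then have "t \<in> ?A" using t m by (auto simp: occ_def intro!: rev_image_eqI)
    then show ?thesis by blast
  next
    case r
    have "a @ m @ b = (p @ r) @ q" using eq by simp
    then have "take (length (p @ r)) a = p @ r" using r
      by (metis append_eq_conv_conj append_eq_append_conv_if length_append)
    then obtain c where c: "a = (p @ r) @ c" by (metis append_take_drop_id)
    then have "c @ m @ b = q" using eq by simp
    note this c
    then have "t \<in> ?B" using t m by (auto simp: occ_def intro!: rev_image_eqI)
    then show ?thesis by blast
  next
    case i
    then have "take (length p) a = p" using eq
      by (metis append_eq_conv_conj append_eq_append_conv_if)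
    then obtain z where "a = p @ z" by (metis append_take_drop_id)
    then have z: "a = p @ z" "z @ m @ b = r @ q" using eq by simp_all
    have "(\<exists>c. r = z @ m @ c) \<or> z = [] \<and> (\<exists>c. m = r @ c)"
      using z i by (intro overlap[of r q z m b]) (auto simp: r mR)
    then have "\<exists>c. r = z @ m @ c"
      using nestI[OF mR r, of "[]"] mm by fastforce
    then obtain c where c: "r = z @ m @ c" ..
    have "(z @ m) @ b = (z @ m) @ c @ q" using z(2) c by simp
    then have "b = c @ q" by (simp only: same_append_eq)
    then have "t = ?c" using core[OF c] z(1) t by simp
    then show ?thesis by blast
  next
    case o
    then have "take (length a) p = a" using eq
      by (metis append_eq_conv_conj append_eq_append_conv_if nat_less_le)
    then obtain z where "p = a @ z" by (metis append_take_drop_id)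
    then have z: "p = a @ z" "m @ b = z @ r @ q" "z \<noteq> []" using eq o by auto
    have "(\<exists>c. m = z @ r @ c) \<or> z = [] \<and> (\<exists>c. r = m @ c)"
      using z o by (intro overlap[of m b z r q]) (auto simp: r mR)
    then show ?thesis using nestI[OF mR r, of z] mm z(3) by blast
  qed
next
  fix t assume "t \<in> ?A \<union> ?B \<union> {?c}"
  then show "t \<in> occ (p @ r @ q)"
    using core_minimal[OF r] parts[of r] by (auto simp: occ_def)
qed

text \<open>A rewriting step moves a single minimal occurrence along an edge of the bi-sided graph and
  leaves all the others alone. Weighting the minimal occurrences by a potential of the graph that
  compensates the change of length yields an invariant that bounds the length.\<close>

lemma length_bounded:
  obtains \<Phi> :: "'a list \<Rightarrow> int"
  where "\<And>w w'. (w, w') \<in> scong D \<Longrightarrow> int (length w') \<le> \<Phi> w"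
proof -
  obtain h0 where h0: "\<And>r s. (r, s) \<in> D \<Longrightarrow> int (length r) + h0 (core r) = int (length s) + h0 (core s)"
    using walk_forest_potential[OF walk_forest_core sym_D, of "\<lambda>w. int (length w)"] by blast
  \<comment> \<open>Subtracting the minimum over the finitely many R-words keeps all differences and
    makes the weights nonnegative, so that the invariant dominates the length.\<close>
  define h where "h v = h0 v - Min (h0 ` R_words R)" for v
  have finW: "finite (R_words R)" using finR by (simp add: R_words_def)
  have h: "(r, s) \<in> D \<Longrightarrow> int (length r) + h (core r) = int (length s) + h (core s)" for r s
    using h0[of r s] by (simp add: h_def)
  have pos: "h m \<ge> 0" if "m \<in> minimal_words" for m
    using that finW by (auto simp: h_def minimal_words_def)
  define W where "W w = (\<Sum>(p, m, q) \<in> occ w. h m)" for w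
  have W_decomp: "W (p @ r @ q) = W p + W q + h (core r)" if r: "r \<in> R_words R" for p q r
  proof -
    let ?A = "(\<lambda>(a, m, b). (a, m, b @ r @ q)) ` occ p"
    let ?B = "(\<lambda>(a, m, b). (p @ r @ a, m, b)) ` occ q"
    let ?c = "(p @ pre r, core r, post r @ q)"
    have ne: "core r \<noteq> []" using core_minimal[OF r] R_words_nonempty by (auto simp: minimal_words_def)
    have "r \<noteq> []" using r by (rule R_words_nonempty)
    have mne: "m \<noteq> []" if "m \<in> minimal_words" for m
      using that R_words_nonempty by (auto simp: minimal_words_def)
    have 1: "?A \<inter> ?B = {}"
      using \<open>r \<noteq> []\<close> by (force simp: occ_def)
    have 2: "?c \<notin> ?A"
      using ne by (auto simp: occ_def dest!: arg_cong[of _ _ length])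
    have 3: "?c \<notin> ?B"
    proof
      assume "?c \<in> ?B"
      then have "length (pre r) \<ge> length r" by (auto dest!: arg_cong[of _ _ length])
      then show False using arg_cong[OF parts[of r], of length] ne by simp
    qed
    have sA: "(\<Sum>(a, m, b) \<in> ?A. h m) = W p"
      unfolding W_def by (subst sum.reindex) (auto simp: inj_on_def case_prod_beta)
    have sB: "(\<Sum>(a, m, b) \<in> ?B. h m) = W q"
      unfolding W_def by (subst sum.reindex) (auto simp: inj_on_def case_prod_beta)
    have "W (p @ r @ q) = (\<Sum>(a, m, b) \<in> ?A \<union> ?B. h m) + h (core r)"
      unfolding W_def occ_decomp[OF r] using 2 3 finite_occ
      by (subst sum.union_disjoint) auto
    also have "(\<Sum>(a, m, b) \<in> ?A \<union> ?B. h m) = W p + W q"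
      using sA sB 1 finite_occ by (subst sum.union_disjoint) auto
    finally show ?thesis .
  qed
  have inv: "int (length w') + W w' = int (length w) + W w" if "(w, w') \<in> scong D" for w w'
    using that unfolding scong_def
  proof (induction rule: rtrancl_induct)
    case (step v w')
    then obtain p q r s where "v = p @ r @ q" "w' = p @ s @ q" "(r, s) \<in> D"
      by (auto simp: rstep_def)
    then show ?case
      using step.IH W_decomp[of r p q] W_decomp[of s p q] h[of r s] D_words[of r s] by simp
  qed simp
  have "W w \<ge> 0" for w
    unfolding W_def by (rule sum_nonneg) (auto simp: occ_def intro: pos)
  then show thesis using that[of "\<lambda>w. int (length w) + W w"] inv by (metis le_add_same_cancel1)
qed

lemma scong_set:
  assumes "(w, w') \<in> scong D"
  shows "set w' \<subseteq> set w \<union> X"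
  using assms unfolding scong_def
proof (induction rule: rtrancl_induct)
  case (step v w')
  then show ?case using D_words by (fastforce simp: rstep_def)
qed simp

lemma finite_class: "finite {w'. (w, w') \<in> scong D}"
proof -
  obtain \<Phi> :: "'a list \<Rightarrow> int"
    where b: "\<And>w w'. (w, w') \<in> scong D \<Longrightarrow> int (length w') \<le> \<Phi> w"
    using length_bounded by blast
  have "{w'. (w, w') \<in> scong D} \<subseteq> {v. set v \<subseteq> set w \<union> X \<and> length v \<le> nat (\<Phi> w)}"
    using scong_set b by fastforce
  then show ?thesis
    by (rule finite_subset) (rule finite_lists_length_le, simp add: finX)
qed

end

section \<open>Left cancellation, least common multiples and the Ore condition\<close>

text \<open>The assumptions on the graph are left-sided only, so that the reversed relations form a
  second instance, which supplies the right-sided results.\<close>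

locale left_adian =
  fixes D :: "'a relations"
  assumes sym_D: "sym D"
    and nonempty: "(r, s) \<in> D \<Longrightarrow> r \<noteq> []"
    and forest_hd: "walk_forest D hd"
    and finite_class: "finite {w'. (w, w') \<in> scong D}"
begin

abbreviation eqv :: "'a list \<Rightarrow> 'a list \<Rightarrow> bool" (infix "\<sim>" 50) where
  "u \<sim> v \<equiv> (u, v) \<in> scong D"

lemma eqv_sym: "u \<sim> v \<Longrightarrow> v \<sim> u"
  by (rule scong_sym[OF sym_D])

lemma D_swap: "(r, s) \<in> D \<Longrightarrow> (s, r) \<in> D"
  using sym_D by (auto simp: sym_def)

lemma nonempty': "(r, s) \<in> D \<Longrightarrow> s \<noteq> []"
  using nonempty D_swap by blast

lemma eqv_Cons: "u \<sim> v \<Longrightarrow> a # u \<sim> a # v"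
  using scong_context[of u v D "[a]" "[]"] by simp

lemma eqv_append_left: "u \<sim> v \<Longrightarrow> p @ u \<sim> p @ v"
  using scong_context[of u v D p "[]"] by simp

lemma eqv_append_right: "u \<sim> v \<Longrightarrow> u @ p \<sim> v @ p"
  using scong_context[of u v D "[]" p] by simp

text \<open>Length is not invariant under the congruence; the maximal length in the class is. It is
  finite because classes are, and grows strictly when a letter is put in front. It measures the
  inductions for cancellation, for least common multiples and for \<open>ore\<close>.\<close>

definition lam :: "'a list \<Rightarrow> nat" where
  "lam w = Max (length ` {w'. w \<sim> w'})"

lemma lam_eqv: "u \<sim> v \<Longrightarrow> lam u = lam v"
proof -
  assume "u \<sim> v"
  then have "{w'. u \<sim> w'} = {w'. v \<sim> w'}" by (auto intro: scong_trans eqv_sym)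
  then show ?thesis by (simp add: lam_def)
qed

lemma length_le_lam: "u \<sim> v \<Longrightarrow> length v \<le> lam u"
  unfolding lam_def using finite_class[of u] by (intro Max_ge) auto

lemma lam_attained: "\<exists>v. u \<sim> v \<and> length v = lam u"
proof -
  have "lam u \<in> length ` {w'. u \<sim> w'}"
    unfolding lam_def using finite_class[of u] scong_refl[of u D] by (intro Max_in) blast+
  then show ?thesis by auto
qed

lemma lam_append: "lam u + lam v \<le> lam (u @ v)"
proof -
  obtain u' v' where "u \<sim> u'" "length u' = lam u" "v \<sim> v'" "length v' = lam v"
    using lam_attained by metis
  then show ?thesis using length_le_lam[OF scong_append[of u u' D v v']] by simp
qed

lemma lam_Cons: "lam u < lam (a # u)"
  using lam_append[of "[a]" u] length_le_lam[of "[a]" "[a]"] by simp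

lemma eqv_Nil: "[] \<sim> v \<Longrightarrow> v = []"
  unfolding scong_def
proof (induction rule: rtrancl_induct)
  case (step v w)
  then show ?case using nonempty by (auto simp: rstep_def)
qed simp

text \<open>A derivation is recorded by the relations it applies at the left end; whatever happens
  behind the first letter is absorbed into congruences of tails. The first letters then trace a walk
  in the left graph with the steps \<open>es\<close>.\<close>

inductive lch :: "('a list \<times> 'a list) list \<Rightarrow> 'a list \<Rightarrow> 'a list \<Rightarrow> bool" where
  base: "u \<sim> v \<Longrightarrow> lch [] (a # u) (a # v)"
| step: "(a # r, s) \<in> D \<Longrightarrow> u \<sim> r @ p \<Longrightarrow> lch es (s @ p) w \<Longrightarrow> lch ((a # r, s) # es) (a # u) w"

lemma lch_nonempty: "lch es w w' \<Longrightarrow> w \<noteq> [] \<and> w' \<noteq> []"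
  by (induction rule: lch.induct) auto

lemma lch_walk: "lch es w w' \<Longrightarrow> walk D hd (hd w) es (hd w')"
proof (induction rule: lch.induct)
  case (step a r s u p es w)
  then show ?case using nonempty'[OF step.hyps(1)] by simp
qed simp

lemma lch_eqv: "lch es w w' \<Longrightarrow> w \<sim> w'"
proof (induction rule: lch.induct)
  case (base u v a)
  then show ?case by (rule eqv_Cons)
next
  case (step a r s u p es w)
  have "a # u \<sim> (a # r) @ p" using eqv_Cons[OF step.hyps(2)] by simp
  also have "(a # r) @ p \<sim> s @ p" by (rule eqv_append_right[OF scong_rel[OF step.hyps(1)]])
  also note step.IH
  finally show ?case .
qed

lemma lch_tail: "lch es (a # u) w \<Longrightarrow> u' \<sim> u \<Longrightarrow> lch es (a # u') w"
  by (auto elim!: lch.cases[of es "a # u"] intro!: lch.intros intro: scong_trans)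

lemma lch_append:
  assumes "lch (ds @ es) w w'"
  shows "\<exists>v. lch ds w v \<and> lch es v w'"
  using assms
proof (induction ds arbitrary: w)
  case Nil
  then obtain a u where "w = a # u" using lch_nonempty by (metis neq_Nil_conv)
  then show ?case using Nil lch.base[of u u a] by auto
next
  case (Cons d ds)
  from Cons.prems have "lch (d # (ds @ es)) w w'" by simp
  then show ?case
    by (cases rule: lch.cases) (metis Cons.IH lch.step)
qed

lemma append_lch:
  "lch ds w v \<Longrightarrow> lch es v w' \<Longrightarrow> lch (ds @ es) w w'"
proof (induction rule: lch.induct)
  case (base u v a)
  then show ?case by (auto intro: lch_tail)
next
  case (step a r s u p es w)
  then show ?case by (auto intro: lch.step)
qed

lemma lch_exists: "w \<sim> w' \<Longrightarrow> w \<noteq> [] \<Longrightarrow> \<exists>es. lch es w w'"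
  unfolding scong_def
proof (induction rule: converse_rtrancl_induct)
  case base
  then show ?case using lch.base[of "tl w'" "tl w'" "hd w'"] by auto
next
  case (step w w1)
  then obtain p q r s where w: "w = p @ r @ q" "w1 = p @ s @ q" and D: "(r, s) \<in> D"
    by (auto simp: rstep_def)
  have "w1 \<noteq> []" using w nonempty'[OF D] by auto
  then obtain es where es: "lch es w1 w'" using step.IH by auto
  show ?case
  proof (cases p)
    case Nil
    obtain a r' where r: "r = a # r'" using nonempty[OF D] by (cases r) auto
    have "lch ((a # r', s) # es) (a # (r' @ q)) w'"
      using D es w Nil r by (intro lch.step[where p = q]) auto
    then show ?thesis using w Nil r by auto
  next
    case (Cons a p')
    have "p' @ r @ q \<sim> p' @ s @ q" by (rule scong_context[OF scong_rel[OF D]])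
    then show ?thesis using lch_tail[of es a "p' @ s @ q" w'] es w Cons by auto
  qed
qed

section \<open>Left cancellation\<close>

definition cancel_below :: "nat \<Rightarrow> bool" where
  "cancel_below n \<longleftrightarrow> (\<forall>a u v. lam (a # u) < n \<longrightarrow> a # u \<sim> a # v \<longrightarrow> u \<sim> v)"

lemma cancel_below_append:
  "cancel_below n \<Longrightarrow> lam (p @ u) < n \<Longrightarrow> p @ u \<sim> p @ v \<Longrightarrow> u \<sim> v"
proof (induction p)
  case (Cons a p)
  have "p @ u \<sim> p @ v"
    using Cons.prems unfolding cancel_below_def append_Cons by blast
  moreover have "lam (p @ u) < n" using Cons.prems lam_Cons[of "p @ u" a] by simp
  ultimately show ?case using Cons.IH Cons.prems by blast
qed simp

lemma lch_backtrack:
  assumes "cancel_below (lam w)" "lch (d # prod.swap d # es) w w'"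
  shows "lch es w w'"
proof -
  obtain r s where d: "d = (r, s)" by (cases d)
  from assms(2) obtain a r' u p where 1: "r = a # r'" "w = a # u" "(r, s) \<in> D" "u \<sim> r' @ p"
      "lch ((s, r) # es) (s @ p) w'"
    unfolding d by (auto elim: lch.cases)
  from 1(5) obtain c s' u' q where 2: "s = c # s'" "s @ p = c # u'" "u' \<sim> s' @ q" "lch es (r @ q) w'"
    by (cases rule: lch.cases) auto
  have "w \<sim> r @ p" using eqv_Cons[OF 1(4)] 1 by simp
  also have "r @ p \<sim> s @ p" by (rule eqv_append_right[OF scong_rel[OF 1(3)]])
  finally have "lam w = lam (s @ p)" by (rule lam_eqv)
  then have "lam (s' @ p) < lam w" using lam_Cons[of "s' @ p" c] 2 by simp
  moreover have "s' @ p \<sim> s' @ q" using 2 by simp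
  ultimately have "p \<sim> q" using assms(1) cancel_below_append by blast
  then have "u \<sim> r' @ q" using 1(4) eqv_append_left scong_trans by blast
  then show ?thesis using lch_tail[of es a "r' @ q" w' u] 1 2 by simp
qed

lemma lch_reduced_below:
  assumes "cancel_below (lam w)" "w \<sim> w'" "w \<noteq> []"
  shows "\<exists>es. lch es w w' \<and> reduced es"
proof -
  obtain es where es: "lch es w w'" and min: "\<And>es'. lch es' w w' \<Longrightarrow> length es \<le> length es'"
    using lch_exists[OF assms(2,3)] ex_has_least_nat[of "\<lambda>es. lch es w w'" _ length] by metis
  have "reduced es"
  proof (rule ccontr)
    assume "\<not> reduced es"
    then obtain as d bs where d: "es = as @ d # prod.swap d # bs" using not_reduced_decomp by blast
    obtain v where v: "lch as w v" "lch (d # prod.swap d # bs) v w'" using lch_append es d by blast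
    have "lam v = lam w" using lam_eqv[OF lch_eqv[OF v(1)]] by simp
    then have "lch bs v w'" using lch_backtrack v(2) assms(1) by simp
    then have "lch (as @ bs) w w'" using append_lch v(1) by blast
    from min[OF this] show False by (simp add: d)
  qed
  then show ?thesis using es by blast
qed

text \<open>A shortest chain from \<open>a # u\<close> to \<open>a # v\<close> is reduced and traces
  a closed walk in a forest. So it is empty: the first letter is never touched and the tails are
  congruent.\<close>

lemma cancel_below: "cancel_below n"
proof (induction n)
  case (Suc n)
  show ?case unfolding cancel_below_def
  proof (intro allI impI)
    fix a u v assume a: "lam (a # u) < Suc n" "a # u \<sim> a # v"
    then have "cancel_below (lam (a # u))" using Suc unfolding cancel_below_def
      by (meson less_Suc_eq_le less_le_trans)
    then obtain es where es: "lch es (a # u) (a # v)" "reduced es"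
      using lch_reduced_below a(2) by blast
    then have "walk D hd a es a" using lch_walk[OF es(1)] by simp
    then have "es = []" using es(2) forest_hd unfolding walk_forest_def by blast
    then show "u \<sim> v" using es(1) by (auto elim: lch.cases)
  qed
qed (simp add: cancel_below_def)

lemma left_cancel: "p @ u \<sim> p @ v \<Longrightarrow> u \<sim> v"
  using cancel_below_append[OF cancel_below[of "Suc (lam (p @ u))"], of p u v] by simp

lemma left_cancel1: "a # u \<sim> a # v \<Longrightarrow> u \<sim> v"
  using left_cancel[of "[a]"] by simp

lemma lch_reduced: "w \<sim> w' \<Longrightarrow> w \<noteq> [] \<Longrightarrow> \<exists>es. lch es w w' \<and> reduced es"
  using lch_reduced_below[OF cancel_below] .

text \<open>Only one reduced walk joins two vertices of a forest, so the relations applied at the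
  left end are dictated by the two first letters alone. Hence they are the same for all common
  multiples of two given nonempty words.\<close>

lemma reduced_walk_lch:
  assumes "w \<sim> w'" "w \<noteq> []" "walk D hd (hd w) es (hd w')" "reduced es"
  shows "lch es w w'"
proof -
  obtain es' where es': "lch es' w w'" "reduced es'" using lch_reduced[OF assms(1,2)] by blast
  have "es' = es"
    by (rule reduced_walk_unique[OF forest_hd sym_D lch_walk[OF es'(1)] es'(2) assms(3,4)])
  then show ?thesis using es' by simp
qed

lemma lch_vertex_divides:
  assumes "lch (ks @ es) w w'" "walk D hd (hd w) ks m"
  shows "\<exists>k. w \<sim> m # k"
proof -
  obtain v where v: "lch ks w v" using lch_append assms(1) by blast
  have "hd v = m" using walk_end_unique[OF lch_walk[OF v] assms(2)] .
  then have "v = m # tl v" using lch_nonempty[OF v] by auto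
  then show ?thesis using lch_eqv[OF v] by metis
qed

section \<open>Least common multiples and common multiples of three elements\<close>

definition is_lcm :: "'a list \<Rightarrow> 'a list \<Rightarrow> 'a list \<Rightarrow> 'a list \<Rightarrow> bool" where
  "is_lcm u v p q \<longleftrightarrow> u @ p \<sim> v @ q \<and>
     (\<forall>p' q'. u @ p' \<sim> v @ q' \<longrightarrow> (\<exists>t. p' \<sim> p @ t \<and> q' \<sim> q @ t))"

lemma is_lcmD:
  "is_lcm u v p q \<Longrightarrow> u @ p \<sim> v @ q"
  "is_lcm u v p q \<Longrightarrow> u @ p' \<sim> v @ q' \<Longrightarrow> \<exists>t. p' \<sim> p @ t \<and> q' \<sim> q @ t"
  by (auto simp: is_lcm_def)

lemma is_lcm_Cons:
  assumes "is_lcm u v p q"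
  shows "is_lcm (a # u) (a # v) p q"
  using assms eqv_Cons left_cancel1 unfolding is_lcm_def append_Cons by blast

text \<open>If the first letters differ, the first relation \<open>(r, s)\<close> is the same for
  every common multiple of \<open>x\<close> and \<open>v\<close>, so the tail \<open>x'\<close> must
  meet \<open>r'\<close>; their lcm exists as \<open>lam\<close> has dropped. What remains is to
  find the lcm of \<open>s @ k1\<close> and \<open>v\<close>, whose first letters are one step
  closer.\<close>

lemma lcm_exists: "u @ p \<sim> v @ q \<Longrightarrow> \<exists>p0 q0. is_lcm u v p0 q0"
proof (induction "lam (u @ p)" arbitrary: u v p q rule: less_induct)
  case less
  \<comment> \<open>The inner induction follows the walk between the first letters. It replaces
    \<open>x\<close> by \<open>s @ k1\<close> without changing the class of the multiple, so
    \<open>lam\<close> stays fixed.\<close>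
  have inner: "\<exists>p0 q0. is_lcm x v p0 q0"
    if "x \<noteq> []" "v \<noteq> []" "x @ y \<sim> v @ q" "lam (x @ y) = lam (u @ p)"
      "walk D hd (hd x) es (hd v)" "reduced es" for es x y
    using that
  proof (induction es arbitrary: x y)
    case Nil
    then obtain a x' v' where x: "x = a # x'" "v = a # v'" by (metis list.collapse walk.simps(1))
    then have "x' @ y \<sim> v' @ q" using Nil.prems(3) left_cancel1 by auto
    moreover have "lam (x' @ y) < lam (u @ p)" using lam_Cons[of "x' @ y" a] Nil.prems(4) x by simp
    ultimately have "\<exists>p0 q0. is_lcm x' v' p0 q0" using less.hyps by blast
    then show ?case using is_lcm_Cons x by blast
  next
    case (Cons d es)
    obtain r s where d: "d = (r, s)" by (cases d)
    have D: "(r, s) \<in> D" "hd r = hd x" and w: "walk D hd (hd s) es (hd v)"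
      using Cons.prems(5) d by auto
    obtain a x' where x: "x = a # x'" using Cons.prems(1) by (cases x) auto
    then obtain r' where r: "r = a # r'" using D nonempty[OF D(1)] by (cases r) auto
    have edge: "\<exists>k. x' @ p' \<sim> r' @ k" if "x @ p' \<sim> v @ q'" for p' q'
    proof -
      have "lch (d # es) (x @ p') (v @ q')"
        using that Cons.prems(1,2,5,6) by (intro reduced_walk_lch) auto
      then obtain k where "x' @ p' \<sim> r' @ k"
        unfolding d r x by (auto elim: lch.cases)
      then show ?thesis by blast
    qed
    obtain k where k: "x' @ y \<sim> r' @ k" using edge Cons.prems(3) by blast
    have "lam (x' @ y) < lam (u @ p)" using lam_Cons[of "x' @ y" a] Cons.prems(4) x by simp
    then obtain p1 k1 where l1: "is_lcm x' r' p1 k1" using less.hyps k by blast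
    have xs: "x @ p1 @ t \<sim> s @ k1 @ t" for t
    proof -
      have "x @ p1 @ t \<sim> r @ k1 @ t"
        using eqv_Cons[OF eqv_append_right[OF is_lcmD(1)[OF l1], of t], of a] x r by simp
      also have "r @ k1 @ t \<sim> s @ k1 @ t" by (rule eqv_append_right[OF scong_rel[OF D(1)]])
      finally show ?thesis .
    qed
    obtain t where t: "y \<sim> p1 @ t" "k \<sim> k1 @ t" using is_lcmD(2)[OF l1 k] by blast
    have xt: "x @ y \<sim> s @ k1 @ t" using eqv_append_left[OF t(1)] xs scong_trans by blast
    then have "(s @ k1) @ t \<sim> v @ q" using Cons.prems(3) scong_trans eqv_sym append_assoc by metis
    moreover have "lam ((s @ k1) @ t) = lam (u @ p)" using lam_eqv[OF xt] Cons.prems(4) by simp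
    moreover have "hd (s @ k1) = hd s" "s @ k1 \<noteq> []" using nonempty'[OF D(1)] by auto
    moreover have "reduced es" using Cons.prems(6) by (simp add: reduced_Cons)
    ultimately obtain t0 q0 where l2: "is_lcm (s @ k1) v t0 q0"
      using Cons.IH[of "s @ k1" t] Cons.prems(2) w by auto
    have "is_lcm x v (p1 @ t0) q0"
      unfolding is_lcm_def
    proof (intro conjI allI impI)
      show "x @ p1 @ t0 \<sim> v @ q0"
        using xs[of t0] is_lcmD(1)[OF l2] scong_trans append_assoc by metis
    next
      fix p' q' assume pq: "x @ p' \<sim> v @ q'"
      obtain k' where k': "x' @ p' \<sim> r' @ k'" using edge[OF pq] by blast
      obtain t' where t': "p' \<sim> p1 @ t'" using is_lcmD(2)[OF l1 k'] by blast
      have "(s @ k1) @ t' \<sim> v @ q'"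
        using eqv_append_left[OF t', of x] xs[of t'] pq scong_trans eqv_sym append_assoc by metis
      then obtain t'' where "t' \<sim> t0 @ t''" "q' \<sim> q0 @ t''" using is_lcmD(2)[OF l2] by blast
      then show "\<exists>t. p' \<sim> (p1 @ t0) @ t \<and> q' \<sim> q0 @ t"
        using scong_trans[OF t' eqv_append_left] by fastforce
    qed
    then show ?case by blast
  qed
  show ?case
  proof (cases "u = [] \<or> v = []")
    case True
    then show ?thesis
    proof
      assume "u = []"
      then have "is_lcm u v v []" by (auto simp: is_lcm_def intro: scong_refl)
      then show ?thesis by blast
    next
      assume "v = []"
      then have "is_lcm u v [] u" by (auto simp: is_lcm_def intro: scong_refl eqv_sym)
      then show ?thesis by blast
    qed
  next
    case False
    then obtain es where es: "lch es (u @ p) (v @ q)" "reduced es" using lch_reduced less.prems by blast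
    have "walk D hd (hd u) es (hd v)" using lch_walk[OF es(1)] False by simp
    then show ?thesis using inner[of u p es] es(2) False less.prems by blast
  qed
qed

text \<open>The median \<open>m\<close> of the first letters lies on the reduced walk between any
  two of them and so divides all three pairwise multiples. The complements \<open>qu\<close>,
  \<open>qv\<close>, \<open>qw\<close> with respect to \<open>m\<close> again have pairwise common
  multiples, at smaller \<open>lam\<close>. A common multiple of these three, preceded by
  \<open>m\<close>, is one of \<open>u\<close>, \<open>v\<close>, \<open>w\<close>.\<close>

lemma ore:
  "u @ p1 \<sim> v @ p2 \<Longrightarrow> v @ q2 \<sim> w @ q3 \<Longrightarrow> u @ r1 \<sim> w @ r3 \<Longrightarrow>
    \<exists>x y z. u @ x \<sim> v @ y \<and> v @ y \<sim> w @ z"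
proof (induction "lam (u @ p1)" arbitrary: u v w p1 p2 q2 q3 r1 r3 rule: less_induct)
  case less
  consider "u = []" | "v = []" | "w = []" | (n) "u \<noteq> []" "v \<noteq> []" "w \<noteq> []" by blast
  then show ?case
  proof cases
    case 1
    then have "u @ v @ q2 \<sim> v @ q2" by simp
    then show ?thesis using less.prems(2) by blast
  next
    case 2
    then have "v @ u @ r1 \<sim> w @ r3" "u @ r1 \<sim> v @ u @ r1" using less.prems(3) by auto
    then show ?thesis by blast
  next
    case 3
    then have "v @ p2 \<sim> w @ v @ p2" by auto
    then show ?thesis using less.prems(1) by blast
  next
    case n
    obtain ds where ds: "lch ds (u @ p1) (v @ p2)" "reduced ds" using lch_reduced less.prems(1) n by blast
    obtain es where es: "lch es (u @ r1) (w @ r3)" "reduced es" using lch_reduced less.prems(3) n by blast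
    have wds: "walk D hd (hd u) ds (hd v)" using lch_walk[OF ds(1)] n by simp
    have wes: "walk D hd (hd u) es (hd w)" using lch_walk[OF es(1)] n by simp
    obtain ks ds' es' m where m: "ds = ks @ ds'" "es = ks @ es'" "walk D hd (hd u) ks m"
      "walk D hd (hd v) (rev (map prod.swap ds')) m" "walk D hd m es' (hd w)"
      "reduced (rev (map prod.swap ds') @ es')"
      using reduced_walks_median[OF sym_D wds ds(2) wes es(2)] by metis
    obtain y1 where y1: "u @ p1 \<sim> [m] @ y1" using lch_vertex_divides[of ks ds' "u @ p1"] ds m n by auto
    obtain y3 where y3: "u @ r1 \<sim> [m] @ y3" using lch_vertex_divides[of ks es' "u @ r1"] es m n by auto
    have "lch (rev (map prod.swap ds') @ es') (v @ q2) (w @ q3)"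
      using less.prems(2) n m by (intro reduced_walk_lch) (auto simp: walk_append)
    then obtain y2 where y2: "v @ q2 \<sim> [m] @ y2"
      using lch_vertex_divides[of _ es' "v @ q2" "w @ q3" m] m n by auto
    have y1': "v @ p2 \<sim> [m] @ y1" using y1 less.prems(1) scong_trans eqv_sym by blast
    have y2': "w @ q3 \<sim> [m] @ y2" using y2 less.prems(2) scong_trans eqv_sym by blast
    have y3': "w @ r3 \<sim> [m] @ y3" using y3 less.prems(3) scong_trans eqv_sym by blast
    obtain pu qu where lu: "is_lcm u [m] pu qu" using lcm_exists y1 by blast
    obtain pv qv where lv: "is_lcm v [m] pv qv" using lcm_exists y2 by blast
    obtain pw qw where lw: "is_lcm w [m] pw qw" using lcm_exists y2' by blast
    obtain t1 where t1: "y1 \<sim> qu @ t1" using is_lcmD(2)[OF lu y1] by blast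
    obtain t2 where t2: "y3 \<sim> qu @ t2" using is_lcmD(2)[OF lu y3] by blast
    obtain t3 where t3: "y1 \<sim> qv @ t3" using is_lcmD(2)[OF lv y1'] by blast
    obtain t4 where t4: "y2 \<sim> qv @ t4" using is_lcmD(2)[OF lv y2] by blast
    obtain t5 where t5: "y2 \<sim> qw @ t5" using is_lcmD(2)[OF lw y2'] by blast
    obtain t6 where t6: "y3 \<sim> qw @ t6" using is_lcmD(2)[OF lw y3'] by blast
    have "lam (qu @ t1) < lam (u @ p1)"
      using lam_eqv[OF y1] lam_eqv[OF t1] lam_Cons[of y1 m] by simp
    moreover have "qu @ t1 \<sim> qv @ t3" "qv @ t4 \<sim> qw @ t5" "qu @ t2 \<sim> qw @ t6"
      using t1 t2 t3 t4 t5 t6 scong_trans eqv_sym by blast+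
    ultimately obtain x y z where xyz: "qu @ x \<sim> qv @ y" "qv @ y \<sim> qw @ z"
      using less.hyps by blast
    have mult: "a @ pa @ t \<sim> m # qa @ t" if "is_lcm a [m] pa qa" for a pa qa t
      using eqv_append_right[OF is_lcmD(1)[OF that], of t] by simp
    have "u @ pu @ x \<sim> v @ pv @ y"
      using mult[OF lu] mult[OF lv] eqv_Cons[OF xyz(1), of m] scong_trans eqv_sym by meson
    moreover have "v @ pv @ y \<sim> w @ pw @ z"
      using mult[OF lv] mult[OF lw] eqv_Cons[OF xyz(2), of m] scong_trans eqv_sym by meson
    ultimately show ?thesis by blast
  qed
qed

end

section \<open>Multifraction reduction\<close>

text \<open>The product \<open>mul False\<close> is opposite to \<open>mul True\<close>, so every assumption is imposed on both
  sides.\<close>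

locale ore_monoid =
  fixes C :: "'m set" and mul :: "bool \<Rightarrow> 'm \<Rightarrow> 'm \<Rightarrow> 'm" and e :: 'm and ht :: "'m \<Rightarrow> nat"
  assumes closed [simp, intro]: "a \<in> C \<Longrightarrow> b \<in> C \<Longrightarrow> mul \<sigma> a b \<in> C"
    and e_closed [simp, intro]: "e \<in> C"
    and opp: "mul (\<not> \<sigma>) a b = mul \<sigma> b a"
    and assoc: "a \<in> C \<Longrightarrow> b \<in> C \<Longrightarrow> c \<in> C \<Longrightarrow> mul \<sigma> (mul \<sigma> a b) c = mul \<sigma> a (mul \<sigma> b c)"
    and e_left [simp]: "a \<in> C \<Longrightarrow> mul \<sigma> e a = a"
    and cancel: "a \<in> C \<Longrightarrow> b \<in> C \<Longrightarrow> c \<in> C \<Longrightarrow> mul \<sigma> a b = mul \<sigma> a c \<Longrightarrow> b = c"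
    and ht_mul: "a \<in> C \<Longrightarrow> b \<in> C \<Longrightarrow> ht a + ht b \<le> ht (mul \<sigma> a b)"
    and ht_pos: "a \<in> C \<Longrightarrow> a \<noteq> e \<Longrightarrow> 0 < ht a"
    and ht_e: "ht e = 0"
    and lcm_ex: "a \<in> C \<Longrightarrow> b \<in> C \<Longrightarrow> p \<in> C \<Longrightarrow> q \<in> C \<Longrightarrow> mul \<sigma> a p = mul \<sigma> b q \<Longrightarrow>
      \<exists>p0\<in>C. \<exists>q0\<in>C. mul \<sigma> a p0 = mul \<sigma> b q0 \<and>
        (\<forall>p'\<in>C. \<forall>q'\<in>C. mul \<sigma> a p' = mul \<sigma> b q' \<longrightarrow>
          (\<exists>t\<in>C. p' = mul \<sigma> p0 t \<and> q' = mul \<sigma> q0 t))"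
    and ore: "{a, b, c, p1, p2, q2, q3, r1, r3} \<subseteq> C \<Longrightarrow> mul \<sigma> a p1 = mul \<sigma> b p2 \<Longrightarrow>
      mul \<sigma> b q2 = mul \<sigma> c q3 \<Longrightarrow> mul \<sigma> a r1 = mul \<sigma> c r3 \<Longrightarrow>
      \<exists>x\<in>C. \<exists>y\<in>C. \<exists>z\<in>C. mul \<sigma> a x = mul \<sigma> b y \<and> mul \<sigma> b y = mul \<sigma> c z"
begin

section \<open>Least common multiples and their complements\<close>

lemma e_right [simp]: "a \<in> C \<Longrightarrow> mul \<sigma> a e = a"
  using opp[of "\<not> \<sigma>" a e] by simp

lemma no_units:
  assumes "a \<in> C" "b \<in> C" "mul \<sigma> a b = e"
  shows "a = e" "b = e"
  using ht_mul[OF assms(1,2), of \<sigma>] ht_pos[OF assms(1)] ht_pos[OF assms(2)] assms(3) ht_e by auto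

text \<open>The lcm is given by its two complements rather than by the multiple itself, because
  reductions operate on complements.\<close>

definition lcm :: "bool \<Rightarrow> 'm \<Rightarrow> 'm \<Rightarrow> 'm \<Rightarrow> 'm \<Rightarrow> bool" where
  "lcm \<sigma> a b p q \<longleftrightarrow> p \<in> C \<and> q \<in> C \<and> mul \<sigma> a p = mul \<sigma> b q \<and>
     (\<forall>p'\<in>C. \<forall>q'\<in>C. mul \<sigma> a p' = mul \<sigma> b q' \<longrightarrow>
       (\<exists>t\<in>C. p' = mul \<sigma> p t \<and> q' = mul \<sigma> q t))"

lemma lcm_exists:
  assumes "mul \<sigma> a p = mul \<sigma> b q" "a \<in> C" "b \<in> C" "p \<in> C" "q \<in> C"
  obtains p0 q0 where "lcm \<sigma> a b p0 q0"
  using lcm_ex[OF assms(2-5,1)] unfolding lcm_def by blast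

lemma lcmD:
  assumes "lcm \<sigma> a b p q"
  shows "p \<in> C" "q \<in> C" "mul \<sigma> a p = mul \<sigma> b q"
  using assms by (auto simp: lcm_def)

lemma lcm_factor:
  assumes "lcm \<sigma> a b p q" "mul \<sigma> a p' = mul \<sigma> b q'" "p' \<in> C" "q' \<in> C"
  obtains t where "t \<in> C" "p' = mul \<sigma> p t" "q' = mul \<sigma> q t"
  using assms unfolding lcm_def by blast

lemma lcm_sym: "lcm \<sigma> a b p q \<Longrightarrow> lcm \<sigma> b a q p"
  unfolding lcm_def by metis

lemma lcm_unique:
  assumes "lcm \<sigma> a b p q" "lcm \<sigma> a b p' q'"
  shows "p = p'" "q = q'"
proof -
  obtain t where t: "t \<in> C" "p' = mul \<sigma> p t" "q' = mul \<sigma> q t"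
    using lcm_factor[OF assms(1)] lcmD[OF assms(2)] by metis
  obtain s where s: "s \<in> C" "p = mul \<sigma> p' s"
    using lcm_factor[OF assms(2)] lcmD[OF assms(1)] by metis
  have C: "p \<in> C" "q \<in> C" using lcmD[OF assms(1)] by auto
  have "mul \<sigma> p (mul \<sigma> t s) = mul \<sigma> p e"
    using s(2) unfolding t(2) using s(1) t(1) C by (simp add: assoc)
  then have "mul \<sigma> t s = e" by (rule cancel[OF C(1) closed[OF t(1) s(1)] e_closed])
  then have "t = e" using no_units(1)[OF t(1) s(1)] by blast
  then show "p = p'" "q = q'" using t C by auto
qed

lemma lcm_divides:
  assumes "z \<in> C" "k \<in> C"
  shows "lcm \<sigma> (mul \<sigma> z k) z e k"
  unfolding lcm_def
proof (intro conjI ballI impI)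
  fix p' q' assume pq: "p' \<in> C" "q' \<in> C" "mul \<sigma> (mul \<sigma> z k) p' = mul \<sigma> z q'"
  then have "mul \<sigma> z (mul \<sigma> k p') = mul \<sigma> z q'" using assms by (simp add: assoc)
  then have "mul \<sigma> k p' = q'" using cancel pq assms closed by blast
  then show "\<exists>t\<in>C. p' = mul \<sigma> e t \<and> q' = mul \<sigma> k t" using pq by auto
qed (use assms in auto)

lemma lcm_e: "a \<in> C \<Longrightarrow> lcm \<sigma> a e e a"
  using lcm_divides[of e a \<sigma>] by simp

text \<open>Two lcm squares are pasted along \<open>b\<close>: a common multiple of \<open>a\<close>
  and the product of \<open>x\<close> and \<open>t\<close> factors through the first square, and the
  cofactor through the second.\<close>

lemma lcm_comp:
  assumes 1: "lcm \<sigma> a x x' b" and 2: "lcm \<sigma> b t t' c" and C: "a \<in> C" "x \<in> C" "t \<in> C"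
  shows "lcm \<sigma> a (mul \<sigma> x t) (mul \<sigma> x' t') c"
  unfolding lcm_def
proof (intro conjI ballI impI)
  note 3 = lcmD[OF 1] lcmD[OF 2]
  show "mul \<sigma> x' t' \<in> C" "c \<in> C" using 3 by auto
  have "mul \<sigma> a (mul \<sigma> x' t') = mul \<sigma> (mul \<sigma> x b) t'" using 3 C by (simp add: assoc[symmetric])
  also have "\<dots> = mul \<sigma> (mul \<sigma> x t) c" using 3 C by (simp add: assoc)
  finally show "mul \<sigma> a (mul \<sigma> x' t') = mul \<sigma> (mul \<sigma> x t) c" .
  fix p q assume pq: "p \<in> C" "q \<in> C" "mul \<sigma> a p = mul \<sigma> (mul \<sigma> x t) q"
  then have "mul \<sigma> a p = mul \<sigma> x (mul \<sigma> t q)" using C by (simp add: assoc)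
  then obtain s where s: "s \<in> C" "p = mul \<sigma> x' s" "mul \<sigma> t q = mul \<sigma> b s"
    using lcm_factor[OF 1] pq C closed by metis
  obtain r where r: "r \<in> C" "s = mul \<sigma> t' r" "q = mul \<sigma> c r"
    using lcm_factor[OF 2 s(3)[symmetric]] s pq by metis
  then show "\<exists>r\<in>C. p = mul \<sigma> (mul \<sigma> x' t') r \<and> q = mul \<sigma> c r"
    using s 3 by (intro bexI[of _ r]) (simp_all add: assoc)
qed

text \<open>A multifraction \<open>a\<^sub>0 a\<^sub>1\<inverse> a\<^sub>2 a\<^sub>3\<inverse> \<dots>\<close> is a sequence which is eventually \<open>e\<close>. The reduction at
  \<open>i\<close> pushes a divisor \<open>x\<close> of the entry \<open>i + 1\<close> across the entry \<open>i\<close> into the entry \<open>i - 1\<close>, whose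
  sign is that of the entry \<open>i + 1\<close>.\<close>

definition res :: "nat \<Rightarrow> 'm \<Rightarrow> 'm \<Rightarrow> 'm \<Rightarrow> (nat \<Rightarrow> 'm) \<Rightarrow> nat \<Rightarrow> 'm" where
  "res i x' b' a' a = (\<lambda>j. if j = Suc i then a' else if j = i then b'
     else if Suc j = i then mul (odd i) (a j) x' else a j)"

text \<open>The parity of \<open>i\<close> selects the side on which the entries \<open>i\<close>
  and \<open>i + 1\<close> meet. At \<open>i = 0\<close> no entry can receive \<open>x'\<close>, so
  \<open>x'\<close> must be \<open>e\<close>: then \<open>x\<close> divides both entries and is
  cancelled. The trivial divisor \<open>e\<close> is excluded only in \<open>red\<close>, which
  spares case distinctions when diagrams are closed.\<close>

definition red_at :: "nat \<Rightarrow> 'm \<Rightarrow> (nat \<Rightarrow> 'm) \<Rightarrow> (nat \<Rightarrow> 'm) \<Rightarrow> bool" where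
  "red_at i x a b \<longleftrightarrow> (\<exists>x' b' a'. x \<in> C \<and> a' \<in> C \<and> a (Suc i) = mul (odd i) x a' \<and>
     lcm (odd i) (a i) x x' b' \<and> (i = 0 \<longrightarrow> x' = e) \<and> b = res i x' b' a' a)"

definition seqs :: "nat \<Rightarrow> (nat \<Rightarrow> 'm) set" where
  "seqs N = {a. (\<forall>i. a i \<in> C) \<and> (\<forall>i\<ge>N. a i = e)}"

definition red :: "(nat \<Rightarrow> 'm) rel" where
  "red = {(a, b). (\<exists>N. a \<in> seqs N) \<and> (\<exists>i x. x \<noteq> e \<and> red_at i x a b)}"

lemma seqs_closed: "a \<in> seqs N \<Longrightarrow> a i \<in> C"
  by (simp add: seqs_def)

lemma red_at_e:
  assumes "red_at i e a b" "a \<in> seqs N"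
  shows "b = a"
proof -
  obtain x' b' a' where 1: "a' \<in> C" "a (Suc i) = mul (odd i) e a'" "lcm (odd i) (a i) e x' b'"
    "b = res i x' b' a' a"
    using assms by (auto simp: red_at_def)
  have "x' = e" "b' = a i"
    using lcm_unique[OF 1(3) lcm_e] seqs_closed[OF assms(2)] by auto
  then show ?thesis using 1 seqs_closed[OF assms(2)] by (auto simp: res_def fun_eq_iff)
qed

lemma red_at_seqs:
  assumes "red_at i x a b" "a \<in> seqs N" "x \<noteq> e"
  shows "b \<in> seqs N" "Suc i < N"
proof -
  obtain x' b' a' where 1: "x \<in> C" "a' \<in> C" "a (Suc i) = mul (odd i) x a'"
    "lcm (odd i) (a i) x x' b'" "b = res i x' b' a' a"
    using assms(1) by (auto simp: red_at_def)
  have "a (Suc i) \<noteq> e" using no_units(1)[of x a' "odd i"] 1 assms(3) by auto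
  then show "Suc i < N" using assms(2) by (auto simp: seqs_def not_le[symmetric])
  then show "b \<in> seqs N"
    using 1 assms(2) lcmD[OF 1(4)] by (auto simp: seqs_def res_def)
qed

lemma red_seqs: "(a, b) \<in> red \<Longrightarrow> a \<in> seqs N \<Longrightarrow> b \<in> seqs N"
  unfolding red_def using red_at_seqs by blast

lemma red_at_rtrancl: "red_at i x a b \<Longrightarrow> a \<in> seqs N \<Longrightarrow> (a, b) \<in> red\<^sup>*"
  using red_at_e[of i a b N] unfolding red_def by (cases "x = e") blast+

lemma red_rtrancl_seqs: "(a, b) \<in> red\<^sup>* \<Longrightarrow> a \<in> seqs N \<Longrightarrow> b \<in> seqs N"
  by (induction rule: rtrancl_induct) (auto intro: red_seqs)

lemma red_at_closed: "red_at i x a b \<Longrightarrow> a \<in> seqs N \<Longrightarrow> b \<in> seqs N"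
  using red_rtrancl_seqs red_at_rtrancl by blast

text \<open>A reduction at \<open>i\<close> lowers the height of entry \<open>i + 1\<close>, leaves
  the entries above alone and may enlarge those below, so the heights read from the top decrease
  lexicographically.\<close>

lemma wf_red: "wf {(b, a). a \<in> seqs N \<and> (a, b) \<in> red}"
proof -
  let ?f = "\<lambda>a. map (\<lambda>i. ht (a i)) (rev [0..<N])"
  have "{(b, a). a \<in> seqs N \<and> (a, b) \<in> red} \<subseteq> inv_image (lex less_than) ?f"
  proof clarify
    fix a b assume a: "a \<in> seqs N" "(a, b) \<in> red"
    then obtain i x where r: "x \<noteq> e" "red_at i x a b" by (auto simp: red_def)
    then obtain x' b' a' where 1: "x \<in> C" "a' \<in> C" "a (Suc i) = mul (odd i) x a'"
      "b = res i x' b' a' a"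
      by (auto simp: red_at_def)
    have i: "Suc i < N" using red_at_seqs(2)[OF r(2) a(1) r(1)] .
    have "ht a' < ht (a (Suc i))"
      using ht_mul[OF 1(1,2), of "odd i"] ht_pos[OF 1(1) r(1)] 1(3) by simp
    then have "ht (b (Suc i)) < ht (a (Suc i))" using 1 by (simp add: res_def)
    moreover have "[0..<N] = [0..<Suc i] @ Suc i # [Suc (Suc i)..<N]"
      using i upt_add_eq_append[of 0 "Suc i" "N - Suc i"] upt_conv_Cons[of "Suc i" N] by simp
    moreover have "map (\<lambda>j. ht (b j)) [Suc (Suc i)..<N] = map (\<lambda>j. ht (a j)) [Suc (Suc i)..<N]"
      using 1(4) by (auto simp: res_def)
    ultimately have "?f a = rev (map (\<lambda>j. ht (a j)) [Suc (Suc i)..<N]) @ ht (a (Suc i)) # rev (map (\<lambda>j. ht (a j)) [0..<Suc i])"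
      "?f b = rev (map (\<lambda>j. ht (a j)) [Suc (Suc i)..<N]) @ ht (b (Suc i)) # rev (map (\<lambda>j. ht (b j)) [0..<Suc i])"
      "(ht (b (Suc i)), ht (a (Suc i))) \<in> less_than"
      by (simp_all add: rev_map)
    then have "(?f b, ?f a) \<in> lex less_than"
      unfolding lex_conv by auto
    then show "(b, a) \<in> inv_image (lex less_than) ?f" by simp
  qed
  then show ?thesis by (rule wf_subset[rotated]) (intro wf_inv_image wf_lex wf_less_than)
qed

text \<open>Any two of \<open>a i\<close>, \<open>x\<close>, \<open>y\<close> have a common
  multiple, hence all three do. So the lcm of \<open>x\<close> and \<open>y\<close> can be pushed
  across \<open>a i\<close> as well, and both reductions extend to that one.\<close>

lemma joinable_same:
  assumes a: "a \<in> seqs N" and "red_at i x a b" "red_at i y a c"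
  shows "\<exists>d. (b, d) \<in> red\<^sup>* \<and> (c, d) \<in> red\<^sup>*"
proof -
  define \<sigma> where "\<sigma> = odd i"
  note aC = seqs_closed[OF a]
  obtain x' b1 a1 where 1: "x \<in> C" "a1 \<in> C" "a (Suc i) = mul \<sigma> x a1"
    "lcm \<sigma> (a i) x x' b1" "i = 0 \<longrightarrow> x' = e" "b = res i x' b1 a1 a"
    using assms(2) by (auto simp: red_at_def \<sigma>_def)
  obtain y' b2 a2 where 2: "y \<in> C" "a2 \<in> C" "a (Suc i) = mul \<sigma> y a2"
    "lcm \<sigma> (a i) y y' b2" "i = 0 \<longrightarrow> y' = e" "c = res i y' b2 a2 a"
    using assms(3) by (auto simp: red_at_def \<sigma>_def)
  note C1 = lcmD[OF 1(4)] and C2 = lcmD[OF 2(4)]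
  have xy: "mul \<sigma> x a1 = mul \<sigma> y a2" using 1(3) 2(3) by simp
  obtain p q where pq: "lcm \<sigma> x y p q" using lcm_exists[OF xy 1(1) 2(1) 1(2) 2(2)] .
  note Cpq = lcmD[OF pq]
  obtain s where s: "s \<in> C" "a1 = mul \<sigma> p s" "a2 = mul \<sigma> q s"
    using lcm_factor[OF pq xy 1(2) 2(2)] .
  have "\<exists>u\<in>C. \<exists>v\<in>C. \<exists>w\<in>C. mul \<sigma> (a i) u = mul \<sigma> x v \<and> mul \<sigma> x v = mul \<sigma> y w"
    by (rule ore[where ?p1.0 = x' and ?p2.0 = b1 and ?q2.0 = a1 and ?q3.0 = a2 and ?r1.0 = y' and ?r3.0 = b2])
      (use aC 1 2 C1 C2 xy in auto)
  then obtain u v w where u: "u \<in> C" "v \<in> C" "w \<in> C" "mul \<sigma> (a i) u = mul \<sigma> x v"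
    "mul \<sigma> x v = mul \<sigma> y w" by blast
  obtain r where r: "r \<in> C" "v = mul \<sigma> p r" "w = mul \<sigma> q r"
    using lcm_factor[OF pq u(5) u(2,3)] .
  obtain s1 where s1: "s1 \<in> C" "mul \<sigma> p r = mul \<sigma> b1 s1"
    using lcm_factor[OF 1(4) u(4) u(1,2)] r by metis
  obtain s2 where s2: "s2 \<in> C" "mul \<sigma> q r = mul \<sigma> b2 s2"
    using lcm_factor[OF 2(4) _ u(1,3)] u r by metis
  obtain t1 c1 where t1: "lcm \<sigma> b1 p t1 c1"
    using lcm_exists[OF s1(2)[symmetric]] C1 s1 Cpq r by metis
  obtain t2 c2 where t2: "lcm \<sigma> b2 q t2 c2"
    using lcm_exists[OF s2(2)[symmetric]] C2 s2 Cpq r by metis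
  note Ct = lcmD[OF t1] lcmD[OF t2]
  have l1: "lcm \<sigma> (a i) (mul \<sigma> x p) (mul \<sigma> x' t1) c1"
    by (rule lcm_comp[OF 1(4) t1]) (use aC 1 Cpq in auto)
  have l2: "lcm \<sigma> (a i) (mul \<sigma> x p) (mul \<sigma> y' t2) c2"
    unfolding Cpq(3) by (rule lcm_comp[OF 2(4) t2]) (use aC 2 Cpq in auto)
  have eq: "mul \<sigma> x' t1 = mul \<sigma> y' t2" "c1 = c2" using lcm_unique[OF l1 l2] .
  \<comment> \<open>At the bottom \<open>x\<close> and \<open>y\<close> both divide entry 0, hence
    so does their lcm, and nothing is carried to the left.\<close>
  have bot: "t1 = e" "t2 = e" if "i = 0"
  proof -
    have xy': "x' = e" "y' = e" using 1 2 that by auto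
    have "a i = mul \<sigma> x b1" using C1(3) aC[of i] unfolding xy' by simp
    moreover have "a i = mul \<sigma> y b2" using C2(3) aC[of i] unfolding xy' by simp
    ultimately have ai: "a i = mul \<sigma> x b1" "mul \<sigma> x b1 = mul \<sigma> y b2" by simp_all
    then obtain k where k: "k \<in> C" "b1 = mul \<sigma> p k"
      using lcm_factor[OF pq] C1 C2 by metis
    then have "a i = mul \<sigma> (mul \<sigma> x p) k" using ai(1) assoc[OF 1(1) Cpq(1) k(1)] k(2) by simp
    then have "lcm \<sigma> (a i) (mul \<sigma> x p) e k" using lcm_divides k 1 Cpq closed by metis
    then have "mul \<sigma> x' t1 = e" using lcm_unique l1 by blast
    then show "t1 = e" "t2 = e" using eq no_units[of x' t1 \<sigma>] no_units[of y' t2 \<sigma>] Ct C1 C2 by auto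
  qed
  have rb: "red_at i p b (res i t1 c1 s b)"
    unfolding red_at_def \<sigma>_def[symmetric]
    by (rule exI[of _ t1], rule exI[of _ c1], rule exI[of _ s])
      (use Cpq s t1 bot 1 in \<open>auto simp: res_def\<close>)
  have rc: "red_at i q c (res i t2 c2 s c)"
    unfolding red_at_def \<sigma>_def[symmetric]
    by (rule exI[of _ t2], rule exI[of _ c2], rule exI[of _ s])
      (use Cpq s t2 bot 2 in \<open>auto simp: res_def\<close>)
  have "res i t1 c1 s b = res i t2 c2 s c"
    using 1(6) 2(6) eq aC C1 C2 Ct by (auto simp: res_def fun_eq_iff \<sigma>_def assoc)
  moreover have "b \<in> seqs N"
    by (rule red_at_closed[OF assms(2) a])
  moreover have "c \<in> seqs N"
    by (rule red_at_closed[OF assms(3) a])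
  ultimately show ?thesis using red_at_rtrancl[OF rb] red_at_rtrancl[OF rc] by metis
qed

text \<open>After the reduction by \<open>y\<close>, the factor \<open>f\<close> has to be pushed in
  place of \<open>x\<close>; crossing \<open>y'\<close> turns it into the divisor \<open>x0\<close>
  of \<open>x\<close>. The other order has pushed all of \<open>x\<close>, so its entries
  \<open>i - 1\<close> and \<open>i\<close> carry a surplus common factor \<open>z1\<close>, which
  one more reduction at \<open>i - 1\<close> cancels.\<close>

lemma joinable_adjacent:
  assumes a: "a \<in> seqs N" and "red_at i x a b" "red_at (Suc i) y a c"
  shows "\<exists>d. (b, d) \<in> red\<^sup>* \<and> (c, d) \<in> red\<^sup>*"
proof -
  define \<sigma> where "\<sigma> = odd i"
  note aC = seqs_closed[OF a]
  have opp': "mul (odd (Suc i)) u v = mul \<sigma> v u" for u v using opp[of \<sigma>] by (simp add: \<sigma>_def)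
  have bN: "b \<in> seqs N"
    by (rule red_at_closed[OF assms(2) a])
  have cN: "c \<in> seqs N"
    by (rule red_at_closed[OF assms(3) a])
  obtain x' b1 c1 where 1: "x \<in> C" "c1 \<in> C" "a (Suc i) = mul \<sigma> x c1"
    "lcm \<sigma> (a i) x x' b1" "i = 0 \<longrightarrow> x' = e" "b = res i x' b1 c1 a"
    using assms(2) by (auto simp: red_at_def \<sigma>_def)
  obtain y' b2 d where 2: "y \<in> C" "d \<in> C" "a (Suc (Suc i)) = mul \<sigma> d y"
    "lcm (odd (Suc i)) (a (Suc i)) y y' b2" "c = res (Suc i) y' b2 d a"
    using assms(3) unfolding red_at_def opp' by auto
  note C1 = lcmD[OF 1(4)] and C2 = lcmD[OF 2(4), unfolded opp']
  have yxc: "mul \<sigma> (mul \<sigma> y' x) c1 = mul \<sigma> b2 y" using C2 1 by (simp add: assoc)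
  have yxc': "mul (odd (Suc i)) c1 (mul \<sigma> y' x) = mul (odd (Suc i)) y b2"
    unfolding opp' by (rule yxc)
  obtain y2 c2 where l2: "lcm (odd (Suc i)) c1 y y2 c2"
    using lcm_exists[OF yxc'] 1 2 C2 closed by metis
  note Cy2 = lcmD[OF l2, unfolded opp']
  obtain f where f: "f \<in> C" "mul \<sigma> y' x = mul \<sigma> f y2" "b2 = mul \<sigma> f c2"
    using lcm_factor[OF l2 yxc', unfolded opp'] 1 C2 closed by metis
  have rb: "red_at (Suc i) y b (res (Suc i) y2 c2 d b)"
    unfolding red_at_def opp'
    by (rule exI[of _ y2], rule exI[of _ c2], rule exI[of _ d])
      (use 1 2 l2 in \<open>auto simp: res_def\<close>)
  obtain x0 y0 where l3: "lcm \<sigma> y' f x0 y0"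
    using lcm_exists[OF f(2)] C2 f 1 Cy2 by metis
  note C3 = lcmD[OF l3]
  obtain x1 where x1: "x1 \<in> C" "x = mul \<sigma> x0 x1" "y2 = mul \<sigma> y0 x1"
    using lcm_factor[OF l3 f(2)] 1 Cy2 by metis
  have ax: "mul \<sigma> (a i) x' = mul \<sigma> x0 (mul \<sigma> x1 b1)"
    using C1 x1 C3 by (simp add: assoc)
  obtain z b0 where l4: "lcm \<sigma> (a i) x0 z b0"
    using lcm_exists[OF ax] aC C1 C3 x1 closed by metis
  note C4 = lcmD[OF l4]
  obtain z1 where z1: "z1 \<in> C" "x' = mul \<sigma> z z1" "mul \<sigma> x1 b1 = mul \<sigma> b0 z1"
    using lcm_factor[OF l4 ax] C1 x1 closed by metis
  have l5: "lcm \<sigma> (mul \<sigma> y' (a i)) f z (mul \<sigma> y0 b0)"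
    by (rule lcm_sym[OF lcm_comp[OF lcm_sym[OF l3] lcm_sym[OF l4]]]) (use aC C2 f in auto)
  have bot: "z = e" "z1 = e" if "i = 0"
    using no_units[OF C4(1) z1(1)] z1(2) 1(5) that by auto
  have rc: "red_at i f c (res i z (mul \<sigma> y0 b0) c2 c)"
    unfolding red_at_def \<sigma>_def[symmetric]
    by (rule exI[of _ z], rule exI[of _ "mul \<sigma> y0 b0"], rule exI[of _ c2])
      (use f Cy2 l5 2 bot in \<open>auto simp: res_def opp'[simplified]\<close>)
  let ?b = "res (Suc i) y2 c2 d b" and ?c = "res i z (mul \<sigma> y0 b0) c2 c"
  have b_i: "mul \<sigma> y2 b1 = mul \<sigma> (mul \<sigma> y0 b0) z1"
    using x1 z1 C1 C3 C4 by (simp add: assoc)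
  have eval_b: "?b j = (if j = Suc (Suc i) then d else if j = Suc i then c2 else if j = i then mul \<sigma> y2 b1
      else if Suc j = i then mul \<sigma> (a j) x' else a j)" for j
    using 1(6) opp' by (auto simp: res_def \<sigma>_def)
  have eval_c: "?c j = (if j = Suc (Suc i) then d else if j = Suc i then c2 else if j = i then mul \<sigma> y0 b0
      else if Suc j = i then mul \<sigma> (a j) z else a j)" for j
    using 2(5) opp' by (auto simp: res_def \<sigma>_def)
  have b1N: "(b, ?b) \<in> red\<^sup>*" by (rule red_at_rtrancl[OF rb bN])
  have c1N: "(c, ?c) \<in> red\<^sup>*" by (rule red_at_rtrancl[OF rc cN])
  have bN': "?b \<in> seqs N"
    by (rule red_at_closed[OF rb bN])
  have "(?b, ?c) \<in> red\<^sup>*"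
  proof (cases i)
    case 0
    have "?b j = ?c j" for j
      unfolding eval_b eval_c using 0 bot b_i C3 C4 by auto
    then have "?b = ?c" by (rule ext)
    then show ?thesis by simp
  next
    case (Suc k)
    have opk: "mul (odd k) u v = mul \<sigma> v u" for u v using opp[of "odd k" v u] Suc by (simp add: \<sigma>_def)
    have k: "?b k = mul \<sigma> (mul \<sigma> (a k) z) z1"
      unfolding eval_b using z1 C4 aC[of k] Suc by (simp add: assoc)
    have "red_at k z1 ?b ?c"
      unfolding red_at_def opk
    proof (rule exI[of _ e], rule exI[of _ "mul \<sigma> (a k) z"], rule exI[of _ "mul \<sigma> y0 b0"], intro conjI)
      show "?b (Suc k) = mul \<sigma> (mul \<sigma> y0 b0) z1" unfolding eval_b using b_i Suc by simp
      have "?b k = mul (odd k) z1 (mul \<sigma> (a k) z)" using k opk by simp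
      then show "lcm (odd k) (?b k) z1 e (mul \<sigma> (a k) z)"
        using lcm_divides[of z1 "mul \<sigma> (a k) z" "odd k"] z1 aC[of k] C4 by simp
      show "?c = res k e (mul \<sigma> (a k) z) (mul \<sigma> y0 b0) ?b"
        unfolding fun_eq_iff eval_c res_def[of k] opk eval_b using Suc aC by auto
    qed (use z1 C3 C4 in auto)
    then show ?thesis using red_at_rtrancl bN' by blast
  qed
  then show ?thesis using b1N c1N by (meson rtrancl_trans)
qed

text \<open>The reductions commute. They meet only for \<open>j = i + 2\<close>, where the second
  one multiplies entry \<open>i + 1\<close> by \<open>y'\<close> on the side away from
  \<open>x\<close>; the cofactor \<open>c1'\<close> records this.\<close>

lemma joinable_far:
  assumes a: "a \<in> seqs N" and "red_at i x a b" "red_at j y a c" and ij: "Suc (Suc i) \<le> j"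
  shows "\<exists>d. (b, d) \<in> red\<^sup>* \<and> (c, d) \<in> red\<^sup>*"
proof -
  note aC = seqs_closed[OF a]
  have bN: "b \<in> seqs N"
    by (rule red_at_closed[OF assms(2) a])
  have cN: "c \<in> seqs N"
    by (rule red_at_closed[OF assms(3) a])
  obtain x' b1 c1 where 1: "x \<in> C" "c1 \<in> C" "a (Suc i) = mul (odd i) x c1"
    "lcm (odd i) (a i) x x' b1" "i = 0 \<longrightarrow> x' = e" "b = res i x' b1 c1 a"
    using assms(2) by (auto simp: red_at_def)
  obtain y' b2 c2 where 2: "y \<in> C" "c2 \<in> C" "a (Suc j) = mul (odd j) y c2"
    "lcm (odd j) (a j) y y' b2" "c = res j y' b2 c2 a"
    using assms(3) by (auto simp: red_at_def)
  note C1 = lcmD[OF 1(4)] and C2 = lcmD[OF 2(4)]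
  define c1' where "c1' = (if j = Suc (Suc i) then mul (odd i) c1 y' else c1)"
  have rb: "red_at j y b (res j y' b2 c2 b)"
    unfolding red_at_def
    by (rule exI[of _ y'], rule exI[of _ b2], rule exI[of _ c2]) (use 1 2 ij in \<open>auto simp: res_def\<close>)
  have rc: "red_at i x c (res i x' b1 c1' c)"
    unfolding red_at_def
    by (rule exI[of _ x'], rule exI[of _ b1], rule exI[of _ c1'])
      (use 1 2 ij C2 in \<open>auto simp: res_def c1'_def assoc\<close>)
  have "res j y' b2 c2 b = res i x' b1 c1' c"
    using 1(6) 2(5) ij by (auto simp: res_def fun_eq_iff c1'_def)
  then show ?thesis using red_at_rtrancl[OF rb bN] red_at_rtrancl[OF rc cN] by metis
qed

lemma red_locally_confluent:
  assumes "(a, b) \<in> red" "(a, c) \<in> red"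
  shows "\<exists>d. (b, d) \<in> red\<^sup>* \<and> (c, d) \<in> red\<^sup>*"
proof -
  obtain N i x j y where a: "a \<in> seqs N" and 1: "red_at i x a b" and 2: "red_at j y a c"
    using assms unfolding red_def by blast
  consider "i = j" | "j = Suc i" | "i = Suc j" | "Suc (Suc i) \<le> j" | "Suc (Suc j) \<le> i" by linarith
  then show ?thesis
  proof cases
    case 1
    then show ?thesis using joinable_same[OF a] \<open>red_at i x a b\<close> 2 by blast
  next
    case 2
    then show ?thesis using joinable_adjacent[OF a 1] \<open>red_at j y a c\<close> by blast
  next
    case 3
    then show ?thesis using joinable_adjacent[OF a 2] 1 by blast
  next
    case 4
    then show ?thesis using joinable_far[OF a 1 2] by blast
  next
    case 5
    then show ?thesis using joinable_far[OF a 2 1] by blast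
  qed
qed

text \<open>Newman's argument, for each bound \<open>N\<close> on the support separately, since
  termination is available in this form.\<close>

lemma red_confluent:
  assumes "a \<in> seqs N" "(a, b) \<in> red\<^sup>*" "(a, c) \<in> red\<^sup>*"
  shows "\<exists>d. (b, d) \<in> red\<^sup>* \<and> (c, d) \<in> red\<^sup>*"
  using assms
proof (induction a arbitrary: b c rule: wf_induct_rule[OF wf_red[of N]])
  case (1 a)
  have IH: "\<exists>d. (b', d) \<in> red\<^sup>* \<and> (c', d) \<in> red\<^sup>*"
    if "(a, a') \<in> red" "(a', b') \<in> red\<^sup>*" "(a', c') \<in> red\<^sup>*" for a' b' c'
    using "1.IH"[of a' b' c'] that "1.prems"(1) red_seqs[OF that(1) "1.prems"(1)] by simp
  show ?case
  proof (cases "a = b \<or> a = c")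
    case True
    then show ?thesis using "1.prems"(2,3) by auto
  next
    case False
    obtain b1 where b1: "(a, b1) \<in> red" "(b1, b) \<in> red\<^sup>*"
      using "1.prems"(2) False by (metis converse_rtranclE)
    obtain c1 where c1: "(a, c1) \<in> red" "(c1, c) \<in> red\<^sup>*"
      using "1.prems"(3) False by (metis converse_rtranclE)
    obtain d where d: "(b1, d) \<in> red\<^sup>*" "(c1, d) \<in> red\<^sup>*"
      using red_locally_confluent[OF b1(1) c1(1)] by blast
    obtain f where f: "(b, f) \<in> red\<^sup>*" "(d, f) \<in> red\<^sup>*" using IH[OF b1 d(1)] by blast
    obtain g where g: "(c, g) \<in> red\<^sup>*" "(f, g) \<in> red\<^sup>*"
      using IH[OF c1 rtrancl_trans[OF d(2) f(2)]] by blast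
    show ?thesis using rtrancl_trans[OF f(1) g(2)] g(1) by blast
  qed
qed

definition sim :: "(nat \<Rightarrow> 'm) rel" where
  "sim = (red \<union> red\<inverse>)\<^sup>*"

lemma sim_joinable:
  assumes "(a, b) \<in> sim"
  shows "\<exists>d. (a, d) \<in> red\<^sup>* \<and> (b, d) \<in> red\<^sup>*"
  using assms unfolding sim_def
proof (induction rule: rtrancl_induct)
  case (step b c)
  then obtain d where d: "(a, d) \<in> red\<^sup>*" "(b, d) \<in> red\<^sup>*" by blast
  from step.hyps(2) show ?case
  proof
    assume bc: "(b, c) \<in> red"
    then obtain N where "b \<in> seqs N" by (auto simp: red_def)
    then obtain f where "(c, f) \<in> red\<^sup>*" "(d, f) \<in> red\<^sup>*" using red_confluent bc d by blast
    then show ?thesis using d by (meson rtrancl_trans)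
  next
    assume "(b, c) \<in> red\<inverse>"
    then show ?thesis using d by (meson converseD converse_rtrancl_into_rtrancl)
  qed
qed blast

text \<open>A sequence with trivial entries from 1 on is irreducible, since a reduction needs a
  nontrivial divisor of such an entry. By confluence, equivalent ones coincide.\<close>

lemma sim_single:
  assumes "u \<in> C" "v \<in> C" "((\<lambda>_. e)(0 := u), (\<lambda>_. e)(0 := v)) \<in> sim"
  shows "u = v"
proof -
  have irr: "b = (\<lambda>_. e)(0 := w)" if "((\<lambda>_. e)(0 := w), b) \<in> red\<^sup>*" for w b
    using that
  proof (cases rule: converse_rtranclE)
    case (step c)
    then obtain i x where x: "x \<noteq> e" "red_at i x ((\<lambda>_. e)(0 := w)) c" by (auto simp: red_def)
    then obtain a' where "x \<in> C" "a' \<in> C" "((\<lambda>_. e)(0 := w)) (Suc i) = mul (odd i) x a'"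
      unfolding red_at_def by blast
    then show ?thesis using no_units(1)[of x a' "odd i"] x(1) by simp
  qed simp
  obtain d where "((\<lambda>_. e)(0 := u), d) \<in> red\<^sup>*" "((\<lambda>_. e)(0 := v), d) \<in> red\<^sup>*"
    using sim_joinable[OF assms(3)] by blast
  then have "(\<lambda>_. e)(0 := u) = ((\<lambda>_. e)(0 := v) :: nat \<Rightarrow> 'm)" using irr by metis
  then show ?thesis by (metis fun_upd_same)
qed

end

section \<open>The group action on multifractions\<close>

context ore_monoid
begin

lemma sim_refl [simp]: "(a, a) \<in> sim"
  by (simp add: sim_def)

lemma sim_trans [trans]: "(a, b) \<in> sim \<Longrightarrow> (b, c) \<in> sim \<Longrightarrow> (a, c) \<in> sim"
  unfolding sim_def by (rule rtrancl_trans)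

lemma sim_sym: "(a, b) \<in> sim \<Longrightarrow> (b, a) \<in> sim"
proof -
  have "sym (red \<union> red\<inverse>)" by (auto simp: sym_def)
  then show "(a, b) \<in> sim \<Longrightarrow> (b, a) \<in> sim" unfolding sim_def by (meson sym_rtrancl symD)
qed

lemma red_sim: "(a, b) \<in> red\<^sup>* \<Longrightarrow> (a, b) \<in> sim"
  unfolding sim_def by (rule subsetD[OF rtrancl_mono]) auto

lemma seqs_mono: "a \<in> seqs n \<Longrightarrow> n \<le> m \<Longrightarrow> a \<in> seqs m"
  by (auto simp: seqs_def)

lemma seqs_upd: "a \<in> seqs n \<Longrightarrow> y \<in> C \<Longrightarrow> n \<le> m \<Longrightarrow> a(m := y) \<in> seqs (Suc m)"
  by (auto simp: seqs_def)

lemma red_upd: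
  assumes "(a, b) \<in> red" "a \<in> seqs n" "y \<in> C"
  shows "(a(n := y), b(n := y)) \<in> sim"
proof -
  obtain i x where x: "x \<noteq> e" "red_at i x a b" using assms(1) by (auto simp: red_def)
  have i: "Suc i < n" using red_at_seqs(2)[OF x(2) assms(2) x(1)] .
  obtain x' b' a' where 1: "x \<in> C" "a' \<in> C" "a (Suc i) = mul (odd i) x a'"
    "lcm (odd i) (a i) x x' b'" "i = 0 \<longrightarrow> x' = e" "b = res i x' b' a' a"
    using x(2) by (auto simp: red_at_def)
  have "red_at i x (a(n := y)) (b(n := y))"
    unfolding red_at_def
    by (rule exI[of _ x'], rule exI[of _ b'], rule exI[of _ a'])
      (use 1 i in \<open>auto simp: res_def fun_eq_iff\<close>)
  then show ?thesis using red_at_rtrancl seqs_upd[OF assms(2,3) order_refl] red_sim by blast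
qed

text \<open>For \<open>a\<close> in \<open>seqs n\<close>, the update at \<open>n\<close> appends an
  entry whose sign is the parity of \<open>n\<close>. Two entries of equal sign merge because
  \<open>z\<close> can be pushed across the trivial entry between them; the sign decides the order
  of the product.\<close>

lemma upd_upd_mul:
  assumes a: "a \<in> seqs n" and y: "y \<in> C" and z: "z \<in> C"
  shows "(a(n := y, Suc (Suc n) := z), a(n := mul (even n) y z)) \<in> sim"
proof -
  let ?a = "a(n := y, Suc (Suc n) := z)"
  have e: "a j = e" if "n \<le> j" for j using a that by (simp add: seqs_def)
  have "red_at (Suc n) z ?a (a(n := mul (even n) y z))"
    unfolding red_at_def
    by (rule exI[of _ z], rule exI[of _ e], rule exI[of _ e])
      (use y z lcm_sym[OF lcm_e[OF z]] e in \<open>auto simp: res_def fun_eq_iff\<close>)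
  moreover have "?a \<in> seqs (Suc (Suc (Suc n)))"
    using a y z by (auto simp: seqs_def)
  ultimately show ?thesis using red_at_rtrancl red_sim by blast
qed

lemma upd_shift:
  assumes "a \<in> seqs n" "y \<in> C"
  shows "(a(n + 2 * k := y), a(n := y)) \<in> sim"
proof (induction k)
  case (Suc k)
  let ?m = "n + 2 * k"
  have "a(?m := e) = a" using assms(1) by (auto simp: seqs_def fun_eq_iff)
  then have "(a(Suc (Suc ?m) := y), a(?m := y)) \<in> sim"
    using upd_upd_mul[of a ?m e y] seqs_mono[OF assms(1), of ?m] assms(2) by simp
  also note Suc
  finally show ?case by (simp add: fun_upd_def)
qed simp

lemma upd_same:
  assumes "a \<in> seqs n" "a \<in> seqs m" "even n = even m" "y \<in> C"
  shows "(a(n := y), a(m := y)) \<in> sim"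
proof -
  have *: "(a(m := y), a(n := y)) \<in> sim" if "n \<le> m" "a \<in> seqs n" "even n = even m" for n m
  proof -
    have "even (m - n)" using that by simp
    then obtain k where "m - n = 2 * k" by (elim evenE)
    then have "m = n + 2 * k" using that by simp
    then show ?thesis using upd_shift that assms by simp
  qed
  show ?thesis
  proof (cases "n \<le> m")
    case True
    then show ?thesis using *[OF True assms(1,3)] sim_sym by blast
  next
    case False
    then show ?thesis using *[of m n] assms by simp
  qed
qed

text \<open>Appending an entry of given sign is well defined on classes. It is to become right
  multiplication in the group.\<close>

lemma upd_cong:
  assumes "(a, b) \<in> sim" "a \<in> seqs n" "b \<in> seqs m" "even n = even m" "y \<in> C"
  shows "(a(n := y), b(m := y)) \<in> sim"
proof -
  have "(a, b) \<in> (red \<union> red\<inverse>)\<^sup>*" using assms(1) by (simp add: sim_def)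
  then show ?thesis using assms(3,4)
  proof (induction arbitrary: m rule: rtrancl_induct)
    case base
    then show ?case using upd_same assms(2,5) by blast
  next
    case (step b c)
    have dom: "\<exists>N. f \<in> seqs N" if "(f, g) \<in> red" for f g using that by (auto simp: red_def)
    obtain N where N: "b \<in> seqs N" "c \<in> seqs N"
      using step.hyps(2) red_seqs dom by (metis UnE converseD)
    \<comment> \<open>This position has the parity of \<open>m\<close> and lies beyond the support
      of both \<open>b\<close> and \<open>c\<close>.\<close>
    define K where "K = m + 2 * N"
    have K: "b \<in> seqs K" "c \<in> seqs K" "even K = even m"
      using seqs_mono[OF N(1), of K] seqs_mono[OF N(2), of K] by (simp_all add: K_def)
    have "(a(n := y), b(K := y)) \<in> sim" by (rule step.IH[OF K(1)]) (use K step.prems in simp)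
    also have "(b(K := y), c(K := y)) \<in> sim"
      using step.hyps(2) red_upd K assms(5) sim_sym by blast
    also have "(c(K := y), c(m := y)) \<in> sim" using upd_same K step.prems assms(5) by blast
    finally show ?case .
  qed
qed

lemma upd_inverse:
  assumes a: "a \<in> seqs n" and y: "y \<in> C"
  shows "(a(n := y, Suc n := y), a) \<in> sim"
proof -
  let ?a = "a(n := y, Suc n := y)"
  have e: "a j = e" if "n \<le> j" for j using a that by (simp add: seqs_def)
  have l: "lcm (odd n) y y e e" using lcm_divides[of y e "odd n"] y by simp
  have "red_at n y ?a a"
    unfolding red_at_def
    by (rule exI[of _ e], rule exI[of _ e], rule exI[of _ e])
      (use y l e seqs_closed[OF a] in \<open>auto simp: res_def fun_eq_iff\<close>)
  moreover have "?a \<in> seqs (Suc (Suc n))"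
    using a y by (auto simp: seqs_def)
  ultimately show ?thesis using red_at_rtrancl red_sim by blast
qed

end

section \<open>Representations by partial injections\<close>

fun lstep :: "('a \<Rightarrow> ('v \<times> 'v) set) \<Rightarrow> 'a letter \<Rightarrow> ('v \<times> 'v) set" where
  "lstep T (Pos x) = T x"
| "lstep T (Neg x) = (T x)\<inverse>"

fun run :: "('a \<Rightarrow> ('v \<times> 'v) set) \<Rightarrow> 'a letter list \<Rightarrow> ('v \<times> 'v) set" where
  "run T [] = Id"
| "run T (l # w) = lstep T l O run T w"

lemma run_append: "run T (u @ v) = run T u O run T v"
  by (induction u) (auto simp: O_assoc)

lemma lstep_inv: "lstep T (inv_letter l) = (lstep T l)\<inverse>"
  by (cases l) auto

lemma inv_word_Cons: "inv_word (l # w) = inv_word w @ [inv_letter l]"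
  by (simp add: inv_word_def)

lemma run_inv_word: "run T (inv_word w) = (run T w)\<inverse>"
  by (induction w) (simp_all add: run_append lstep_inv inv_word_Cons converse_relcomp, simp add: inv_word_def)

lemma run_single_valued:
  assumes "\<And>x. single_valued (T x)" "\<And>x. single_valued ((T x)\<inverse>)"
  shows "single_valued (run T w)"
proof (induction w)
  case (Cons l w)
  have "single_valued (lstep T l)" using assms by (cases l) auto
  then show ?case using Cons by (auto intro: single_valued_relcomp)
qed auto

text \<open>Partial injections form an inverse monoid, so letting the letters act by partial
  injections that respect \<open>R\<close> gives an invariant of the congruence. It is applied to
  \<open>act\<close> and to \<open>path_step\<close>.\<close>

lemma run_inv_cong:
  assumes sv: "\<And>x. single_valued (T x)" "\<And>x. single_valued ((T x)\<inverse>)"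
    and rel: "\<And>r s. (r, s) \<in> R \<Longrightarrow> run T (map Pos r) = run T (map Pos s)"
    and "(u, v) \<in> inv_cong X R"
  shows "run T u = run T v"
  using assms(4)
proof induction
  case (regular w)
  have "single_valued (run T w)" by (rule run_single_valued[OF sv])
  then show ?case by (auto simp: run_append run_inv_word single_valued_def)
next
  case (commute u v)
  have *: "run T w O run T (inv_word w) \<subseteq> Id" for w
    using run_single_valued[OF sv, where w = "inv_word w"]
    by (auto simp: run_inv_word single_valued_def)
  have "A O B = B O A" if "A \<subseteq> Id" "B \<subseteq> Id" for A B :: "('v \<times> 'v) set"
    using that by auto
  from this[OF *[of u] *[of v]] show ?case by (simp add: run_append O_assoc)
qed (auto simp: run_append rel)

section \<open>Embedding the semigroup into its group\<close>

definition rev_rel :: "'a relations \<Rightarrow> 'a relations" where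
  "rev_rel D = map_prod rev rev ` D"

lemma rev_rel_rev_rel [simp]: "rev_rel (rev_rel D) = D"
  by (force simp: rev_rel_def image_iff)

lemma scong_rev: "(u, v) \<in> scong D \<Longrightarrow> (rev u, rev v) \<in> scong (rev_rel D)"
  unfolding scong_def
proof (induction rule: rtrancl_induct)
  case (step v w)
  then obtain p q r s where "v = p @ r @ q" "w = p @ s @ q" "(r, s) \<in> D"
    by (auto simp: rstep_def)
  then have "(rev q @ rev r @ rev p, rev q @ rev s @ rev p) \<in> rstep (rev_rel D)"
    unfolding rstep_def rev_rel_def by force
  then have "(rev v, rev w) \<in> rstep (rev_rel D)" using \<open>v = _\<close> \<open>w = _\<close> by simp
  then show ?case using step.IH by (rule rtrancl_into_rtrancl[rotated])
qed simp

lemma scong_rev_iff: "(rev u, rev v) \<in> scong (rev_rel D) \<longleftrightarrow> (u, v) \<in> scong D"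
  using scong_rev[of u v D] scong_rev[of "rev u" "rev v" "rev_rel D"] by auto

locale adian_semigroup =
  fixes D :: "'a relations"
  assumes sym: "sym D"
    and nonempty: "(r, s) \<in> D \<Longrightarrow> r \<noteq> []"
    and forest_hd: "walk_forest D hd"
    and forest_last: "walk_forest D last"
    and finite_classes: "finite {w'. (w, w') \<in> scong D}"
begin

sublocale L: left_adian D
  by unfold_locales (use sym nonempty forest_hd finite_classes in auto)

text \<open>Reversal exchanges first and last letters, so the right graph of \<open>D\<close>
  becomes the left graph of \<open>rev_rel D\<close>. Left cancellation, lcms and the Ore condition
  there are the right-sided ones for \<open>D\<close>.\<close>

sublocale Rv: left_adian "rev_rel D"
proof
  show "Relation.sym (rev_rel D)" using sym by (force simp: rev_rel_def sym_def)
  show "r \<noteq> []" if "(r, s) \<in> rev_rel D" for r s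
    using that nonempty by (auto simp: rev_rel_def)
  show "walk_forest (rev_rel D) hd"
    unfolding walk_forest_def
  proof (intro allI impI)
    fix x ds assume ds: "walk (rev_rel D) hd x ds x" "reduced ds"
    have ne: "d \<in> rev_rel D \<Longrightarrow> fst d \<noteq> [] \<and> snd d \<noteq> []" for d
      using nonempty L.nonempty' by (force simp: rev_rel_def)
    have "walk D last x (map (map_prod rev rev) ds) y" if "walk (rev_rel D) hd x ds y" for x y ds
      using that
    proof (induction ds arbitrary: x)
      case (Cons d ds)
      have "map_prod rev rev d \<in> D"
        using Cons.prems by (force simp: rev_rel_def)
      moreover have "last (rev (fst d)) = hd (fst d)" "last (rev (snd d)) = hd (snd d)"
        using ne[of d] Cons.prems by (auto simp: last_rev)
      ultimately show ?case using Cons by simp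
    qed simp
    from this[OF ds(1)] have "walk D last x (map (map_prod rev rev) ds) x" .
    moreover have "reduced (map (map_prod rev rev) ds)"
      using ds(2) unfolding reduced_def successively_map
      by (rule successively_mono) (auto simp: prod_eq_iff)
    ultimately show "ds = []" using forest_last by (auto simp: walk_forest_def)
  qed
  show "finite {w'. (w, w') \<in> scong (rev_rel D)}" for w
  proof -
    have "{w'. (w, w') \<in> scong (rev_rel D)} \<subseteq> rev ` {w'. (rev w, w') \<in> scong D}"
    proof
      fix w' assume "w' \<in> {w'. (w, w') \<in> scong (rev_rel D)}"
      then have "rev w' \<in> {w'. (rev w, w') \<in> scong D}"
        using scong_rev[of w w' "rev_rel D"] by simp
      then show "w' \<in> rev ` {w'. (rev w, w') \<in> scong D}" by (metis image_eqI rev_rev_ident)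
    qed
    then show ?thesis using finite_classes finite_subset by blast
  qed
qed

abbreviation eqv :: "'a list \<Rightarrow> 'a list \<Rightarrow> bool" (infix "\<approx>" 50) where
  "u \<approx> v \<equiv> (u, v) \<in> scong D"

definition cat :: "bool \<Rightarrow> 'a list \<Rightarrow> 'a list \<Rightarrow> 'a list" where
  "cat \<sigma> u v = (if \<sigma> then u @ v else v @ u)"

lemma rev_cat_False: "rev (cat False u v) = rev u @ rev v"
  by (simp add: cat_def)

lemma cat_False_eqv: "cat False u v \<approx> cat False u' v' \<longleftrightarrow>
    (rev u @ rev v, rev u' @ rev v') \<in> scong (rev_rel D)"
  using scong_rev_iff[of "cat False u v" "cat False u' v'" D] by (simp add: rev_cat_False)

lemma cat_cancel: "cat \<sigma> p u \<approx> cat \<sigma> p v \<Longrightarrow> u \<approx> v"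
proof (cases \<sigma>)
  case False
  then show "cat \<sigma> p u \<approx> cat \<sigma> p v \<Longrightarrow> u \<approx> v"
    using Rv.left_cancel[of "rev p" "rev u" "rev v"] by (simp add: cat_False_eqv scong_rev_iff)
qed (use L.left_cancel in \<open>simp add: cat_def\<close>)

lemma cat_lcm:
  assumes "cat \<sigma> u p \<approx> cat \<sigma> v q"
  shows "\<exists>p0 q0. cat \<sigma> u p0 \<approx> cat \<sigma> v q0 \<and>
    (\<forall>p' q'. cat \<sigma> u p' \<approx> cat \<sigma> v q' \<longrightarrow> (\<exists>t. p' \<approx> cat \<sigma> p0 t \<and> q' \<approx> cat \<sigma> q0 t))"
proof (cases \<sigma>)
  case True
  then show ?thesis using L.lcm_exists[of u p v q] assms by (simp add: cat_def L.is_lcm_def)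
next
  case False
  then obtain p0 q0 where l: "Rv.is_lcm (rev u) (rev v) p0 q0"
    using Rv.lcm_exists[of "rev u" "rev p" "rev v" "rev q"] assms by (auto simp: cat_False_eqv)
  have "cat False u (rev p0) \<approx> cat False v (rev q0)"
    using Rv.is_lcmD(1)[OF l] by (simp add: cat_False_eqv)
  moreover have "\<exists>t. p' \<approx> cat False (rev p0) t \<and> q' \<approx> cat False (rev q0) t"
    if pq: "cat False u p' \<approx> cat False v q'" for p' q'
  proof -
    obtain t where "(rev p', p0 @ t) \<in> scong (rev_rel D)" "(rev q', q0 @ t) \<in> scong (rev_rel D)"
      using Rv.is_lcmD(2)[OF l] pq by (auto simp: cat_False_eqv)
    then have "p' \<approx> rev (p0 @ t)" "q' \<approx> rev (q0 @ t)"
      using scong_rev_iff[of p' "rev (p0 @ t)" D] scong_rev_iff[of q' "rev (q0 @ t)" D] by auto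
    then have "p' \<approx> cat False (rev p0) (rev t) \<and> q' \<approx> cat False (rev q0) (rev t)"
      by (simp add: cat_def)
    then show ?thesis by blast
  qed
  moreover have "\<sigma> = False" using False by simp
  ultimately show ?thesis by blast
qed

lemma cat_ore:
  assumes "cat \<sigma> u p1 \<approx> cat \<sigma> v p2" "cat \<sigma> v q2 \<approx> cat \<sigma> w q3" "cat \<sigma> u r1 \<approx> cat \<sigma> w r3"
  shows "\<exists>x y z. cat \<sigma> u x \<approx> cat \<sigma> v y \<and> cat \<sigma> v y \<approx> cat \<sigma> w z"
proof (cases \<sigma>)
  case True
  then show ?thesis using L.ore[of u p1 v p2 q2 w q3 r1 r3] assms by (simp add: cat_def)
next
  case False
  then obtain x y z where "(rev u @ x, rev v @ y) \<in> scong (rev_rel D)" "(rev v @ y, rev w @ z) \<in> scong (rev_rel D)"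
    using Rv.ore[of "rev u" "rev p1" "rev v" "rev p2" "rev q2" "rev w" "rev q3" "rev r1" "rev r3"] assms
    by (auto simp: cat_False_eqv)
  then have "cat False u (rev x) \<approx> cat False v (rev y) \<and> cat False v (rev y) \<approx> cat False w (rev z)"
    by (simp add: cat_False_eqv)
  moreover have "\<sigma> = False" using False by simp
  ultimately show ?thesis by blast
qed

definition cl :: "'a list \<Rightarrow> 'a list set" where
  "cl w = {w'. w \<approx> w'}"

definition rep :: "'a list set \<Rightarrow> 'a list" where
  "rep A = (SOME w. cl w = A)"

definition cmul :: "bool \<Rightarrow> 'a list set \<Rightarrow> 'a list set \<Rightarrow> 'a list set" where
  "cmul \<sigma> A B = cl (cat \<sigma> (rep A) (rep B))"

lemma cl_eq_iff: "cl u = cl v \<longleftrightarrow> u \<approx> v"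
proof
  assume "cl u = cl v"
  then have "v \<in> cl u" by (simp add: cl_def)
  then show "u \<approx> v" by (simp add: cl_def)
qed (auto simp: cl_def intro: scong_trans L.eqv_sym)

lemma rep_cl: "rep (cl w) \<approx> w"
  unfolding rep_def cl_eq_iff[symmetric] by (rule someI[of _ w]) simp

lemma cmul_cl [simp]: "cmul \<sigma> (cl u) (cl v) = cl (cat \<sigma> u v)"
  unfolding cmul_def cl_eq_iff cat_def using scong_append[OF rep_cl rep_cl] by simp

sublocale M: ore_monoid "range cl" cmul "cl []" "\<lambda>A. L.lam (rep A)"
proof
  fix A B \<sigma> assume "A \<in> range cl" "B \<in> range cl"
  then obtain a b where ab: "A = cl a" "B = cl b" by blast
  show "cmul \<sigma> A B \<in> range cl" by (simp add: cmul_def)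
  have lam: "L.lam (rep (cl w)) = L.lam w" for w by (rule L.lam_eqv[OF rep_cl])
  show "L.lam (rep A) + L.lam (rep B) \<le> L.lam (rep (cmul \<sigma> A B))"
    using L.lam_append[of a b] L.lam_append[of b a] by (simp add: ab lam cat_def)
next
  show "cl [] \<in> range cl" by simp
next
  show "cmul (\<not> \<sigma>) A B = cmul \<sigma> B A" for A B \<sigma> by (simp add: cmul_def cat_def)
next
  fix A B E \<sigma> assume "A \<in> range cl" "B \<in> range cl" "E \<in> range cl"
  then obtain a b c where ab: "A = cl a" "B = cl b" "E = cl c" by blast
  show "cmul \<sigma> (cmul \<sigma> A B) E = cmul \<sigma> A (cmul \<sigma> B E)" by (simp add: ab cat_def)
  show "B = E" if "cmul \<sigma> A B = cmul \<sigma> A E"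
    using that cat_cancel[of \<sigma> a b c] by (simp add: ab cl_eq_iff)
next
  show "cmul \<sigma> (cl []) A = A" if "A \<in> range cl" for A \<sigma> using that by (elim rangeE) (simp add: cat_def)
next
  fix A assume "A \<in> range cl" "A \<noteq> cl []"
  then obtain a where a: "A = cl a" "a \<noteq> []" by auto
  then have "0 < L.lam a" using L.length_le_lam[of a a] by (cases a) auto
  then show "0 < L.lam (rep A)" using L.lam_eqv[OF rep_cl[of a]] a by simp
next
  have "[] \<approx> v \<longleftrightarrow> v = []" for v using L.eqv_Nil by auto
  then have "L.lam [] = 0" by (simp add: L.lam_def)
  then show "L.lam (rep (cl [])) = 0" using L.lam_eqv[OF rep_cl[of "[]"]] by simp
next
  fix A B P Q \<sigma> assume "A \<in> range cl" "B \<in> range cl" "P \<in> range cl" "Q \<in> range cl"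
    and eq: "cmul \<sigma> A P = cmul \<sigma> B Q"
  then obtain a b p q where ab: "A = cl a" "B = cl b" "P = cl p" "Q = cl q" by blast
  then have "cat \<sigma> a p \<approx> cat \<sigma> b q" using eq by (simp add: cl_eq_iff)
  then obtain p0 q0 where l: "cat \<sigma> a p0 \<approx> cat \<sigma> b q0"
    "\<And>p' q'. cat \<sigma> a p' \<approx> cat \<sigma> b q' \<Longrightarrow> \<exists>t. p' \<approx> cat \<sigma> p0 t \<and> q' \<approx> cat \<sigma> q0 t"
    using cat_lcm by metis
  show "\<exists>p0\<in>range cl. \<exists>q0\<in>range cl. cmul \<sigma> A p0 = cmul \<sigma> B q0 \<and>
      (\<forall>p'\<in>range cl. \<forall>q'\<in>range cl. cmul \<sigma> A p' = cmul \<sigma> B q' \<longrightarrow>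
        (\<exists>t\<in>range cl. p' = cmul \<sigma> p0 t \<and> q' = cmul \<sigma> q0 t))"
    by (rule bexI[of _ "cl p0"], rule bexI[of _ "cl q0"])
      (use l in \<open>auto simp: ab cl_eq_iff\<close>)
next
  fix A B E P1 P2 Q2 Q3 R1 R3 \<sigma>
  assume "{A, B, E, P1, P2, Q2, Q3, R1, R3} \<subseteq> range cl"
    and eq: "cmul \<sigma> A P1 = cmul \<sigma> B P2" "cmul \<sigma> B Q2 = cmul \<sigma> E Q3" "cmul \<sigma> A R1 = cmul \<sigma> E R3"
  then obtain a b c p1 p2 q2 q3 r1 r3 where ab: "A = cl a" "B = cl b" "E = cl c"
    "P1 = cl p1" "P2 = cl p2" "Q2 = cl q2" "Q3 = cl q3" "R1 = cl r1" "R3 = cl r3"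
    unfolding insert_subset image_iff by metis
  obtain x y z where "cat \<sigma> a x \<approx> cat \<sigma> b y" "cat \<sigma> b y \<approx> cat \<sigma> c z"
    using cat_ore[of \<sigma> a p1 b p2 q2 c q3 r1 r3] eq by (auto simp: ab cl_eq_iff)
  then show "\<exists>x\<in>range cl. \<exists>y\<in>range cl. \<exists>z\<in>range cl. cmul \<sigma> A x = cmul \<sigma> B y \<and> cmul \<sigma> B y = cmul \<sigma> E z"
    by (auto simp: ab cl_eq_iff)
qed

section \<open>The action of the letters on classes of multifractions\<close>

definition \<Omega> :: "(nat \<Rightarrow> 'a list set) set set" where
  "\<Omega> = {M.sim `` {a} | a n. a \<in> M.seqs n}"

definition act :: "'a \<Rightarrow> ((nat \<Rightarrow> 'a list set) set \<times> (nat \<Rightarrow> 'a list set) set) set" where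
  "act x = {(M.sim `` {a}, M.sim `` {a(n := cl [x])}) | a n. a \<in> M.seqs n \<and> even n}"

lemma sim_class_eq: "M.sim `` {a} = M.sim `` {b} \<longleftrightarrow> (a, b) \<in> M.sim"
proof
  assume "M.sim `` {a} = M.sim `` {b}"
  then have "b \<in> M.sim `` {a}" using M.sim_refl[of b] by blast
  then show "(a, b) \<in> M.sim" by simp
qed (auto intro: M.sim_trans M.sim_sym)

lemma actI: "a \<in> M.seqs n \<Longrightarrow> even n \<Longrightarrow> (M.sim `` {a}, M.sim `` {a(n := cl [x])}) \<in> act x"
  by (auto simp: act_def)

lemma act_single_valued: "single_valued (act x)"
proof (rule single_valuedI)
  fix A B B' assume "(A, B) \<in> act x" "(A, B') \<in> act x"
  then obtain a n b m where a: "A = M.sim `` {a}" "B = M.sim `` {a(n := cl [x])}" "a \<in> M.seqs n" "even n"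
    and b: "A = M.sim `` {b}" "B' = M.sim `` {b(m := cl [x])}" "b \<in> M.seqs m" "even m"
    unfolding act_def by blast
  have "(a, b) \<in> M.sim" using a b sim_class_eq by blast
  then have "(a(n := cl [x]), b(m := cl [x])) \<in> M.sim" using M.upd_cong a b by blast
  then show "B = B'" using a b sim_class_eq by blast
qed

text \<open>Appending the same entry once more, at the next odd position, undoes the action.\<close>

lemma act_converse_single_valued: "single_valued ((act x)\<inverse>)"
proof (rule single_valuedI)
  fix B A A' assume "(B, A) \<in> (act x)\<inverse>" "(B, A') \<in> (act x)\<inverse>"
  then obtain a n b m where a: "A = M.sim `` {a}" "B = M.sim `` {a(n := cl [x])}" "a \<in> M.seqs n" "even n"
    and b: "A' = M.sim `` {b}" "B = M.sim `` {b(m := cl [x])}" "b \<in> M.seqs m" "even m"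
    unfolding act_def by blast
  have s: "(a(n := cl [x]), b(m := cl [x])) \<in> M.sim" using a b sim_class_eq by blast
  have "(a, a(n := cl [x], Suc n := cl [x])) \<in> M.sim"
    using M.upd_inverse[OF a(3)] M.sim_sym by blast
  also have "(a(n := cl [x], Suc n := cl [x]), b(m := cl [x], Suc m := cl [x])) \<in> M.sim"
    by (rule M.upd_cong[OF s]) (use a b M.seqs_upd in auto)
  also have "(b(m := cl [x], Suc m := cl [x]), b) \<in> M.sim" using M.upd_inverse[OF b(3)] by blast
  finally show "A = A'" using a b sim_class_eq by blast
qed

text \<open>Letters appended at successive even positions merge into one entry. For empty
  \<open>r\<close> the run is the identity on all sets, not just on classes of multifractions,
  whence the hypothesis.\<close>

lemma run_act_positive:
  "r \<noteq> [] \<Longrightarrow> run act (map Pos r) = {(M.sim `` {a}, M.sim `` {a(n := cl r)}) | a n. a \<in> M.seqs n \<and> even n}"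
proof (induction r)
  case (Cons x r)
  show ?case
  proof (cases "r = []")
    case True
    then show ?thesis by (simp add: act_def fun_upd_def)
  next
    case False
    note IH = Cons.IH[OF False]
    have mul: "(a(n := cl [x], Suc (Suc n) := cl r), a(n := cl (x # r))) \<in> M.sim"
      if "a \<in> M.seqs n" "even n" for a n
      using M.upd_upd_mul[OF that(1), of "cl [x]" "cl r"] that(2) by (simp add: cat_def)
    have "run act (map Pos (x # r)) = act x O run act (map Pos r)" by simp
    also have "\<dots> = {(M.sim `` {a}, M.sim `` {a(n := cl (x # r))}) | a n. a \<in> M.seqs n \<and> even n}"
    proof (intro equalityI subrelI)
      fix A B assume "(A, B) \<in> act x O run act (map Pos r)"
      then obtain a n b m where a: "A = M.sim `` {a}" "a \<in> M.seqs n" "even n"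
        and eq: "M.sim `` {a(n := cl [x])} = M.sim `` {b}"
        and b: "B = M.sim `` {b(m := cl r)}" "b \<in> M.seqs m" "even m"
        unfolding IH act_def by blast
      have "(b(m := cl r), a(n := cl [x], Suc (Suc n) := cl r)) \<in> M.sim"
      proof (rule M.upd_cong)
        show "(b, a(n := cl [x])) \<in> M.sim" using eq sim_class_eq by blast
        show "a(n := cl [x]) \<in> M.seqs (Suc (Suc n))"
          using M.seqs_mono[OF M.seqs_upd[OF a(2) _ order_refl]] by simp
      qed (use a b in auto)
      then have "B = M.sim `` {a(n := cl (x # r))}"
        using mul[OF a(2,3)] b sim_class_eq M.sim_trans by blast
      then show "(A, B) \<in> {(M.sim `` {a}, M.sim `` {a(n := cl (x # r))}) | a n. a \<in> M.seqs n \<and> even n}"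
        using a by blast
    next
      fix A B assume "(A, B) \<in> {(M.sim `` {a}, M.sim `` {a(n := cl (x # r))}) | a n. a \<in> M.seqs n \<and> even n}"
      then obtain a n where a: "A = M.sim `` {a}" "B = M.sim `` {a(n := cl (x # r))}" "a \<in> M.seqs n" "even n"
        by blast
      have "B = M.sim `` {a(n := cl [x], Suc (Suc n) := cl r)}"
        using mul[OF a(3,4)] a(2) sim_class_eq M.sim_sym by blast
      moreover have "a(n := cl [x]) \<in> M.seqs (Suc (Suc n))"
        using M.seqs_mono[OF M.seqs_upd[OF a(3) _ order_refl]] by simp
      ultimately have "(M.sim `` {a(n := cl [x])}, B) \<in> run act (map Pos r)"
        unfolding IH using a(4) by fastforce
      then show "(A, B) \<in> act x O run act (map Pos r)"
        using actI[OF a(3,4)] a(1) by blast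
    qed
    finally show ?thesis .
  qed
qed simp

text \<open>A preimage is found by appending the inverse of \<open>l\<close>: at an odd position for
  a positive letter, at an even one for a negative letter.\<close>

lemma act_total:
  assumes "A \<in> \<Omega>"
  shows "\<exists>B\<in>\<Omega>. (B, A) \<in> lstep act l"
proof -
  obtain a n where a: "A = M.sim `` {a}" "a \<in> M.seqs n" using assms by (auto simp: \<Omega>_def)
  show ?thesis
  proof (cases l)
    case (Neg x)
    obtain m where m: "even m" "a \<in> M.seqs m"
      using a(2) M.seqs_mono[OF a(2) le_SucI[OF order_refl]] even_Suc by metis
    have "M.sim `` {a(m := cl [x])} \<in> \<Omega>" using M.seqs_upd[OF m(2) _ order_refl] by (auto simp: \<Omega>_def)
    then show ?thesis using actI[OF m(2,1)] Neg a by auto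
  next
    case (Pos x)
    obtain m where m: "odd m" "a \<in> M.seqs m"
      using a(2) M.seqs_mono[OF a(2) le_SucI[OF order_refl]] even_Suc by metis
    have b: "a(m := cl [x]) \<in> M.seqs (Suc m)" using M.seqs_upd[OF m(2) _ order_refl] by simp
    have "(M.sim `` {a(m := cl [x])}, M.sim `` {a(m := cl [x], Suc m := cl [x])}) \<in> act x"
      using actI[OF b] m(1) by simp
    moreover have "M.sim `` {a(m := cl [x], Suc m := cl [x])} = A"
      using M.upd_inverse[OF m(2)] a(1) sim_class_eq by blast
    moreover have "M.sim `` {a(m := cl [x])} \<in> \<Omega>" using b by (auto simp: \<Omega>_def)
    ultimately show ?thesis using Pos by auto
  qed
qed

lemma run_act_total: "A \<in> \<Omega> \<Longrightarrow> \<exists>B\<in>\<Omega>. (B, A) \<in> run act z"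
proof (induction z)
  case (Cons l z)
  then obtain B where "B \<in> \<Omega>" "(B, A) \<in> run act z" by blast
  then show ?case using act_total[of B l] by auto
qed auto

text \<open>Tracing \<open>z\<close> backwards from the trivial multifraction gives some
  \<open>B\<close>. From \<open>B\<close>, the runs of both words end at multifractions with the
  single entries \<open>cl u\<close> and \<open>cl v\<close>; invariance makes these equivalent, and
  irreducibility makes them equal.\<close>

lemma group_embedding:
  assumes R: "R \<subseteq> D" and eq: "(z @ map Pos u, z @ map Pos v) \<in> inv_cong X R"
  shows "u \<approx> v"
proof -
  let ?o = "\<lambda>_::nat. cl []"
  have o: "?o \<in> M.seqs 0" by (simp add: M.seqs_def)
  have rel: "run act (map Pos r) = run act (map Pos s)" if "(r, s) \<in> R" for r s
  proof -
    have D: "(r, s) \<in> D" using that R by blast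
    have "cl r = cl s" using scong_rel[OF D] cl_eq_iff by blast
    then show ?thesis using run_act_positive nonempty[OF D] L.nonempty'[OF D] by simp
  qed
  note sv = act_single_valued act_converse_single_valued
  have run: "run act (z @ map Pos u) = run act (z @ map Pos v)"
    by (rule run_inv_cong[OF sv rel eq])
  have pos: "(M.sim `` {?o}, M.sim `` {?o(0 := cl w)}) \<in> run act (map Pos w)" for w
  proof (cases "w = []")
    case True
    then have "?o(0 := cl w) = ?o" by (simp add: fun_eq_iff)
    then show ?thesis using True by simp
  qed (use run_act_positive[of w] o in fastforce)
  have "M.sim `` {?o} \<in> \<Omega>" using o by (auto simp: \<Omega>_def)
  then obtain B where B: "(B, M.sim `` {?o}) \<in> run act z" using run_act_total by blast
  have end_w: "(B, M.sim `` {?o(0 := cl w)}) \<in> run act (z @ map Pos w)" for w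
    using B pos[of w] by (auto simp: run_append)
  have "M.sim `` {?o(0 := cl u)} = M.sim `` {?o(0 := cl v)}"
    by (rule single_valuedD[OF run_single_valued[OF sv] end_w[of u, unfolded run] end_w[of v]])
  then have "(?o(0 := cl u), ?o(0 := cl v)) \<in> M.sim" using sim_class_eq by blast
  then have "cl u = cl v" by (intro M.sim_single) auto
  then show ?thesis by (simp add: cl_eq_iff)
qed

end

section \<open>Schuetzenberger graphs\<close>

context
  fixes X :: "'a set" and R :: "'a relations"
  assumes pp: "positive_presentation X R"
begin

definition icong :: "'a letter list \<Rightarrow> 'a letter list \<Rightarrow> bool" (infix "\<doteq>" 50) where
  "u \<doteq> v \<longleftrightarrow> (u, v) \<in> inv_cong X R"

abbreviation wc :: "'a letter list \<Rightarrow> 'a letter list set" where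
  "wc \<equiv> word_class X R"

lemma icong_refl: "u \<in> words X \<Longrightarrow> u \<doteq> u"
  unfolding icong_def by (rule inv_cong.refl)

lemma icong_sym: "u \<doteq> v \<Longrightarrow> v \<doteq> u"
  unfolding icong_def by (rule inv_cong.sym)

lemma icong_trans [trans]: "u \<doteq> v \<Longrightarrow> v \<doteq> w \<Longrightarrow> u \<doteq> w"
  unfolding icong_def by (rule inv_cong.trans)

lemma icong_regular: "u \<in> words X \<Longrightarrow> u @ inv_word u @ u \<doteq> u"
  unfolding icong_def by (rule inv_cong.regular)

lemma icong_commute: "u \<in> words X \<Longrightarrow> v \<in> words X \<Longrightarrow>
    u @ inv_word u @ v @ inv_word v \<doteq> v @ inv_word v @ u @ inv_word u"
  unfolding icong_def by (rule inv_cong.commute)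

lemma icong_words: "u \<doteq> v \<Longrightarrow> u \<in> words X" "u \<doteq> v \<Longrightarrow> v \<in> words X"
  unfolding icong_def using inv_cong_words[OF pp] by blast+

lemma icong_compat: "u \<doteq> v \<Longrightarrow> p \<in> words X \<Longrightarrow> q \<in> words X \<Longrightarrow> p @ u @ q \<doteq> p @ v @ q"
  unfolding icong_def by (rule inv_cong.compat)

lemma icong_left: "u \<doteq> v \<Longrightarrow> p \<in> words X \<Longrightarrow> p @ u \<doteq> p @ v"
  using icong_compat[of u v p "[]"] by simp

lemma icong_right: "u \<doteq> v \<Longrightarrow> q \<in> words X \<Longrightarrow> u @ q \<doteq> v @ q"
  using icong_compat[of u v "[]" q] by simp

lemma icong_append: "u \<doteq> u' \<Longrightarrow> v \<doteq> v' \<Longrightarrow> u @ v \<doteq> u' @ v'"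
  unfolding icong_def by (rule inv_cong_append[OF pp])

lemma wc_eq_iff: "u \<in> words X \<Longrightarrow> v \<in> words X \<Longrightarrow> wc u = wc v \<longleftrightarrow> u \<doteq> v"
  unfolding icong_def by (rule word_class_eq_iff[OF pp])

lemma wc_eq: "u \<doteq> v \<Longrightarrow> wc u = wc v"
  using wc_eq_iff icong_words by blast

lemma icong_inv_word: "u \<doteq> v \<Longrightarrow> inv_word u \<doteq> inv_word v"
  using sg_inv_word_class[OF pp, of u] sg_inv_word_class[OF pp, of v] wc_eq[of u v] icong_words[of u v]
    wc_eq_iff[of "inv_word u" "inv_word v"] inv_word_words[of u X] inv_word_words[of v X] by simp

lemma Pos_words: "u \<in> lists X \<Longrightarrow> map Pos u \<in> words X"
  by (auto simp: in_lists_conv_set letters_def)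

lemma inv_word_append: "inv_word (u @ v) = inv_word v @ inv_word u"
  by (simp add: inv_word_def)

text \<open>In the inverse monoid, \<open>readable z y\<close> says that the path labelled \<open>y\<close> from the vertex \<open>z\<close>
  stays in the Schuetzenberger graph of \<open>z\<close>.\<close>

definition readable :: "'a letter list \<Rightarrow> 'a letter list \<Rightarrow> bool" where
  "readable z y \<longleftrightarrow> z @ y @ inv_word y \<doteq> z"

lemma readable_Nil: "z \<in> words X \<Longrightarrow> readable z []"
  by (simp add: readable_def inv_word_def icong_refl)

lemma readable_cong:
  assumes "readable z y" "z \<doteq> z'"
  shows "readable z' y"
proof -
  have y: "y @ inv_word y \<in> words X" using assms(1) icong_words unfolding readable_def by fastforce
  have "z' @ y @ inv_word y \<doteq> z @ y @ inv_word y" by (rule icong_right[OF icong_sym[OF assms(2)] y])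
  also have "\<dots> \<doteq> z" using assms(1) by (simp add: readable_def)
  also note assms(2)
  finally show ?thesis by (simp add: readable_def)
qed

lemma readable_label_cong:
  assumes "readable z y" "y \<doteq> y'" "z \<in> words X"
  shows "readable z y'"
proof -
  have "y' @ inv_word y' \<doteq> y @ inv_word y"
    using icong_append[OF icong_sym[OF assms(2)] icong_sym[OF icong_inv_word[OF assms(2)]]] .
  then have "z @ y' @ inv_word y' \<doteq> z @ y @ inv_word y" using assms(3) by (rule icong_left)
  also have "\<dots> \<doteq> z" using assms(1) by (simp add: readable_def)
  finally show ?thesis by (simp add: readable_def)
qed

lemma readable_append:
  assumes [simp]: "z \<in> words X" "a \<in> words X" "b \<in> words X"
  shows "readable z (a @ b) \<longleftrightarrow> readable z a \<and> readable (z @ a) b"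
proof
  note [simp] = inv_word_words[of a X] inv_word_words[of b X]
  assume r: "readable z (a @ b)"
  have ab: "z @ a @ b @ inv_word b @ inv_word a \<doteq> z"
    using r by (simp add: readable_def inv_word_append)
  have ra: "inv_word a @ a @ inv_word a \<doteq> inv_word a"
    using icong_regular[of "inv_word a"] by simp
  have "z @ a @ inv_word a \<doteq> z @ a @ b @ inv_word b @ inv_word a @ a @ inv_word a"
    using icong_right[OF icong_sym[OF ab], of "a @ inv_word a"] by simp
  also have "\<dots> \<doteq> z @ a @ b @ inv_word b @ inv_word a"
    using icong_left[OF ra, of "z @ a @ b @ inv_word b"] by simp
  also note ab
  finally have 1: "readable z a" by (simp add: readable_def)
  have "z @ a @ b @ inv_word b \<doteq> z @ a @ inv_word a @ a @ b @ inv_word b"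
    using icong_compat[OF icong_sym[OF icong_regular[of a]], of z "b @ inv_word b"] by simp
  \<comment> \<open>Commuting the idempotents \<open>inv_word a @ a\<close> and
    \<open>b @ inv_word b\<close> brings out the path \<open>a @ b\<close> and back, which fixes
    \<open>z\<close>.\<close>
  also have "\<dots> \<doteq> z @ a @ b @ inv_word b @ inv_word a @ a"
    using icong_left[OF icong_commute[of "inv_word a" b], of "z @ a"] by simp
  also have "\<dots> \<doteq> z @ a"
    using icong_right[OF ab, of a] by simp
  finally show "readable z a \<and> readable (z @ a) b" using 1 by (simp add: readable_def)
next
  note [simp] = inv_word_words[of a X] inv_word_words[of b X]
  assume r: "readable z a \<and> readable (z @ a) b"
  have "z @ (a @ b) @ inv_word (a @ b) \<doteq> z @ a @ inv_word a"
    using r icong_right[of "z @ a @ b @ inv_word b" "z @ a" "inv_word a"]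
    by (simp add: readable_def inv_word_append)
  also have "\<dots> \<doteq> z" using r by (simp add: readable_def)
  finally show "readable z (a @ b)" by (simp add: readable_def)
qed

lemma schutz_verts_eq:
  assumes w: "w \<in> words X"
  shows "schutz_verts X R w = {wc z | z. z \<in> words X \<and> z @ inv_word z \<doteq> w @ inv_word w}"
proof -
  have "wc z \<otimes>\<^bsub>Inv_pres X R\<^esub> sg_inv (Inv_pres X R) (wc z) = wc (z @ inv_word z)" if "z \<in> words X" for z
    using sg_inv_word_class[OF pp that] mult_word_class[OF pp that inv_word_words[OF that]] by simp
  moreover have "wc (z @ inv_word z) = wc (w @ inv_word w) \<longleftrightarrow> z @ inv_word z \<doteq> w @ inv_word w"
    if "z \<in> words X" for z
    using that w inv_word_words[of z X] inv_word_words[of w X] by (intro wc_eq_iff) auto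
  ultimately have "wc z \<otimes>\<^bsub>Inv_pres X R\<^esub> sg_inv (Inv_pres X R) (wc z) =
      wc w \<otimes>\<^bsub>Inv_pres X R\<^esub> sg_inv (Inv_pres X R) (wc w) \<longleftrightarrow> z @ inv_word z \<doteq> w @ inv_word w"
    if "z \<in> words X" for z
    using that w by simp
  then show ?thesis unfolding schutz_verts_def Let_def carrier_Inv_pres by blast
qed

text \<open>Every edge of the Schuetzenberger graph of \<open>w\<close> lies on a positive path between two vertices of
  the path labelled \<open>w\<close>: the edges with this property contain the latter path and are closed under
  replacing a path labelled by one side of a relation by the other.\<close>

context
  fixes w :: "'a letter list"
  assumes w: "w \<in> words X"
begin

definition base :: "'a letter list" where
  "base = w @ inv_word w"

text \<open>The factor \<open>base\<close> places each vertex in the Schuetzenberger graph of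
  \<open>w\<close>; a prefix of \<open>w\<close> by itself need not lie there.\<close>

definition anchors :: "'a letter list set" where
  "anchors = {base @ p | p. prefix p w}"

definition edge :: "'a letter list \<Rightarrow> 'a \<Rightarrow> bool" where
  "edge z x \<longleftrightarrow> x \<in> X \<and> (\<exists>a\<in>anchors. \<exists>u\<in>lists X. \<exists>v\<in>lists X. z \<doteq> a @ map Pos u \<and>
     readable a (map Pos (u @ x # v)) \<and> (\<exists>b\<in>anchors. a @ map Pos (u @ x # v) \<doteq> b))"

definition path_step :: "'a \<Rightarrow> ('a letter list set \<times> 'a letter list set) set" where
  "path_step x = {(wc z, wc (z @ [Pos x])) | z. edge z x}"

definition verts_on_paths :: "'a letter list set" where
  "verts_on_paths = {z. \<exists>a\<in>anchors. \<exists>b\<in>anchors. \<exists>u v. u @ v \<in> lists X \<and>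
     z \<doteq> a @ map Pos u \<and> a @ map Pos (u @ v) \<doteq> b}"

lemma base_words: "base \<in> words X"
  using w inv_word_words[OF w] by (simp add: base_def)

lemma anchors_words: "a \<in> anchors \<Longrightarrow> a \<in> words X"
  using w base_words by (auto simp: anchors_def prefix_def)

lemma edgeI:
  assumes "x \<in> X" "a \<in> anchors" "b \<in> anchors" "u \<in> lists X" "v \<in> lists X" "z \<doteq> a @ map Pos u"
    "readable a (map Pos (u @ x # v))" "a @ map Pos (u @ x # v) \<doteq> b"
  shows "edge z x"
  unfolding edge_def using assms by blast

lemma edge_words: "edge z x \<Longrightarrow> z \<in> words X" "edge z x \<Longrightarrow> [Pos x] \<in> words X"
  unfolding edge_def using icong_words by (auto simp: letters_def)

lemma edge_cong: "edge z x \<Longrightarrow> z \<doteq> z' \<Longrightarrow> edge z' x"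
  unfolding edge_def using icong_trans[OF icong_sym] by meson

lemma edge_readable:
  assumes "edge z x"
  shows "readable z [Pos x]"
proof -
  obtain a u v where a: "a \<in> anchors" "u \<in> lists X" "v \<in> lists X" "x \<in> X" "z \<doteq> a @ map Pos u"
    "readable a (map Pos (u @ x # v))"
    using assms unfolding edge_def by blast
  have "readable a (map Pos u @ [Pos x] @ map Pos v)" using a by simp
  then have "readable (a @ map Pos u) ([Pos x] @ map Pos v)"
    using a Pos_words[of u] Pos_words[of "x # v"] anchors_words[of a]
      readable_append[of a "map Pos u" "[Pos x] @ map Pos v"] by simp
  then have "readable (a @ map Pos u) [Pos x]"
    using a Pos_words[of u] Pos_words[of v] Pos_words[of "[x]"] anchors_words[of a]
      readable_append[of "a @ map Pos u" "[Pos x]" "map Pos v"] by simp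
  then show ?thesis using readable_cong icong_sym[OF a(5)] by blast
qed

lemma path_stepI: "edge z x \<Longrightarrow> (wc z, wc (z @ [Pos x])) \<in> path_step x"
  by (auto simp: path_step_def)

lemma path_stepD:
  assumes "(wc z, B) \<in> path_step x" "z \<in> words X"
  shows "edge z x" "B = wc (z @ [Pos x])"
proof -
  obtain z' where z': "wc z = wc z'" "B = wc (z' @ [Pos x])" "edge z' x"
    using assms(1) by (auto simp: path_step_def)
  have eq: "z' \<doteq> z" using z' edge_words[OF z'(3)] assms(2) wc_eq_iff by blast
  show "edge z x" using edge_cong[OF z'(3) eq] .
  show "B = wc (z @ [Pos x])" using wc_eq[OF icong_right[OF eq edge_words(2)[OF z'(3)]]] z'(2) by simp
qed

lemma path_step_single_valued: "single_valued (path_step x)"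
proof (rule single_valuedI)
  fix A B B' assume AB: "(A, B) \<in> path_step x" "(A, B') \<in> path_step x"
  then obtain z where "A = wc z" "z \<in> words X" using edge_words(1) by (auto simp: path_step_def)
  then show "B = B'" using path_stepD(2) AB by metis
qed

lemma edge_target:
  assumes "edge z x"
  shows "z @ [Pos x] @ [Neg x] \<doteq> z"
  using edge_readable[OF assms] by (simp add: readable_def inv_word_def)

lemma path_step_converse_single_valued: "single_valued ((path_step x)\<inverse>)"
proof (rule single_valuedI)
  fix B A A' assume "(B, A) \<in> (path_step x)\<inverse>" "(B, A') \<in> (path_step x)\<inverse>"
  then obtain z z' where z: "A = wc z" "edge z x" "A' = wc z'" "edge z' x"
    and eq: "wc (z @ [Pos x]) = wc (z' @ [Pos x])"
    by (auto simp: path_step_def)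
  have zz: "z @ [Pos x] \<doteq> z' @ [Pos x]"
    using eq wc_eq_iff edge_words z(2,4) by (metis append_in_lists_conv)
  have "z \<doteq> z @ [Pos x] @ [Neg x]" using icong_sym[OF edge_target[OF z(2)]] .
  also have "\<dots> \<doteq> z' @ [Pos x] @ [Neg x]"
    using icong_right[OF zz, of "[Neg x]"] edge_words(2)[OF z(2)] by (simp add: letters_def image_iff)
  also have "\<dots> \<doteq> z'" by (rule edge_target[OF z(4)])
  finally show "A = A'" using wc_eq z by simp
qed

lemma run_path_step:
  assumes "(wc z, B) \<in> run path_step y" "z \<in> words X"
  shows "B = wc (z @ y)"
  using assms
proof (induction y arbitrary: z)
  case (Cons l y)
  then obtain B1 where B1: "(wc z, B1) \<in> lstep path_step l" "(B1, B) \<in> run path_step y" by auto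
  show ?case
  proof (cases l)
    case (Pos x)
    have e: "edge z x" "B1 = wc (z @ [Pos x])" using path_stepD B1(1) Pos Cons.prems(2) by auto
    have "z @ [Pos x] \<in> words X" using edge_words[OF e(1)] by simp
    from Cons.IH[OF _ this, of] B1(2) e(2) have "B = wc ((z @ [Pos x]) @ y)" by blast
    then show ?thesis using Pos by simp
  next
    case (Neg x)
    then obtain z' where z': "B1 = wc z'" "wc z = wc (z' @ [Pos x])" "edge z' x"
      using B1(1) by (auto simp: path_step_def)
    note zw = edge_words[OF z'(3)]
    have N: "[Neg x] \<in> words X" using zw(2) by (simp add: letters_def image_iff)
    have "z \<doteq> z' @ [Pos x]" using z'(2) wc_eq_iff[OF Cons.prems(2), of "z' @ [Pos x]"] zw by simp
    then have "z @ [Neg x] \<doteq> z' @ [Pos x] @ [Neg x]" using icong_right[OF _ N] by fastforce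
    also have "\<dots> \<doteq> z'" by (rule edge_target[OF z'(3)])
    finally have eq: "z @ [Neg x] \<doteq> z'" .
    then have "B1 = wc (z @ [Neg x])" using wc_eq z'(1) by simp
    then have "B = wc ((z @ [Neg x]) @ y)" using Cons.IH B1(2) icong_words(1)[OF eq] by blast
    then show ?thesis using Neg by simp
  qed
qed simp

lemma run_path_step_positive:
  assumes "z \<in> words X"
  shows "(wc z, B) \<in> run path_step (map Pos r) \<longleftrightarrow>
    B = wc (z @ map Pos r) \<and> (\<forall>r1 x r2. r = r1 @ x # r2 \<longrightarrow> edge (z @ map Pos r1) x)"
  using assms
proof (induction r arbitrary: z)
  case Nil
  then show ?case by auto
next
  case (Cons y r)
  show ?case
  proof
    assume "(wc z, B) \<in> run path_step (map Pos (y # r))"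
    then obtain B1 where B1: "(wc z, B1) \<in> path_step y" "(B1, B) \<in> run path_step (map Pos r)" by auto
    note e = path_stepD[OF B1(1) Cons.prems]
    have zy: "z @ [Pos y] \<in> words X" using edge_words[OF e(1)] by simp
    from Cons.IH[OF zy] B1(2) e(2)
    have 1: "B = wc ((z @ [Pos y]) @ map Pos r)"
      "\<And>r1 x r2. r = r1 @ x # r2 \<Longrightarrow> edge ((z @ [Pos y]) @ map Pos r1) x" by auto
    show "B = wc (z @ map Pos (y # r)) \<and> (\<forall>r1 x r2. y # r = r1 @ x # r2 \<longrightarrow> edge (z @ map Pos r1) x)"
      using 1 e(1) by (auto simp: Cons_eq_append_conv)
  next
    assume a: "B = wc (z @ map Pos (y # r)) \<and> (\<forall>r1 x r2. y # r = r1 @ x # r2 \<longrightarrow> edge (z @ map Pos r1) x)"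
    have e: "edge z y" using a by force
    have zy: "z @ [Pos y] \<in> words X" using edge_words[OF e] by simp
    have "edge ((z @ [Pos y]) @ map Pos r1) x" if "r = r1 @ x # r2" for r1 x r2
    proof -
      have "y # r = (y # r1) @ x # r2" using that by simp
      then have "edge (z @ map Pos (y # r1)) x" using a by blast
      then show ?thesis by simp
    qed
    moreover have "B = wc ((z @ [Pos y]) @ map Pos r)" using a by simp
    ultimately have "(wc (z @ [Pos y]), B) \<in> run path_step (map Pos r)"
      unfolding Cons.IH[OF zy] by blast
    then show "(wc z, B) \<in> run path_step (map Pos (y # r))" using path_stepI[OF e] by auto
  qed
qed

lemma edges_readable:
  assumes "z \<in> words X" "\<And>r1 x r2. r = r1 @ x # r2 \<Longrightarrow> edge (z @ map Pos r1) x"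
  shows "readable z (map Pos r)"
  using assms
proof (induction r arbitrary: z)
  case Nil
  then show ?case by (simp add: readable_Nil)
next
  case (Cons y r)
  have e: "edge z y" using Cons.prems(2)[of "[]" y r] by simp
  have zy: "z @ [Pos y] \<in> words X" using edge_words[OF e] by simp
  have er: "edge ((z @ [Pos y]) @ map Pos r1) x" if "r = r1 @ x # r2" for r1 x r2
    using Cons.prems(2)[of "y # r1" x r2] that by simp
  have "readable (z @ [Pos y]) (map Pos r)" by (rule Cons.IH[OF zy er])
  moreover have "x \<in> X" if "x \<in> set r" for x
    using split_list[OF that] er unfolding edge_def by blast
  then have "map Pos r \<in> words X" by (intro Pos_words) auto
  ultimately show ?case
    using edge_readable[OF e] readable_append[of z "[Pos y]" "map Pos r"] edge_words[OF e] by simp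
qed

text \<open>The first edge of a path labelled \<open>r\<close> lies on a positive path from an
  anchor \<open>a\<close>, the last one on a positive path to an anchor \<open>b\<close>. The start
  of the former, the path labelled \<open>s\<close> and the end of the latter form a positive path
  from \<open>a\<close> to \<open>b\<close>, on which all edges of \<open>s\<close> lie.\<close>

lemma run_path_step_relation:
  assumes rs: "r \<noteq> []" "s \<noteq> []" "r \<in> lists X" "s \<in> lists X" "map Pos r \<doteq> map Pos s"
  shows "run path_step (map Pos r) \<subseteq> run path_step (map Pos s)"
proof (rule subrelI)
  fix A B assume AB: "(A, B) \<in> run path_step (map Pos r)"
  obtain z where z: "A = wc z" "z \<in> words X"
    using AB rs(1) edge_words(1) by (cases r) (auto simp: path_step_def)
  from AB have B: "B = wc (z @ map Pos r)"
    and e: "\<And>r1 x r2. r = r1 @ x # r2 \<Longrightarrow> edge (z @ map Pos r1) x"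
    using run_path_step_positive[OF z(2), of B r] z(1) by auto
  note Pw [simp] = Pos_words[OF rs(3)] Pos_words[OF rs(4)]
  have "readable z (map Pos r)" by (rule edges_readable[OF z(2)]) (rule e)
  then have rz: "readable z (map Pos s)" using readable_label_cong rs(5) z(2) by blast
  have zrs: "z @ map Pos r \<doteq> z @ map Pos s" by (rule icong_left[OF rs(5) z(2)])
  have "edge z (hd r)" using e[of "[]" "hd r" "tl r"] rs(1) by simp
  then obtain a u v where a: "a \<in> anchors" "u \<in> lists X" "v \<in> lists X" "hd r \<in> X" "z \<doteq> a @ map Pos u"
    "readable a (map Pos (u @ hd r # v))"
    unfolding edge_def by blast
  have aw [simp]: "a \<in> words X" "map Pos u \<in> words X" using anchors_words a Pos_words by auto
  have au: "readable a (map Pos u)"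
    using a readable_append[of a "map Pos u" "map Pos (hd r # v)"] Pos_words[of "hd r # v"] by simp
  have "edge (z @ map Pos (butlast r)) (last r)" using e[of "butlast r" "last r" "[]"] rs(1) by simp
  then obtain a' u' v' b where a': "a' \<in> anchors" "u' \<in> lists X" "v' \<in> lists X" "last r \<in> X"
    "z @ map Pos (butlast r) \<doteq> a' @ map Pos u'"
    "readable a' (map Pos (u' @ last r # v'))" "b \<in> anchors" "a' @ map Pos (u' @ last r # v') \<doteq> b"
    unfolding edge_def by blast
  have a'w: "a' \<in> words X" "map Pos (u' @ [last r]) \<in> words X" "map Pos v' \<in> words X"
    using anchors_words a' Pos_words[of "u' @ [last r]"] Pos_words[of v'] by auto
  have lr: "map Pos (butlast r) @ [Pos (last r)] = map Pos r"
    using rs(1) by (metis append_butlast_last_id list.simps(8,9) map_append)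
  have zr: "z @ map Pos r \<doteq> a' @ map Pos (u' @ [last r])"
    using icong_right[OF a'(5), of "[Pos (last r)]"] Pos_words[of "[last r]"] a'(4) lr by simp
  have "readable (a' @ map Pos (u' @ [last r])) (map Pos v')"
    using a'(6) readable_append[OF a'w] by simp
  then have rv': "readable (z @ map Pos s) (map Pos v')"
    using readable_cong icong_trans[OF icong_sym[OF zr] zrs] by blast
  have "z @ map Pos s @ map Pos v' \<doteq> a' @ map Pos (u' @ [last r]) @ map Pos v'"
    using icong_right[OF icong_trans[OF icong_sym[OF zrs] zr] a'w(3)] by simp
  also have "\<dots> \<doteq> b" using a'(8) by simp
  finally have zsv: "z @ map Pos s @ map Pos v' \<doteq> b" .
  have aus: "a @ map Pos u @ map Pos s \<doteq> z @ map Pos s"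
    using icong_right[OF icong_sym[OF a(5)] Pw(2)] by simp
  have "readable (a @ map Pos u) (map Pos s)" using readable_cong[OF rz a(5)] .
  moreover have "readable (a @ map Pos u @ map Pos s) (map Pos v')"
    using readable_cong[OF rv' icong_sym[OF aus]] .
  ultimately have rd: "readable a (map Pos u @ map Pos s @ map Pos v')"
    using au a'w(3) readable_append[of a "map Pos u" "map Pos s @ map Pos v'"]
      readable_append[of "a @ map Pos u" "map Pos s" "map Pos v'"] by simp
  have end_b: "a @ map Pos u @ map Pos s @ map Pos v' \<doteq> b"
    using icong_trans[OF icong_right[OF aus a'w(3)]] zsv by simp
  have "edge (z @ map Pos s1) x" if s: "s = s1 @ x # s2" for s1 x s2
  proof (rule edgeI)
    show "x \<in> X" "u @ s1 \<in> lists X" "s2 @ v' \<in> lists X" "a \<in> anchors" "b \<in> anchors"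
      using rs(4) s a a' by auto
    show "z @ map Pos s1 \<doteq> a @ map Pos (u @ s1)"
      using icong_right[OF a(5), of "map Pos s1"] Pos_words[of s1] rs(4) s by simp
    show "readable a (map Pos ((u @ s1) @ x # s2 @ v'))" using rd s by simp
    show "a @ map Pos ((u @ s1) @ x # s2 @ v') \<doteq> b" using end_b s by simp
  qed
  then show "(A, B) \<in> run path_step (map Pos s)"
    using run_path_step_positive[OF z(2)] z(1) B wc_eq[OF zrs] by auto
qed

lemma run_path_step_icong: "u \<doteq> v \<Longrightarrow> run path_step u = run path_step v"
  unfolding icong_def
proof (rule run_inv_cong[OF path_step_single_valued path_step_converse_single_valued])
  fix r s assume rs: "(r, s) \<in> R"
  then have "r \<noteq> []" "s \<noteq> []" "r \<in> lists X" "s \<in> lists X"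
    using pp by (auto simp: positive_presentation_def)
  moreover have "map Pos r \<doteq> map Pos s" unfolding icong_def by (rule inv_cong.relation[OF rs])
  ultimately show "run path_step (map Pos r) = run path_step (map Pos s)"
    using run_path_step_relation[of r s] run_path_step_relation[of s r] icong_sym by blast
qed

lemma readable_base: "readable base w"
proof -
  note [simp] = w inv_word_words[OF w]
  have "base @ w @ inv_word w \<doteq> w @ inv_word w"
    using icong_right[OF icong_regular[OF w], of "inv_word w"] by (simp add: base_def)
  then show ?thesis by (simp add: readable_def base_def)
qed

text \<open>Each edge of the path labelled \<open>w\<close> joins two anchors, so by itself it is a
  positive path of length one, oriented by the sign of its letter.\<close>

lemma run_path_step_base:
  "w = p @ q \<Longrightarrow> (wc (base @ p), wc (base @ w)) \<in> run path_step q"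
proof (induction q arbitrary: p)
  case (Cons l q)
  have pl: "p \<in> words X" "[l] \<in> words X" "q \<in> words X" using w Cons.prems by auto
  note bw = base_words
  have r: "readable (base @ p) [l]"
    using readable_base Cons.prems readable_append[of base p "l # q"]
      readable_append[of "base @ p" "[l]" q] bw pl by simp
  have anch: "base @ p \<in> anchors" "base @ p @ [l] \<in> anchors"
    unfolding anchors_def using Cons.prems by (auto intro!: exI[of _ p] exI[of _ "p @ [l]"])
  have refl: "base @ p @ [l] \<doteq> base @ p @ [l]" by (rule icong_refl) (use bw pl in simp)
  have IH: "(wc (base @ p @ [l]), wc (base @ w)) \<in> run path_step q"
    using Cons.IH[of "p @ [l]"] Cons.prems by simp
  have "(wc (base @ p), wc (base @ p @ [l])) \<in> lstep path_step l"
  proof (cases l)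
    case (Pos x)
    have "edge (base @ p) x"
    proof (rule edgeI[where a = "base @ p" and u = "[]" and v = "[]" and b = "base @ p @ [l]"])
      show "x \<in> X" using pl(2) Pos by (auto simp: letters_def)
      show "base @ p \<doteq> (base @ p) @ map Pos []" using bw pl by (simp add: icong_refl)
      show "readable (base @ p) (map Pos ([] @ [x]))" using r Pos by simp
      show "(base @ p) @ map Pos ([] @ [x]) \<doteq> base @ p @ [l]" using refl Pos by simp
    qed (use anch in auto)
    from path_stepI[OF this] show ?thesis using Pos by simp
  next
    case (Neg x)
    have x: "x \<in> X" "[Pos x] \<in> words X" using pl(2) Neg by (auto simp: letters_def)
    have eq: "base @ p @ [Neg x] @ [Pos x] \<doteq> base @ p"
      using r Neg by (simp add: readable_def inv_word_def)
    have "edge (base @ p @ [Neg x]) x"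
    proof (rule edgeI[where a = "base @ p @ [Neg x]" and u = "[]" and v = "[]" and b = "base @ p"])
      show "base @ p @ [Neg x] \<doteq> (base @ p @ [Neg x]) @ map Pos []"
        using bw pl Neg by (simp add: icong_refl)
      show "readable (base @ p @ [Neg x]) (map Pos ([] @ [x]))"
        using icong_right[OF eq, of "[Neg x]"] pl Neg by (simp add: readable_def inv_word_def)
      show "(base @ p @ [Neg x]) @ map Pos ([] @ [x]) \<doteq> base @ p" using eq by simp
    qed (use anch x Neg in auto)
    from path_stepI[OF this] have "(wc (base @ p @ [Neg x]), wc (base @ p)) \<in> path_step x"
      using wc_eq[OF eq] by simp
    then show ?thesis using Neg by simp
  qed
  then show ?case using IH by auto
qed simp

lemma edge_verts_on_paths:
  assumes "edge z x"
  shows "z \<in> verts_on_paths" "z @ [Pos x] \<in> verts_on_paths"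
proof -
  obtain a u v b where a: "a \<in> anchors" "u \<in> lists X" "v \<in> lists X" "x \<in> X" "z \<doteq> a @ map Pos u"
    "b \<in> anchors" "a @ map Pos (u @ x # v) \<doteq> b"
    using assms unfolding edge_def by blast
  show "z \<in> verts_on_paths"
    unfolding verts_on_paths_def using a
    by (intro CollectI bexI[of _ a] bexI[of _ b] exI[of _ u] exI[of _ "x # v"]) auto
  have "z @ [Pos x] \<doteq> a @ map Pos (u @ [x])"
    using icong_right[OF a(5), of "[Pos x]"] a(4) by (simp add: letters_def)
  then show "z @ [Pos x] \<in> verts_on_paths"
    unfolding verts_on_paths_def using a
    by (intro CollectI bexI[of _ a] bexI[of _ b] exI[of _ "u @ [x]"] exI[of _ v]) auto
qed

lemma run_path_step_verts:
  "(A, B) \<in> run path_step y \<Longrightarrow> A \<in> wc ` verts_on_paths \<Longrightarrow> B \<in> wc ` verts_on_paths"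
proof (induction y arbitrary: A)
  case (Cons l y)
  then obtain B1 where B1: "(A, B1) \<in> lstep path_step l" "(B1, B) \<in> run path_step y" by auto
  then have "B1 \<in> wc ` verts_on_paths"
    using edge_verts_on_paths by (cases l) (auto simp: path_step_def)
  then show ?case using Cons.IH B1(2) by blast
qed simp

text \<open>Going along \<open>w\<close> and back fixes the class of \<open>base\<close>, so by
  invariance \<open>z @ inv_word z\<close> does too. Hence \<open>z\<close> can be traversed from
  \<open>base\<close> along edges of positive paths, and it ends at the class of
  \<open>z\<close>.\<close>

lemma schutz_verts_subset: "schutz_verts X R w \<subseteq> wc ` verts_on_paths"
proof
  fix m assume "m \<in> schutz_verts X R w"
  then obtain z where z: "m = wc z" "z \<in> words X" "z @ inv_word z \<doteq> w @ inv_word w"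
    using schutz_verts_eq[OF w] by auto
  have "(wc base, wc (base @ w)) \<in> run path_step w" using run_path_step_base[of "[]" w] by simp
  then have "(wc base, wc base) \<in> run path_step (w @ inv_word w)"
    by (auto simp: run_append run_inv_word)
  then have "(wc base, wc base) \<in> run path_step (z @ inv_word z)" using run_path_step_icong[OF z(3)] by simp
  then obtain B where B: "(wc base, B) \<in> run path_step z" by (auto simp: run_append)
  have "base @ z \<doteq> z @ inv_word z @ z"
    using icong_right[OF icong_sym[OF z(3)] z(2)] by (simp add: base_def)
  also have "\<dots> \<doteq> z" by (rule icong_regular[OF z(2)])
  finally have "B = m" using run_path_step[OF B base_words] wc_eq z(1) by simp
  have "base \<in> anchors" by (auto simp: anchors_def)
  then have "base \<in> verts_on_paths"
    unfolding verts_on_paths_def using base_words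
    by (intro CollectI bexI[of _ base] exI[of _ "[]"]) (auto intro: icong_refl)
  then show "m \<in> wc ` verts_on_paths" using run_path_step_verts[OF B] \<open>B = m\<close> by blast
qed

lemma finite_verts_on_paths:
  assumes fin: "\<And>a b. finite {y \<in> lists X. a @ map Pos y \<doteq> b}"
  shows "finite (wc ` verts_on_paths)"
proof -
  define L where "L a b = {y \<in> lists X. a @ map Pos y \<doteq> b}" for a b
  have "anchors \<subseteq> (\<lambda>p. base @ p) ` set (prefixes w)" by (auto simp: anchors_def)
  then have A: "finite anchors" by (rule finite_subset) simp
  have sub: "wc ` verts_on_paths \<subseteq>
      (\<Union>a\<in>anchors. \<Union>b\<in>anchors. (\<lambda>u. wc (a @ map Pos u)) ` (\<Union>y\<in>L a b. set (prefixes y)))"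
  proof
    fix m assume "m \<in> wc ` verts_on_paths"
    then obtain z where z: "m = wc z" "z \<in> verts_on_paths" by blast
    from z(2) obtain a b u v where a: "a \<in> anchors" "b \<in> anchors" "u @ v \<in> lists X"
      "z \<doteq> a @ map Pos u" "a @ map Pos (u @ v) \<doteq> b"
      unfolding verts_on_paths_def by blast
    have "u @ v \<in> L a b" using a by (simp add: L_def)
    moreover have "u \<in> set (prefixes (u @ v))" by simp
    ultimately have "u \<in> (\<Union>y\<in>L a b. set (prefixes y))" by blast
    moreover have "m = wc (a @ map Pos u)" using wc_eq[OF a(4)] z(1) by simp
    ultimately show "m \<in> (\<Union>a\<in>anchors. \<Union>b\<in>anchors. (\<lambda>u. wc (a @ map Pos u)) ` (\<Union>y\<in>L a b. set (prefixes y)))"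
      using a(1,2) by blast
  qed
  have "finite (L a b)" for a b using fin by (simp add: L_def)
  then show ?thesis using A by (intro finite_subset[OF sub] finite_UN_I finite_imageI) auto
qed

end

end

section \<open>Finiteness of the labels and of the complex\<close>

sublocale bs_presentation \<subseteq> adian_semigroup D
  by unfold_locales (use sym_D D_words walk_forest_hd walk_forest_last finite_class in auto)

text \<open>Two such labels become congruent words after the prefix \<open>a\<close>; by the
  embedding they are congruent in the semigroup, so all of them lie in one finite class.\<close>

lemma (in bs_presentation) finite_positive_labels:
  "finite {y \<in> lists X. (a @ map Pos y, b) \<in> inv_cong X R}"
proof (cases "{y \<in> lists X. (a @ map Pos y, b) \<in> inv_cong X R} = {}")
  case False
  then have "\<exists>y0. (a @ map Pos y0, b) \<in> inv_cong X R" by blast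
  then obtain y0 where y0: "(a @ map Pos y0, b) \<in> inv_cong X R" by blast
  have "{y \<in> lists X. (a @ map Pos y, b) \<in> inv_cong X R} \<subseteq> {y. (y0, y) \<in> scong D}"
  proof
    fix y assume "y \<in> {y \<in> lists X. (a @ map Pos y, b) \<in> inv_cong X R}"
    then have "(a @ map Pos y0, a @ map Pos y) \<in> inv_cong X R"
      using inv_cong.trans[OF y0] inv_cong.sym by blast
    then show "y \<in> {y. (y0, y) \<in> scong D}"
      using group_embedding[of R a y0 y X] by (simp add: D_def)
  qed
  then show ?thesis using finite_class by (rule finite_subset)
next
  case True
  then show ?thesis by (simp only: finite.emptyI)
qed

theorem theorem4p1:
  fixes X :: "'a set" and R :: "'a relations"
  assumes "positive_presentation X R"
    and "finite X" and "finite R"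
    and "adian X R"
    and "condition_star R"
    and "bs_no_closed_path R"
  shows "\<forall>w \<in> words X. finite_complex (schutz_complex X R w)"
proof
  fix w assume w: "w \<in> words X"
  interpret bs_presentation X R "R \<union> R\<inverse>" by unfold_locales (use assms in auto)
  have V: "finite (schutz_verts X R w)"
    using finite_subset[OF schutz_verts_subset[OF assms(1) w]
        finite_verts_on_paths[OF assms(1) w finite_positive_labels[folded icong_def[OF assms(1)]]]] .
  have "finite (letters X)" using assms(2) by (simp add: letters_def)
  then have "finite (schutz_verts X R w \<times> letters X \<times> schutz_verts X R w)" using V by simp
  moreover have "arcs (schutz_graph X R w) \<subseteq> schutz_verts X R w \<times> letters X \<times> schutz_verts X R w"
    unfolding schutz_graph_def pre_digraph.simps by blast
  ultimately have "finite (arcs (schutz_graph X R w))" by (rule finite_subset[rotated])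
  moreover have "faces (schutz_complex X R w) \<subseteq> schutz_verts X R w \<times> R"
    unfolding schutz_complex_def Let_def two_complex.simps schutz_graph_def pre_digraph.simps by blast
  then have "finite (faces (schutz_complex X R w))"
    by (rule finite_subset) (use V assms(3) in simp)
  moreover have "skeleton (schutz_complex X R w) = schutz_graph X R w"
    unfolding schutz_complex_def Let_def two_complex.simps ..
  moreover have "verts (schutz_graph X R w) = schutz_verts X R w"
    unfolding schutz_graph_def pre_digraph.simps ..
  ultimately show "finite_complex (schutz_complex X R w)"
    using V by (simp only: finite_complex_def)
qed

end
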